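(* There is a second-order phase transition of the Lyapunov exponent $\lambda$ at the critical point $(\rho_c,\beta_c)$. At this point all second order partial derivatives of $\lambda(\rho,\beta)$ are infinite.
   Context: For $\rho>0,\beta>0$ the Lyapunov exponent is $\lambda(\rho,\beta)=\lim_{n\to\infty}\frac1n\log\mathbb{E}[x_n]$, where $x_{i+1}=a_ix_i$, $x_0>0$ deterministic, $a_i=1+\rho e^{\sigma W(t_i)-\frac12\sigma^2t_i}$, $t_i=i\tau$, $W$ is a standard Brownian motion, and the limit is taken with $\frac12\sigma^2\tau n^2=\beta$ fixed. The limit exists and equals $$\lambda(\rho,\beta)=\sup_{g}\left\{g(1)\log\rho+\beta\int_0^1(g(1)-g(x))^2dx-\int_0^1 I(g'(x))dx\right\},$$ the supremum being over absolutely continuous $g:[0,1]\to[0,1]$ with $g(0)=0$, $0\le g'\le1$ almost everywhere, and $I(x)=x\log x+(1-x)\log(1-x)$ ($0\log0=0$). Critical point: for $a>\log\rho$ let $$F(a;\rho)=\int_{\log\rho}^{a}\frac{dx}{\sqrt{\log\frac{1+e^a}{1+e^x}}},$$ and $\rho_c:=\sup\{\rho>0:\ \exists a,\ \frac{\partial}{\partial a}F(a;\rho)<0\}$, which satisfies $0<\rho_c<\infty$. There exists some $a_c$ with $\frac{\partial}{\partial a}F(a_c;\rho_c)=0$; fix such an $a_c$ and define $\beta_c$ by $2\sqrt{\beta_c}=F(a_c;\rho_c)$. Definition of phases: a phase is a connected region of the parameter space $\{(\rho,\beta)\}=(0,\infty)^2$, maximal for the condition that $\lambda(\rho,\beta)$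 is analytic. There is a $j$th-order phase transition at a boundary point of a phase if at least one $j$th-order partial derivative of $\lambda(\rho,\beta)$ is discontinuous there, while all lower order derivatives are continuous. A second order partial derivative being infinite at $(\rho_c,\beta_c)$ means that it diverges to infinity as $(\rho,\beta)\to(\rho_c,\beta_c)$ through points off the phase transition curve (points where $\lambda$ is analytic). *)

theory Defs
  imports "HOL-Probability.Probability"
begin

definition standard_brownian_motion :: "'a measure \<Rightarrow> (real \<Rightarrow> 'a \<Rightarrow> real) \<Rightarrow> bool" where
  "standard_brownian_motion M W \<longleftrightarrow>
     prob_space M \<and>
     (\<forall>t\<ge>0. W t \<in> borel_measurable M) \<and>
     (AE \<omega> in M. W 0 \<omega> = 0) \<and>
     (\<forall>(n::nat) (t::nat \<Rightarrow> real). 0 \<le> t 0 \<and> (\<forall>i<n. t i < t (Suc i)) \<longrightarrow>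
        prob_space.indep_vars M (\<lambda>_. borel) (\<lambda>i \<omega>. W (t (Suc i)) \<omega> - W (t i) \<omega>) {..<n}) \<and>
     (\<forall>s t. 0 \<le> s \<and> s < t \<longrightarrow>
        distributed M lborel (\<lambda>\<omega>. W t \<omega> - W s \<omega>) (normal_density 0 (sqrt (t - s)))) \<and>
     (AE \<omega> in M. continuous_on {0..} (\<lambda>t. W t \<omega>))"

primrec growth ::
  "(real \<Rightarrow> 'a \<Rightarrow> real) \<Rightarrow> real \<Rightarrow> real \<Rightarrow> real \<Rightarrow> real \<Rightarrow> nat \<Rightarrow> 'a \<Rightarrow> real" where
  "growth W x0 \<rho> \<sigma> \<tau> 0 \<omega> = x0"
| "growth W x0 \<rho> \<sigma> \<tau> (Suc i) \<omega> =
     (let t = real i * \<tau> in 1 + \<rho> * exp (\<sigma> * W t \<omega> - 1/2 * \<sigma>\<^sup>2 * t)) * growth W x0 \<rho> \<sigma> \<tau> i \<omega>"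

text \<open>
  The volatility and the time step may both depend on \<open>n\<close>; the limit is required to be the
  same for every choice that keeps \<open>\<sigma>\<^sup>2 \<tau> n\<^sup>2 / 2\<close> equal to \<open>\<beta>\<close>.
\<close>

definition has_lyapunov_exponent ::
  "'a measure \<Rightarrow> (real \<Rightarrow> 'a \<Rightarrow> real) \<Rightarrow> real \<Rightarrow> real \<Rightarrow> real \<Rightarrow> real \<Rightarrow> bool" where
  "has_lyapunov_exponent M W x0 \<rho> \<beta> L \<longleftrightarrow>
     (\<forall>\<sigma> \<tau> :: nat \<Rightarrow> real.
        (\<forall>n\<ge>1. \<sigma> n > 0 \<and> \<tau> n > 0 \<and> 1/2 * (\<sigma> n)\<^sup>2 * \<tau> n * (real n)\<^sup>2 = \<beta>) \<longrightarrow>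
        (\<lambda>n. 1 / real n * ln (\<integral>\<omega>. growth W x0 \<rho> (\<sigma> n) (\<tau> n) n \<omega> \<partial>M)) \<longlonglongrightarrow> L)"

definition lyapunov_exponent ::
  "'a measure \<Rightarrow> (real \<Rightarrow> 'a \<Rightarrow> real) \<Rightarrow> real \<Rightarrow> real \<times> real \<Rightarrow> real" where
  "lyapunov_exponent M W x0 = (\<lambda>(\<rho>, \<beta>). THE L. has_lyapunov_exponent M W x0 \<rho> \<beta> L)"

text \<open>
  The integrand has an integrable singularity at \<open>x = a\<close>; its value there (\<open>1 / 0 = 0\<close>) is
  irrelevant.
\<close>

definition F :: "real \<Rightarrow> real \<Rightarrow> real" where
  "F a \<rho> = integral {ln \<rho>..a} (\<lambda>x. 1 / sqrt (ln ((1 + exp a) / (1 + exp x))))"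

definition rho_c :: real where
  "rho_c = Sup {\<rho>. \<rho> > 0 \<and> (\<exists>a > ln \<rho>. \<exists>D < 0. ((\<lambda>b. F b \<rho>) has_real_derivative D) (at a))}"

text \<open>
  Directions are the elements of \<open>Basis\<close>, i.e. \<open>(1, 0)\<close> and \<open>(0, 1)\<close>; the head of the list is
  the direction differentiated last.
\<close>

primrec partial :: "(real \<times> real) list \<Rightarrow> (real \<times> real \<Rightarrow> real) \<Rightarrow> real \<times> real \<Rightarrow> real" where
  "partial [] f p = f p"
| "partial (v # vs) f p = deriv (\<lambda>t. partial vs f (p + t *\<^sub>R v)) 0"

primrec partial_exists ::
  "(real \<times> real) list \<Rightarrow> (real \<times> real \<Rightarrow> real) \<Rightarrow> real \<times> real \<Rightarrow> bool" where
  "partial_exists [] f p \<longleftrightarrow> True"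
| "partial_exists (v # vs) f p \<longleftrightarrow>
     (\<forall>\<^sub>F t in nhds 0. partial_exists vs f (p + t *\<^sub>R v)) \<and>
     (\<lambda>t. partial vs f (p + t *\<^sub>R v)) differentiable (at 0)"

text \<open>
  A partial derivative is a function on the set of points where it exists. It is continuous at
  \<open>p\<close> if \<open>p\<close> belongs to that set and it is continuous at \<open>p\<close> relative to that set.
\<close>

definition partial_continuous_at ::
  "(real \<times> real) list \<Rightarrow> (real \<times> real \<Rightarrow> real) \<Rightarrow> real \<times> real \<Rightarrow> bool" where
  "partial_continuous_at vs f p \<longleftrightarrow>
     partial_exists vs f p \<and> continuous (at p within {q. partial_exists vs f q}) (partial vs f)"

definition real_analytic_at :: "(real \<times> real \<Rightarrow> real) \<Rightarrow> real \<times> real \<Rightarrow> bool" where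
  "real_analytic_at f p \<longleftrightarrow>
     (\<exists>(c :: nat \<Rightarrow> nat \<Rightarrow> real) r. r > 0 \<and>
        (\<forall>h k. \<bar>h\<bar> < r \<and> \<bar>k\<bar> < r \<longrightarrow>
           ((\<lambda>(i, j). c i j * h ^ i * k ^ j) has_sum f (p + (h, k))) UNIV))"

definition parameter_space :: "(real \<times> real) set" where
  "parameter_space = {0<..} \<times> {0<..}"

definition analytic_points :: "(real \<times> real \<Rightarrow> real) \<Rightarrow> (real \<times> real) set" where
  "analytic_points f = {p \<in> parameter_space. real_analytic_at f p}"

definition analytic_region :: "(real \<times> real \<Rightarrow> real) \<Rightarrow> (real \<times> real) set \<Rightarrow> bool" where
  "analytic_region f P \<longleftrightarrow> P \<noteq> {} \<and> open P \<and> connected P \<and> P \<subseteq> analytic_points f"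

definition is_phase :: "(real \<times> real \<Rightarrow> real) \<Rightarrow> (real \<times> real) set \<Rightarrow> bool" where
  "is_phase f P \<longleftrightarrow> analytic_region f P \<and> (\<forall>Q. analytic_region f Q \<and> P \<subseteq> Q \<longrightarrow> Q = P)"

definition phase_transition :: "nat \<Rightarrow> (real \<times> real \<Rightarrow> real) \<Rightarrow> real \<times> real \<Rightarrow> bool" where
  "phase_transition j f p \<longleftrightarrow>
     p \<in> parameter_space \<and>
     (\<exists>P. is_phase f P \<and> p \<in> frontier P) \<and>
     (\<exists>vs. set vs \<subseteq> Basis \<and> length vs = j \<and> \<not> partial_continuous_at vs f p) \<and>
     (\<forall>vs. set vs \<subseteq> Basis \<and> length vs < j \<longrightarrow> partial_continuous_at vs f p)"

text \<open>
  Divergence is to \<open>+\<infinity>\<close>, not merely in absolute value; the approach avoids the points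
  where \<open>f\<close> fails to be analytic.
\<close>

definition partial_infinite_at ::
  "(real \<times> real) list \<Rightarrow> (real \<times> real \<Rightarrow> real) \<Rightarrow> real \<times> real \<Rightarrow> bool" where
  "partial_infinite_at vs f p \<longleftrightarrow>
     filterlim (partial vs f) at_top (at p within analytic_points f)"

end

(*
  Expanding the product and integrating out the Brownian increments turns the expectation of x_n into a
  lattice gas partition function with interaction beta / n^2 * SUM_m (N_m^2 - N_m), N_m being the number of
  occupied sites beyond m. Linearising N_m^2 >= 2 b N_m - b^2, with a net of step functions b for the
  converse bound, reduces the exponent to a finite-dimensional maximisation. Its maximisers
  conserve an energy up to O(1/n). In the limit they are encoded by one number m > 0 solving
  K(m, R) = sqrt beta, where R = ln (1 + rho) and K(m, R) = INT_0^m psi (R + m^2 - s^2) ds with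
  psi u = 1 / (1 - exp (- u)), and F a rho = 2 K (sqrt (ln (1 + exp a) - R), R). The exponent f is convex in
  (ln rho, beta), and each m yields a subgradient: f_rho = m / (rho sqrt beta) and
  f_beta = (R + m^2 - f) / (2 beta) wherever these derivatives exist.

  At the critical point K(., R_c) is strictly increasing (identity theorem), so m is unique there and varies
  continuously, which makes the first derivatives continuous. At an analytic point, differentiating
  K = sqrt beta gives K_m * m_beta = 1 / (2 sqrt beta); convexity forces K_m > 0, and K_m tends to 0 at the
  critical point, so m_beta, and with it every second derivative, tends to +infinity. Where m is unique and
  K_m is nonzero, a holomorphic Newton iteration shows that f is analytic. This applies to a vertical segment
  ending at the critical point, hence that point lies on the frontier of a phase.
*)

theory Submission
  imports Defs "HOL-Complex_Analysis.Complex_Analysis" "HOL-Real_Asymp.Real_Asymp"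
begin

section \<open>The partition function\<close>

text \<open>Origin of the transit integral: in the continuum limit a maximiser satisfies b' = -sig
  with b(1) = 0, where sig = 1 - exp(-u) = 1 / psi(u) is the occupation probability at energy u. The
  conserved quantity u + \<beta> b^2 equals R + m^2 with m = sqrt(\<beta>) b(0). For s =
  sqrt(\<beta>) b this reads psi(R + m^2 - s^2) ds = -sqrt(\<beta>) dx, and integrating over the
  unit interval gives K(m, R) = sqrt(\<beta>). The obstacle is that for small \<rho> this equation
  can have several roots m, whose values would have to be compared in order to locate the transition
  curve. Convexity avoids this: where a partial derivative of f exists, it agrees with the component
  of every subgradient, so any choice of a maximiser is the right one there. The second derivatives
  are then computed at analytic points from identities that hold around them, and K_m > 0 is a
  conclusion of that computation instead of an assumption.\<close>

definition tail_count :: "nat set \<Rightarrow> nat \<Rightarrow> nat" where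
  "tail_count S m = card {i \<in> S. m < i}"

text \<open>Increment \<open>m\<close> of the Brownian path is shared by the sites beyond
  \<open>m\<close>. With \<open>N = tail_count S m\<close>, its Gaussian moment contributes
  \<open>N\<^sup>2\<close>, and the drift \<open>- \<sigma>\<^sup>2 t / 2\<close>, split into the
  same steps, contributes \<open>- N\<close>.\<close>

definition partition_fun :: "nat \<Rightarrow> real \<Rightarrow> real \<Rightarrow> real" where
  "partition_fun n \<theta> \<beta> = (\<Sum>S\<in>Pow {..<n}. exp (\<theta> * real (card S)
      + \<beta> / (real n)\<^sup>2 * (\<Sum>m<n. (real (tail_count S m))\<^sup>2 - real (tail_count S m))))"

text \<open>Exchange of summation: index \<open>m\<close> is met once for every \<open>i\<close> in
  \<open>S\<close> beyond it. With the increments as \<open>f\<close> this expands \<open>W\<close>,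
  with the constant 1 it expands the drift.\<close>

lemma sum_prefix_sums:
  fixes f :: "nat \<Rightarrow> real"
  assumes "S \<subseteq> {..<n}"
  shows "(\<Sum>i\<in>S. \<Sum>m<i. f m) = (\<Sum>m<n. real (tail_count S m) * f m)"
proof -
  have fin: "finite S" using assms finite_subset by blast
  have "(\<Sum>i\<in>S. \<Sum>m<i. f m) = (\<Sum>i\<in>S. \<Sum>m<n. if m < i then f m else 0)"
  proof (rule sum.cong[OF refl])
    fix i assume "i \<in> S"
    then have "{m \<in> {..<n}. m < i} = {..<i}" using assms by auto
    then show "(\<Sum>m<i. f m) = (\<Sum>m<n. if m < i then f m else 0)"
      by (simp flip: sum.inter_filter)
  qed
  also have "\<dots> = (\<Sum>m<n. \<Sum>i\<in>S. if m < i then f m else 0)" by (rule sum.swap)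
  also have "\<dots> = (\<Sum>m<n. real (tail_count S m) * f m)"
    using fin by (simp add: tail_count_def flip: sum.inter_filter)
  finally show ?thesis .
qed

text \<open>Completing the square: the exponential weight moves the mean to
  \<open>c * s\<^sup>2\<close> and leaves a constant in front of a normalised density.\<close>

lemma exp_normal_density:
  assumes "s > 0"
  shows "normal_density 0 s x * exp (c * x) = exp (c\<^sup>2 * s\<^sup>2 / 2) * normal_density (c * s\<^sup>2) s x"
proof -
  have "- (x - 0)\<^sup>2 / (2 * s\<^sup>2) + c * x = c\<^sup>2 * s\<^sup>2 / 2 + - (x - c * s\<^sup>2)\<^sup>2 / (2 * s\<^sup>2)"
    using assms by (simp add: field_simps power2_eq_square)
  then show ?thesis
    unfolding normal_density_def by (simp add: mult_exp_exp)
qed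

context prob_space begin

lemma
  assumes X: "distributed M lborel X (normal_density 0 s)" and s: "s > 0"
  shows integrable_exp_normal: "integrable M (\<lambda>x. exp (c * X x))"
    and expectation_exp_normal: "expectation (\<lambda>x. exp (c * X x)) = exp (c\<^sup>2 * s\<^sup>2 / 2)"
proof -
  have *: "(\<lambda>x. normal_density 0 s x * exp (c * x)) =
      (\<lambda>x. exp (c\<^sup>2 * s\<^sup>2 / 2) * normal_density (c * s\<^sup>2) s x)"
    using s by (simp add: exp_normal_density fun_eq_iff)
  have "integrable lborel (\<lambda>x. normal_density 0 s x * exp (c * x))"
    unfolding * using s by simp
  then show "integrable M (\<lambda>x. exp (c * X x))"
    using distributed_integrable[OF X, of "\<lambda>x. exp (c * x)"] by simp
  have "(\<integral>x. normal_density 0 s x * exp (c * x) \<partial>lborel) = exp (c\<^sup>2 * s\<^sup>2 / 2)"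
    unfolding * using s by simp
  then show "expectation (\<lambda>x. exp (c * X x)) = exp (c\<^sup>2 * s\<^sup>2 / 2)"
    using distributed_integral[OF X, of "\<lambda>x. exp (c * x)"] by simp
qed

end

lemma growth_eq_prod:
  "growth W x0 \<rho> \<sigma> \<tau> n \<omega> =
     x0 * (\<Prod>i<n. 1 + \<rho> * exp (\<sigma> * W (real i * \<tau>) \<omega> - 1/2 * \<sigma>\<^sup>2 * (real i * \<tau>)))"
  by (induction n) (simp_all add: Let_def mult_ac)

lemma growth_eq_sum:
  "growth W x0 \<rho> \<sigma> \<tau> n \<omega> = x0 * (\<Sum>S\<in>Pow {..<n}.
     \<Prod>i\<in>S. \<rho> * exp (\<sigma> * W (real i * \<tau>) \<omega> - 1/2 * \<sigma>\<^sup>2 * (real i * \<tau>)))"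
proof -
  have "(\<Prod>i<n. 1 + \<rho> * exp (\<sigma> * W (real i * \<tau>) \<omega> - 1/2 * \<sigma>\<^sup>2 * (real i * \<tau>)))
     = (\<Prod>i<n. \<rho> * exp (\<sigma> * W (real i * \<tau>) \<omega> - 1/2 * \<sigma>\<^sup>2 * (real i * \<tau>)) + 1)"
    by (simp add: add.commute)
  then show ?thesis
    unfolding growth_eq_prod by (simp only: prod_add finite_lessThan) simp
qed

lemma expectation_growth:
  fixes W :: "real \<Rightarrow> 'a \<Rightarrow> real"
  assumes bm: "standard_brownian_motion M W" and \<rho>: "\<rho> > 0" and \<tau>: "\<tau> > 0" and n: "n \<ge> 1"
    and \<beta>: "1/2 * \<sigma>\<^sup>2 * \<tau> * (real n)\<^sup>2 = \<beta>"
  shows "(\<integral>\<omega>. growth W x0 \<rho> \<sigma> \<tau> n \<omega> \<partial>M) = x0 * partition_fun n (ln \<rho>) \<beta>"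
proof -
  interpret prob_space M using bm by (simp add: standard_brownian_motion_def)
  define \<Delta> where "\<Delta> m \<omega> = W (real (Suc m) * \<tau>) \<omega> - W (real m * \<tau>) \<omega>" for m \<omega>
  have \<beta>': "1/2 * \<sigma>\<^sup>2 * \<tau> = \<beta> / (real n)\<^sup>2"
    using n \<beta> by (simp add: field_simps)
  have W0: "AE \<omega> in M. W 0 \<omega> = 0" and
    mW: "\<And>t. t \<ge> 0 \<Longrightarrow> W t \<in> borel_measurable M"
    using bm by (auto simp: standard_brownian_motion_def)
  have dist: "distributed M lborel (\<Delta> m) (normal_density 0 (sqrt \<tau>))" for m
  proof -
    have "0 \<le> real m * \<tau> \<and> real m * \<tau> < real (Suc m) * \<tau>" using \<tau> by simp
    then have "distributed M lborel (\<lambda>\<omega>. W (real (Suc m) * \<tau>) \<omega> - W (real m * \<tau>) \<omega>)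
       (normal_density 0 (sqrt (real (Suc m) * \<tau> - real m * \<tau>)))"
      using bm unfolding standard_brownian_motion_def by blast
    then show ?thesis by (simp add: \<Delta>_def[abs_def] algebra_simps)
  qed
  have indep: "indep_vars (\<lambda>_. borel) \<Delta> {..<n}"
  proof -
    have inc: "0 \<le> real 0 * \<tau> \<and> (\<forall>i<n. real i * \<tau> < real (Suc i) * \<tau>)" using \<tau> by simp
    have "\<forall>(n::nat) (t::nat \<Rightarrow> real). 0 \<le> t 0 \<and> (\<forall>i<n. t i < t (Suc i)) \<longrightarrow>
        indep_vars (\<lambda>_. borel) (\<lambda>i \<omega>. W (t (Suc i)) \<omega> - W (t i) \<omega>) {..<n}"
      using bm by (simp add: standard_brownian_motion_def)
    from this[rule_format, of "\<lambda>i. real i * \<tau>" n] inc show ?thesis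
      unfolding \<Delta>_def[abs_def] by simp
  qed
  have W_sum: "W (real i * \<tau>) \<omega> = W 0 \<omega> + (\<Sum>m<i. \<Delta> m \<omega>)" for i \<omega>
    by (induction i) (simp_all add: \<Delta>_def)
  have main: "integrable M (\<lambda>\<omega>. \<Prod>i\<in>S. \<rho> * exp (\<sigma> * W (real i * \<tau>) \<omega> - 1/2 * \<sigma>\<^sup>2 * (real i * \<tau>))) \<and>
     expectation (\<lambda>\<omega>. \<Prod>i\<in>S. \<rho> * exp (\<sigma> * W (real i * \<tau>) \<omega> - 1/2 * \<sigma>\<^sup>2 * (real i * \<tau>))) =
     exp (ln \<rho> * real (card S)
      + \<beta> / (real n)\<^sup>2 * (\<Sum>m<n. (real (tail_count S m))\<^sup>2 - real (tail_count S m)))"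
    (is "integrable M ?f \<and> expectation ?f = ?e")
    if S: "S \<in> Pow {..<n}" for S
  proof -
    have fin: "finite S" using S finite_subset by auto
    define C where "C = exp (ln \<rho> * real (card S) - \<beta> / (real n)\<^sup>2 * (\<Sum>m<n. real (tail_count S m)))"
    define g where "g \<omega> = (\<Prod>m<n. exp ((\<sigma> * real (tail_count S m)) * \<Delta> m \<omega>))" for \<omega>
    have idx: "(\<Sum>i\<in>S. real i) = (\<Sum>m<n. real (tail_count S m))"
      using sum_prefix_sums[of S n "\<lambda>_. 1"] S by simp
    \<comment> \<open>\<open>W 0\<close> vanishes only almost surely, so the factorisation into
      increments holds off a null set and is used through an almost-everywhere congruence.\<close>
    have eq: "?f \<omega> = C * g \<omega>" if "W 0 \<omega> = 0" for \<omega>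
    proof -
      have "?f \<omega> = exp (\<Sum>i\<in>S. ln \<rho> + (\<sigma> * W (real i * \<tau>) \<omega> - 1/2 * \<sigma>\<^sup>2 * (real i * \<tau>)))"
        using \<rho> by (simp add: exp_sum[OF fin] exp_add)
      also have "(\<Sum>i\<in>S. ln \<rho> + (\<sigma> * W (real i * \<tau>) \<omega> - 1/2 * \<sigma>\<^sup>2 * (real i * \<tau>))) =
        ln \<rho> * real (card S) - (1/2 * \<sigma>\<^sup>2 * \<tau>) * (\<Sum>i\<in>S. real i) + \<sigma> * (\<Sum>i\<in>S. W (real i * \<tau>) \<omega>)"
        by (simp add: sum.distrib sum_subtractf sum_distrib_left sum_distrib_right mult_ac)
      also have "(\<Sum>i\<in>S. W (real i * \<tau>) \<omega>) = (\<Sum>m<n. real (tail_count S m) * \<Delta> m \<omega>)"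
        using sum_prefix_sums[of S n "\<lambda>m. \<Delta> m \<omega>"] S that by (simp add: W_sum)
      finally have *: "?f \<omega> = exp (ln \<rho> * real (card S) - \<beta> / (real n)\<^sup>2 * (\<Sum>m<n. real (tail_count S m))
          + \<sigma> * (\<Sum>m<n. real (tail_count S m) * \<Delta> m \<omega>))"
        unfolding \<beta>' idx .
      have "g \<omega> = exp (\<sigma> * (\<Sum>m<n. real (tail_count S m) * \<Delta> m \<omega>))"
        by (simp add: g_def exp_sum sum_distrib_left mult_ac)
      then show ?thesis
        unfolding * C_def by (simp only: exp_add)
    qed
    have ind: "indep_vars (\<lambda>_. borel) (\<lambda>m \<omega>. exp ((\<sigma> * real (tail_count S m)) * \<Delta> m \<omega>)) {..<n}"
      by (rule indep_vars_compose2[OF indep]) simp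
    have int: "integrable M (\<lambda>\<omega>. exp ((\<sigma> * real (tail_count S m)) * \<Delta> m \<omega>))" for m
      using integrable_exp_normal[OF dist] \<tau> by simp
    have ig: "integrable M g"
      unfolding g_def by (rule indep_vars_integrable[OF _ ind int]) simp
    have "expectation g = (\<Prod>m<n. expectation (\<lambda>\<omega>. exp ((\<sigma> * real (tail_count S m)) * \<Delta> m \<omega>)))"
      unfolding g_def by (rule indep_vars_lebesgue_integral[OF _ ind int]) simp
    also have "\<dots> = (\<Prod>m<n. exp ((\<beta> / (real n)\<^sup>2) * (real (tail_count S m))\<^sup>2))"
    proof (rule prod.cong[OF refl])
      fix m
      have "expectation (\<lambda>\<omega>. exp ((\<sigma> * real (tail_count S m)) * \<Delta> m \<omega>)) =
         exp ((\<sigma> * real (tail_count S m))\<^sup>2 * (sqrt \<tau>)\<^sup>2 / 2)"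
        by (rule expectation_exp_normal[OF dist]) (use \<tau> in simp)
      also have "(\<sigma> * real (tail_count S m))\<^sup>2 * (sqrt \<tau>)\<^sup>2 / 2 = (1/2 * \<sigma>\<^sup>2 * \<tau>) * (real (tail_count S m))\<^sup>2"
        using \<tau> by (simp add: power_mult_distrib)
      finally show "expectation (\<lambda>\<omega>. exp ((\<sigma> * real (tail_count S m)) * \<Delta> m \<omega>)) =
         exp ((\<beta> / (real n)\<^sup>2) * (real (tail_count S m))\<^sup>2)" unfolding \<beta>' .
    qed
    finally have eg: "C * expectation g = ?e"
      unfolding C_def by (simp add: exp_sum[symmetric] mult_exp_exp sum_distrib_left sum_subtractf algebra_simps)
    have mf: "?f \<in> borel_measurable M"
      using mW \<tau> by (intro borel_measurable_prod) (auto intro!: borel_measurable_times borel_measurable_exp borel_measurable_diff)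
    have ae: "AE \<omega> in M. ?f \<omega> = C * g \<omega>" using W0 by eventually_elim (rule eq)
    have mg: "(\<lambda>\<omega>. C * g \<omega>) \<in> borel_measurable M" using ig by auto
    show ?thesis
      using integrable_cong_AE[OF mf mg ae] integral_cong_AE[OF mf mg ae] ig eg by simp
  qed
  show ?thesis
    unfolding growth_eq_sum partition_fun_def using main by (simp add: Bochner_Integration.integral_sum)
qed

section \<open>The mean-field limit\<close>

text \<open>\<open>b m\<close> is a trial value for \<open>tail_count S m / n\<close>. Once the
  square is replaced by its tangent at \<open>b\<close>, the sites decouple, and this is the
  logarithm of the resulting product; see \<open>sum_exp_linear\<close>.\<close>

definition mean_field :: "nat \<Rightarrow> real \<Rightarrow> real \<Rightarrow> (nat \<Rightarrow> real) \<Rightarrow> real" where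
  "mean_field n \<theta> \<beta> b = (\<Sum>i<n. ln (1 + exp (\<theta> + 2 * \<beta> / real n * (\<Sum>m<i. b m)))) - \<beta> * (\<Sum>m<n. (b m)\<^sup>2)"

text \<open>Sequences on all of \<open>nat\<close>, so that a single compact set serves every level
  \<open>n\<close>.\<close>

definition unit_box :: "(nat \<Rightarrow> real) set" where
  "unit_box = {b. \<forall>i. b i \<in> {0..1}}"

lemma tail_count_le: "S \<subseteq> {..<n} \<Longrightarrow> tail_count S m \<le> n"
proof -
  assume "S \<subseteq> {..<n}"
  then have "card {i \<in> S. m < i} \<le> card {..<n}" by (intro card_mono) auto
  then show ?thesis by (simp add: tail_count_def)
qed

lemma tail_count_diff_le:
  assumes "finite S" "m \<le> m'"
  shows "tail_count S m' \<le> tail_count S m" "tail_count S m \<le> tail_count S m' + (m' - m)"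
proof -
  show "tail_count S m' \<le> tail_count S m"
    unfolding tail_count_def using assms by (intro card_mono) auto
  have "card {i \<in> S. m < i} \<le> card ({i \<in> S. m' < i} \<union> {m<..m'})"
    using assms by (intro card_mono) auto
  also have "\<dots> \<le> card {i \<in> S. m' < i} + card {m<..m'}" by (rule card_Un_le)
  finally show "tail_count S m \<le> tail_count S m' + (m' - m)" by (simp add: tail_count_def)
qed

text \<open>A weight that is linear in the counts is a product over the sites, so the sum over all
  subsets is a product of factors \<open>1 + exp\<close>.\<close>

lemma sum_exp_linear:
  assumes "n \<ge> 1"
  shows "(\<Sum>S\<in>Pow {..<n}. exp (\<theta> * real (card S)
      + \<beta> * (\<Sum>m<n. 2 * b m * (real (tail_count S m) / real n) - (b m)\<^sup>2))) = exp (mean_field n \<theta> \<beta> b)"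
proof -
  define \<phi> where "\<phi> i = 2 * \<beta> / real n * (\<Sum>m<i. b m)" for i
  have "exp (\<theta> * real (card S) + \<beta> * (\<Sum>m<n. 2 * b m * (real (tail_count S m) / real n) - (b m)\<^sup>2))
      = exp (- \<beta> * (\<Sum>m<n. (b m)\<^sup>2)) * (\<Prod>i\<in>S. exp (\<theta> + \<phi> i))" if "S \<in> Pow {..<n}" for S
  proof -
    have fin: "finite S" using that finite_subset by auto
    have "(\<Sum>i\<in>S. \<phi> i) = 2 * \<beta> / real n * (\<Sum>m<n. real (tail_count S m) * b m)"
      using that by (simp only: \<phi>_def sum_distrib_left[symmetric] sum_prefix_sums[of S n b] Pow_iff)
    also have "\<dots> = \<beta> * (\<Sum>m<n. 2 * b m * (real (tail_count S m) / real n))"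
      by (simp add: sum_distrib_left mult_ac)
    finally show ?thesis
      by (simp add: exp_sum[OF fin, symmetric] sum.distrib mult_exp_exp sum_subtractf algebra_simps)
  qed
  then have "(\<Sum>S\<in>Pow {..<n}. exp (\<theta> * real (card S)
      + \<beta> * (\<Sum>m<n. 2 * b m * (real (tail_count S m) / real n) - (b m)\<^sup>2)))
     = exp (- \<beta> * (\<Sum>m<n. (b m)\<^sup>2)) * (\<Sum>S\<in>Pow {..<n}. (\<Prod>i\<in>S. exp (\<theta> + \<phi> i)))"
    by (simp add: sum_distrib_left)
  also have "(\<Sum>S\<in>Pow {..<n}. (\<Prod>i\<in>S. exp (\<theta> + \<phi> i))) = (\<Prod>i<n. exp (\<theta> + \<phi> i) + 1)"
    by (simp only: prod_add finite_lessThan) simp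
  also have "\<dots> = exp (\<Sum>i<n. ln (1 + exp (\<theta> + \<phi> i)))"
    by (simp add: exp_sum add.commute add_pos_pos)
  finally show ?thesis by (simp add: mean_field_def \<phi>_def mult_exp_exp algebra_simps)
qed

text \<open>Besides the tangent inequality, each term \<open>- N\<close> costs at most
  \<open>1 / n\<close> after division by \<open>n\<^sup>2\<close>. The \<open>n\<close> terms
  together cost \<open>\<beta>\<close>, which is negligible on the scale \<open>n\<close>.\<close>

lemma partition_fun_ge:
  assumes "n \<ge> 1" "\<beta> \<ge> 0"
  shows "exp (mean_field n \<theta> \<beta> b - \<beta>) \<le> partition_fun n \<theta> \<beta>"
proof -
  have "exp (mean_field n \<theta> \<beta> b - \<beta>) = (\<Sum>S\<in>Pow {..<n}. exp (\<theta> * real (card S)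
      + \<beta> * (\<Sum>m<n. 2 * b m * (real (tail_count S m) / real n) - (b m)\<^sup>2) - \<beta>))"
    by (simp only: exp_diff sum_divide_distrib[symmetric] sum_exp_linear[OF assms(1)])
  also have "\<dots> \<le> partition_fun n \<theta> \<beta>"
    unfolding partition_fun_def
  proof (rule sum_mono)
    fix S assume S: "S \<in> Pow {..<n}"
    have "(\<Sum>m<n. 2 * b m * (real (tail_count S m) / real n) - (b m)\<^sup>2) - 1
       = (\<Sum>m<n. 2 * b m * (real (tail_count S m) / real n) - (b m)\<^sup>2 - 1 / real n)"
      using assms by (simp add: sum_subtractf)
    also have "\<dots> \<le> (\<Sum>m<n. ((real (tail_count S m))\<^sup>2 - real (tail_count S m)) / (real n)\<^sup>2)"
    proof (rule sum_mono)
      fix m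
      define x where "x = real (tail_count S m) / real n"
      have "x \<le> 1" using tail_count_le[of S n m] S assms by (simp add: x_def)
      then have "x / real n \<le> 1 / real n" by (intro divide_right_mono) auto
      moreover have "0 \<le> (b m - x)\<^sup>2" by simp
      moreover have "((real (tail_count S m))\<^sup>2 - real (tail_count S m)) / (real n)\<^sup>2 = x\<^sup>2 - x / real n"
        using assms by (simp add: x_def field_simps power2_eq_square)
      ultimately show "2 * b m * (real (tail_count S m) / real n) - (b m)\<^sup>2 - 1 / real n
          \<le> ((real (tail_count S m))\<^sup>2 - real (tail_count S m)) / (real n)\<^sup>2"
        unfolding x_def[symmetric] by (simp add: power2_eq_square algebra_simps)
    qed
    also have "\<dots> = (\<Sum>m<n. (real (tail_count S m))\<^sup>2 - real (tail_count S m)) / (real n)\<^sup>2"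
      by (simp add: sum_divide_distrib)
    finally have "\<beta> * ((\<Sum>m<n. 2 * b m * (real (tail_count S m) / real n) - (b m)\<^sup>2) - 1)
       \<le> \<beta> * ((\<Sum>m<n. (real (tail_count S m))\<^sup>2 - real (tail_count S m)) / (real n)\<^sup>2)"
      using assms by (intro mult_left_mono)
    then show "exp (\<theta> * real (card S)
        + \<beta> * (\<Sum>m<n. 2 * b m * (real (tail_count S m) / real n) - (b m)\<^sup>2) - \<beta>)
      \<le> exp (\<theta> * real (card S)
        + \<beta> / (real n)\<^sup>2 * (\<Sum>m<n. (real (tail_count S m))\<^sup>2 - real (tail_count S m)))"
      by (simp add: algebra_simps)
  qed
  finally show ?thesis .
qed

text \<open>The profile \<open>m \<mapsto> tail_count S m / n\<close> is monotone and Lipschitz, so it is within \<open>2 / K\<close> of one of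
  \<open>(K + 1) ^ K\<close> step functions, a number independent of \<open>n\<close>.\<close>

lemma partition_fun_le:
  assumes n: "n \<ge> 1" and \<beta>: "\<beta> \<ge> 0" and K: "K \<ge> 1"
    and C: "\<And>b. b \<in> unit_box \<Longrightarrow> mean_field n \<theta> \<beta> b \<le> C"
  shows "partition_fun n \<theta> \<beta> \<le> (real K + 1) ^ K * exp (C + 4 * \<beta> * real n / (real K)\<^sup>2)"
proof -
  define net where "net = {..<K} \<rightarrow>\<^sub>E {..K}"
  define blk where "blk m = m * K div n" for m
  \<comment> \<open>Past \<open>n\<close> the index \<open>blk m\<close> leaves the domain of the
    extensional function \<open>c\<close>; the value 0 there keeps \<open>B c\<close> in the
    box.\<close>
  define B where "B c m = (if m < n then real (c (blk m)) / real K else 0)" for c :: "nat \<Rightarrow> nat" and m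
  have blk_less: "blk m < K" if "m < n" for m
    using that n K by (simp add: blk_def div_less_iff_less_mult mult.commute)
  have box: "B c \<in> unit_box" if "c \<in> net" for c
    using that blk_less K by (auto simp: net_def unit_box_def B_def divide_le_eq_1)
  have fin: "finite net" and card: "card net = (K + 1) ^ K"
    by (auto simp: net_def card_PiE finite_PiE)
  have approx: "\<exists>c\<in>net. \<forall>m<n. \<bar>B c m - real (tail_count S m) / real n\<bar> \<le> 2 / real K"
    if S: "S \<in> Pow {..<n}" for S
  proof -
    have finS: "finite S" using S finite_subset by auto
    define rep where "rep j = (SOME m. m < n \<and> blk m = j)" for j
    have rep: "rep (blk m) < n \<and> blk (rep (blk m)) = blk m" if "m < n" for m
      unfolding rep_def by (rule someI[where x = m]) (use that in simp)
    \<comment> \<open>The value on a block is the tail count at one representative, rounded down to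
      a multiple of \<open>1 / K\<close>. Moving to the representative and rounding cost
      \<open>1 / K\<close> each, which gives the \<open>2 / K\<close>.\<close>
    define c where "c = (\<lambda>j\<in>{..<K}. K * tail_count S (rep j) div n)"
    have "K * tail_count S m div n \<le> K" for m
    proof -
      have "K * tail_count S m \<le> K * n" using tail_count_le[of S n m] S by simp
      then have "K * tail_count S m div n \<le> K * n div n" by (rule div_le_mono)
      then show ?thesis using n by simp
    qed
    then have "c \<in> net" by (simp add: net_def c_def)
    moreover have "\<bar>B c m - real (tail_count S m) / real n\<bar> \<le> 2 / real K" if m: "m < n" for m
    proof -
      define r where "r = rep (blk m)"
      have r: "r < n" "blk r = blk m" using rep[OF m] by (auto simp: r_def)
      have close: "x * K < y * K + n" if "blk x = blk y" for x y
      proof -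
        have "x * K < (blk x + 1) * n" using n by (simp add: blk_def dividend_less_div_times)
        also have "\<dots> = blk y * n + n" using that by simp
        also have "\<dots> \<le> y * K + n" by (simp add: blk_def)
        finally show ?thesis .
      qed
      have "real m * real K < real r * real K + real n" "real r * real K < real m * real K + real n"
        using close[of m r] close[of r m] r by (metis of_nat_add of_nat_less_iff of_nat_mult)+
      then have "\<bar>real m - real r\<bar> * real K \<le> real n"
        by (auto simp: abs_if algebra_simps)
      then have d1: "\<bar>real m - real r\<bar> / real n \<le> 1 / real K"
        using n K by (simp add: field_simps)
      have "\<bar>real (tail_count S m) - real (tail_count S r)\<bar> \<le> \<bar>real m - real r\<bar>"
        using tail_count_diff_le[OF finS, of m r] tail_count_diff_le[OF finS, of r m]
        by (cases "m \<le> r") auto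
      then have "\<bar>real (tail_count S m) - real (tail_count S r)\<bar> / real n \<le> \<bar>real m - real r\<bar> / real n"
        by (intro divide_right_mono) auto
      then have d2: "\<bar>real (tail_count S m) / real n - real (tail_count S r) / real n\<bar> \<le> 1 / real K"
        using d1 by (simp add: diff_divide_distrib[symmetric] abs_divide)
      define q where "q = K * tail_count S r div n"
      have Bq: "B c m = real q / real K"
        using m blk_less[OF m] by (simp add: B_def c_def q_def r_def)
      have "q * n \<le> K * tail_count S r" "K * tail_count S r < q * n + n"
        using n dividend_less_div_times[of n "K * tail_count S r"] by (auto simp: q_def)
      then have "real q * real n \<le> real K * real (tail_count S r)"
         "real K * real (tail_count S r) < real q * real n + real n"
        by (metis of_nat_le_iff of_nat_mult, metis of_nat_add of_nat_less_iff of_nat_mult)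
      then have "real q / real K \<le> real (tail_count S r) / real n"
         "real (tail_count S r) / real n \<le> real q / real K + 1 / real K"
        using n K by (simp_all add: field_simps)
      then show ?thesis using d2 Bq by linarith
    qed
    ultimately show ?thesis by blast
  qed
  have bound: "exp (\<theta> * real (card S)
      + \<beta> / (real n)\<^sup>2 * (\<Sum>m<n. (real (tail_count S m))\<^sup>2 - real (tail_count S m)))
    \<le> (\<Sum>c\<in>net. exp (4 * \<beta> * real n / (real K)\<^sup>2) * exp (\<theta> * real (card S)
      + \<beta> * (\<Sum>m<n. 2 * B c m * (real (tail_count S m) / real n) - (B c m)\<^sup>2)))"
    if S: "S \<in> Pow {..<n}" for S
  proof -
    obtain c where c: "c \<in> net" "\<And>m. m < n \<Longrightarrow> \<bar>B c m - real (tail_count S m) / real n\<bar> \<le> 2 / real K"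
      using approx[OF S] by blast
    have "(\<Sum>m<n. (real (tail_count S m))\<^sup>2 - real (tail_count S m)) / (real n)\<^sup>2
       \<le> (\<Sum>m<n. 2 * B c m * (real (tail_count S m) / real n) - (B c m)\<^sup>2 + 4 / (real K)\<^sup>2)"
      unfolding sum_divide_distrib
    proof (rule sum_mono)
      fix m assume m: "m \<in> {..<n}"
      define x where "x = real (tail_count S m) / real n"
      \<comment> \<open>This square is what linearising at a nearby net point loses; summed over
        \<open>m\<close> it yields the \<open>4 * \<beta> * n / K\<^sup>2\<close> of the
        statement.\<close>
      have "(B c m - x)\<^sup>2 \<le> (2 / real K)\<^sup>2"
        using c(2)[of m] m by (simp add: x_def abs_le_square_iff[symmetric])
      moreover have "(2 / real K)\<^sup>2 = 4 / (real K)\<^sup>2" by (simp add: power_divide)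
      moreover have "((real (tail_count S m))\<^sup>2 - real (tail_count S m)) / (real n)\<^sup>2 = x\<^sup>2 - x / real n"
        using assms by (simp add: x_def field_simps power2_eq_square)
      moreover have "0 \<le> x / real n" by (simp add: x_def)
      ultimately show "((real (tail_count S m))\<^sup>2 - real (tail_count S m)) / (real n)\<^sup>2
          \<le> 2 * B c m * (real (tail_count S m) / real n) - (B c m)\<^sup>2 + 4 / (real K)\<^sup>2"
        unfolding x_def[symmetric] by (simp add: power2_diff algebra_simps)
    qed
    also have "\<dots> = (\<Sum>m<n. 2 * B c m * (real (tail_count S m) / real n) - (B c m)\<^sup>2) + 4 * real n / (real K)\<^sup>2"
      by (simp add: sum.distrib)
    finally have "\<beta> * ((\<Sum>m<n. (real (tail_count S m))\<^sup>2 - real (tail_count S m)) / (real n)\<^sup>2)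
      \<le> \<beta> * ((\<Sum>m<n. 2 * B c m * (real (tail_count S m) / real n) - (B c m)\<^sup>2) + 4 * real n / (real K)\<^sup>2)"
      using \<beta> by (intro mult_left_mono)
    then have "exp (\<theta> * real (card S)
        + \<beta> / (real n)\<^sup>2 * (\<Sum>m<n. (real (tail_count S m))\<^sup>2 - real (tail_count S m)))
      \<le> exp (4 * \<beta> * real n / (real K)\<^sup>2) * exp (\<theta> * real (card S)
        + \<beta> * (\<Sum>m<n. 2 * B c m * (real (tail_count S m) / real n) - (B c m)\<^sup>2))"
      unfolding mult_exp_exp by (simp add: algebra_simps)
    also have "\<dots> \<le> (\<Sum>c\<in>net. exp (4 * \<beta> * real n / (real K)\<^sup>2) * exp (\<theta> * real (card S)
      + \<beta> * (\<Sum>m<n. 2 * B c m * (real (tail_count S m) / real n) - (B c m)\<^sup>2)))"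
      by (rule member_le_sum) (use c fin in auto)
    finally show ?thesis .
  qed
  have "partition_fun n \<theta> \<beta> \<le> (\<Sum>S\<in>Pow {..<n}. \<Sum>c\<in>net. exp (4 * \<beta> * real n / (real K)\<^sup>2) * exp (\<theta> * real (card S)
      + \<beta> * (\<Sum>m<n. 2 * B c m * (real (tail_count S m) / real n) - (B c m)\<^sup>2)))"
    unfolding partition_fun_def by (rule sum_mono) (rule bound)
  also have "\<dots> = (\<Sum>c\<in>net. exp (4 * \<beta> * real n / (real K)\<^sup>2) * exp (mean_field n \<theta> \<beta> (B c)))"
    by (subst sum.swap) (simp only: sum_distrib_left[symmetric] sum_exp_linear[OF n])
  also have "\<dots> \<le> (\<Sum>c\<in>net. exp (C + 4 * \<beta> * real n / (real K)\<^sup>2))"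
    by (rule sum_mono) (use C[OF box] in \<open>simp add: mult_exp_exp\<close>)
  also have "\<dots> = (real K + 1) ^ K * exp (C + 4 * \<beta> * real n / (real K)\<^sup>2)"
    by (simp add: card add.commute)
  finally show ?thesis .
qed

section \<open>Maximisation over the unit box and the limit of large levels\<close>

definition mean_field_max :: "nat \<Rightarrow> real \<Rightarrow> real \<Rightarrow> real" where
  "mean_field_max n \<theta> \<beta> = (SUP b\<in>unit_box. mean_field n \<theta> \<beta> b)"

text \<open>A supremum is available before any convergence proof;
  \<open>mean_field_max_tendsto\<close> shows that it is also the limit.\<close>

definition free_energy :: "real \<Rightarrow> real \<Rightarrow> real" where
  "free_energy \<theta> \<beta> = (SUP n\<in>{1..}. mean_field_max n \<theta> \<beta> / real n)"

lemma compact_unit_box: "compact unit_box"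
proof -
  have "compactin (product_topology (\<lambda>i::nat. euclidean :: real topology) UNIV) (PiE UNIV (\<lambda>i. {0..1}))"
    by (subst compactin_PiE) auto
  then show ?thesis
    by (simp add: unit_box_def PiE_UNIV_domain Pi_def euclidean_product_topology)
qed

lemma mean_field_attains_max:
  "\<exists>b\<in>unit_box. \<forall>b'\<in>unit_box. mean_field n \<theta> \<beta> b' \<le> mean_field n \<theta> \<beta> b"
proof (rule continuous_attains_sup[OF compact_unit_box])
  have "(\<lambda>_. 0) \<in> unit_box" by (simp add: unit_box_def)
  then show "unit_box \<noteq> {}" by blast
  have "1 + exp (\<theta> + 2 * \<beta> / real n * (\<Sum>m<i. b m)) \<noteq> 0" for i b
    using exp_gt_zero[of "\<theta> + 2 * \<beta> / real n * (\<Sum>m<i. b m)"] by linarith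
  then show "continuous_on unit_box (mean_field n \<theta> \<beta>)"
    unfolding mean_field_def
    by (auto intro!: continuous_intros continuous_on_product_then_coordinatewise[OF continuous_on_id])
qed

lemma mean_field_max_attained:
  obtains b where "b \<in> unit_box" "mean_field_max n \<theta> \<beta> = mean_field n \<theta> \<beta> b"
    "\<And>b'. b' \<in> unit_box \<Longrightarrow> mean_field n \<theta> \<beta> b' \<le> mean_field n \<theta> \<beta> b"
proof -
  obtain b where b: "b \<in> unit_box" "\<And>b'. b' \<in> unit_box \<Longrightarrow> mean_field n \<theta> \<beta> b' \<le> mean_field n \<theta> \<beta> b"
    using mean_field_attains_max by blast
  moreover have "mean_field_max n \<theta> \<beta> = mean_field n \<theta> \<beta> b"
    unfolding mean_field_max_def by (rule cSup_eq_maximum) (use b in auto)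
  ultimately show ?thesis using that by blast
qed

lemma mean_field_le_max: "b \<in> unit_box \<Longrightarrow> mean_field n \<theta> \<beta> b \<le> mean_field_max n \<theta> \<beta>"
  by (metis mean_field_max_attained)

lemma ln_one_plus_exp_mono: "x \<le> y \<Longrightarrow> ln (1 + exp x) \<le> ln (1 + exp (y::real))"
  by (simp add: add_pos_pos)

lemma ln_one_plus_exp_lipschitz:
  assumes "x \<le> y"
  shows "ln (1 + exp (y::real)) \<le> ln (1 + exp x) + (y - x)"
proof -
  have "1 + exp y \<le> (1 + exp x) * exp (y - x)"
    using assms by (simp add: algebra_simps mult_exp_exp)
  then have "ln (1 + exp y) \<le> ln ((1 + exp x) * exp (y - x))"
    by (simp add: add_pos_pos)
  also have "\<dots> = ln (1 + exp x) + (y - x)"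
    using ln_mult_pos[of "1 + exp x" "exp (y - x)"] by (simp add: add_pos_pos)
  finally show ?thesis .
qed

lemma mean_field_max_nonneg: "0 \<le> mean_field_max n \<theta> \<beta>"
proof -
  have "(0::real) \<le> mean_field n \<theta> \<beta> (\<lambda>_. 0)"
    by (simp add: mean_field_def)
  also have "\<dots> \<le> mean_field_max n \<theta> \<beta>" by (rule mean_field_le_max) (simp add: unit_box_def)
  finally show ?thesis .
qed

lemma unit_box_sum_bounds:
  assumes "b \<in> unit_box"
  shows "0 \<le> (\<Sum>m<i. b m)" "(\<Sum>m<i. b m) \<le> real i"
proof -
  show "0 \<le> (\<Sum>m<i. b m)" using assms by (auto simp: unit_box_def intro: sum_nonneg)
  have "(\<Sum>m<i. b m) \<le> (\<Sum>m<i. 1)" using assms by (intro sum_mono) (auto simp: unit_box_def)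
  then show "(\<Sum>m<i. b m) \<le> real i" by simp
qed

lemma field_bounds:
  assumes "b \<in> unit_box" "\<beta> \<ge> 0" "i \<le> n"
  shows "0 \<le> 2 * \<beta> / real n * (\<Sum>m<i. b m)" "2 * \<beta> / real n * (\<Sum>m<i. b m) \<le> 2 * \<beta>"
proof -
  show "0 \<le> 2 * \<beta> / real n * (\<Sum>m<i. b m)" using unit_box_sum_bounds[OF assms(1)] assms(2) by simp
  have "(\<Sum>m<i. b m) \<le> real n" using unit_box_sum_bounds(2)[OF assms(1), of i] assms(3) by linarith
  then have "2 * \<beta> / real n * (\<Sum>m<i. b m) \<le> 2 * \<beta> / real n * real n"
    using assms(2) by (intro mult_left_mono) auto
  also have "\<dots> \<le> 2 * \<beta>" using assms(2) by simp
  finally show "2 * \<beta> / real n * (\<Sum>m<i. b m) \<le> 2 * \<beta>" .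
qed

lemma mean_field_max_le:
  assumes "\<beta> \<ge> 0"
  shows "mean_field_max n \<theta> \<beta> \<le> real n * ln (1 + exp (\<theta> + 2 * \<beta>))"
proof -
  obtain b where b: "b \<in> unit_box" "mean_field_max n \<theta> \<beta> = mean_field n \<theta> \<beta> b"
    using mean_field_max_attained by blast
  have "mean_field n \<theta> \<beta> b \<le> (\<Sum>i<n. ln (1 + exp (\<theta> + 2 * \<beta> / real n * (\<Sum>m<i. b m))))"
    using assms by (simp add: mean_field_def sum_nonneg)
  also have "\<dots> \<le> (\<Sum>i<n. ln (1 + exp (\<theta> + 2 * \<beta>)))"
    by (intro sum_mono ln_one_plus_exp_mono) (use field_bounds[OF b(1) assms] in simp)
  finally show ?thesis using b by simp
qed

lemma sum_div_blocks: "(\<Sum>i<k * N. f (i div k)) = real k * (\<Sum>j<N. f j)" for f :: "nat \<Rightarrow> real"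
proof (cases "k = 0")
  case False
  have "(\<Sum>i<N * k. f (i div k)) = (\<Sum>j<N. sum (\<lambda>i. f (i div k)) {j * k..<j * k + k})"
    by (rule sum.nat_group[symmetric])
  also have "\<dots> = (\<Sum>j<N. \<Sum>i\<in>{j * k..<j * k + k}. f j)"
  proof (intro sum.cong refl)
    fix j i assume "i \<in> {j * k..<j * k + k}"
    then have "i div k = j" using False by (intro div_nat_eqI) (auto simp: mult.commute)
    then show "f (i div k) = f j" by simp
  qed
  finally show ?thesis by (simp add: sum_distrib_left mult.commute)
qed simp

text \<open>Blowing up each coordinate of a level-\<open>N\<close> configuration to a block of length \<open>n div N\<close>.\<close>

lemma mean_field_max_blocks:
  assumes \<beta>: "\<beta> \<ge> 0" and N: "N \<ge> 1" and n: "n \<ge> 1"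
  shows "real (n div N) * mean_field_max N \<theta> \<beta> - 2 * \<beta> * real N \<le> mean_field_max n \<theta> \<beta>"
proof -
  obtain b where b: "b \<in> unit_box" "mean_field_max N \<theta> \<beta> = mean_field N \<theta> \<beta> b"
    using mean_field_max_attained by blast
  define k where "k = n div N"
  define f where "f j = ln (1 + exp (\<theta> + 2 * \<beta> / real N * (\<Sum>m<j. b m)))" for j
  define b' where "b' m = (if m < k * N then b (m div k) else 0)" for m
  have b'_box: "b' \<in> unit_box" using b by (auto simp: unit_box_def b'_def)
  have kN: "k * N \<le> n" and nk: "n < k * N + N"
    using N dividend_less_div_times[of N n] by (auto simp: k_def)
  have kN': "real n - real N \<le> real k * real N" "real k * real N \<le> real n"
    using kN nk by (metis of_nat_add of_nat_mult of_nat_less_iff less_eq_real_def diff_le_eq, metis of_nat_le_iff of_nat_mult)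
  \<comment> \<open>The field on site \<open>i\<close> falls short of the field on its block by at
    most \<open>2 * \<beta> * N / n\<close>: the unfinished block is dropped, and
    \<open>n / N\<close> is rounded down to \<open>k\<close>.\<close>
  have low: "f (i div k) - 2 * \<beta> * real N / real n \<le> ln (1 + exp (\<theta> + 2 * \<beta> / real n * (\<Sum>m<i. b' m)))"
    if i: "i < k * N" for i
  proof -
    define j where "j = i div k"
    have k0: "k > 0" using i by (cases k) auto
    have j: "j < N" using i k0 by (simp add: j_def div_less_iff_less_mult mult.commute[of k N])
    have jk: "k * j \<le> i" by (simp add: j_def)
    have le: "m < k * N" if "m < k * j" for m
      using that j by (meson less_imp_le less_le_trans mult_le_mono2)
    have "real k * (\<Sum>l<j. b l) = (\<Sum>m<k * j. b (m div k))" by (rule sum_div_blocks[symmetric])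
    also have "\<dots> = (\<Sum>m<k * j. b' m)" using le by (intro sum.cong) (auto simp: b'_def)
    also have "\<dots> \<le> (\<Sum>m<i. b' m)"
      using jk b'_box by (intro sum_mono2) (auto simp: unit_box_def)
    finally have 1: "2 * \<beta> / real n * (real k * (\<Sum>l<j. b l)) \<le> 2 * \<beta> / real n * (\<Sum>m<i. b' m)"
      using \<beta> by (intro mult_left_mono) auto
    have "2 * \<beta> / real N * (\<Sum>l<j. b l) * (real n - real N) \<le> 2 * \<beta> / real N * (\<Sum>l<j. b l) * (real k * real N)"
      using kN' field_bounds(1)[OF b(1) \<beta>, of j N] j by (intro mult_left_mono) auto
    then have "2 * \<beta> / real N * (\<Sum>l<j. b l) * (1 - real N / real n) \<le> 2 * \<beta> / real n * (real k * (\<Sum>l<j. b l))"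
      using n N divide_right_mono[of "2 * \<beta> / real N * (\<Sum>l<j. b l) * (real n - real N)" _ "real n"]
      by (simp add: right_diff_distrib diff_divide_distrib mult_ac)
    moreover have "2 * \<beta> / real N * (\<Sum>l<j. b l) * (real N / real n) \<le> 2 * \<beta> * (real N / real n)"
      using field_bounds(2)[OF b(1) \<beta>, of j N] j by (intro mult_right_mono) auto
    moreover have "2 * \<beta> * (real N / real n) = 2 * \<beta> * real N / real n" by simp
    moreover have "x - u \<le> z" if "x * (1 - t) \<le> y" "x * t \<le> u" "y \<le> z" for x t y u z :: real
      using that by (simp add: algebra_simps)
    ultimately have 2: "2 * \<beta> / real N * (\<Sum>l<j. b l) - 2 * \<beta> * real N / real n \<le> 2 * \<beta> / real n * (\<Sum>m<i. b' m)"
      using 1 by (metis (no_types, lifting))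
    have "f j \<le> ln (1 + exp (\<theta> + (2 * \<beta> / real N * (\<Sum>l<j. b l) - 2 * \<beta> * real N / real n))) + 2 * \<beta> * real N / real n"
      using ln_one_plus_exp_lipschitz[of "\<theta> + (2 * \<beta> / real N * (\<Sum>l<j. b l) - 2 * \<beta> * real N / real n)"
          "\<theta> + 2 * \<beta> / real N * (\<Sum>l<j. b l)"] \<beta> by (simp add: f_def)
    also have "ln (1 + exp (\<theta> + (2 * \<beta> / real N * (\<Sum>l<j. b l) - 2 * \<beta> * real N / real n)))
       \<le> ln (1 + exp (\<theta> + 2 * \<beta> / real n * (\<Sum>m<i. b' m)))"
      by (rule ln_one_plus_exp_mono) (use 2 in simp)
    finally show ?thesis by (simp add: j_def)
  qed
  have "real k * (\<Sum>j<N. f j) - 2 * \<beta> * real N \<le> real k * (\<Sum>j<N. f j) - real (k * N) * (2 * \<beta> * real N / real n)"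
  proof -
    have "real (k * N) * (2 * \<beta> * real N / real n) \<le> real n * (2 * \<beta> * real N / real n)"
      using kN' \<beta> by (intro mult_right_mono) auto
    also have "\<dots> = 2 * \<beta> * real N" using n by simp
    finally show ?thesis by simp
  qed
  also have "\<dots> = (\<Sum>i<k * N. f (i div k) - 2 * \<beta> * real N / real n)"
    by (simp add: sum_subtractf sum_div_blocks)
  also have "\<dots> \<le> (\<Sum>i<k * N. ln (1 + exp (\<theta> + 2 * \<beta> / real n * (\<Sum>m<i. b' m))))"
    by (rule sum_mono) (use low in simp)
  also have "\<dots> \<le> (\<Sum>i<n. ln (1 + exp (\<theta> + 2 * \<beta> / real n * (\<Sum>m<i. b' m))))"
    using kN by (intro sum_mono2) auto
  finally have A: "real k * (\<Sum>j<N. f j) - 2 * \<beta> * real N \<le> \<dots>" .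
  have "(\<Sum>m<n. (b' m)\<^sup>2) = (\<Sum>m<k * N. (b' m)\<^sup>2)"
    using kN by (intro sum.mono_neutral_right) (auto simp: b'_def)
  also have "\<dots> = (\<Sum>m<k * N. (b (m div k))\<^sup>2)" by (intro sum.cong) (auto simp: b'_def)
  also have "\<dots> = real k * (\<Sum>m<N. (b m)\<^sup>2)" by (rule sum_div_blocks)
  finally have B: "(\<Sum>m<n. (b' m)\<^sup>2) = real k * (\<Sum>m<N. (b m)\<^sup>2)" .
  have "real k * mean_field N \<theta> \<beta> b - 2 * \<beta> * real N \<le> mean_field n \<theta> \<beta> b'"
    using A unfolding mean_field_def f_def[symmetric] B by (simp add: algebra_simps)
  also have "\<dots> \<le> mean_field_max n \<theta> \<beta>" by (rule mean_field_le_max[OF b'_box])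
  finally show ?thesis using b by (simp add: k_def)
qed

lemma bdd_above_mean_field_max:
  assumes "\<beta> \<ge> 0"
  shows "bdd_above ((\<lambda>n. mean_field_max n \<theta> \<beta> / real n) ` {1..})"
proof (rule bdd_aboveI2)
  fix n :: nat assume "n \<in> {1..}"
  then show "mean_field_max n \<theta> \<beta> / real n \<le> ln (1 + exp (\<theta> + 2 * \<beta>))"
    using mean_field_max_le[OF assms, of n \<theta>] by (simp add: field_simps)
qed

text \<open>As in Fekete's lemma: blowing up level \<open>N\<close> loses
  \<open>2 * \<beta> * N\<close>, which does not grow with \<open>n\<close>, and a fraction below
  \<open>N / n\<close> of the sites. So every \<open>mean_field_max N / N\<close> is an asymptotic
  lower bound.\<close>

lemma mean_field_max_tendsto:
  assumes \<beta>: "\<beta> \<ge> 0"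
  shows "(\<lambda>n. mean_field_max n \<theta> \<beta> / real n) \<longlonglongrightarrow> free_energy \<theta> \<beta>"
proof (rule order_tendstoI)
  fix a assume "free_energy \<theta> \<beta> < a"
  moreover have "mean_field_max n \<theta> \<beta> / real n \<le> free_energy \<theta> \<beta>" if "n \<ge> 1" for n
    unfolding free_energy_def by (rule cSUP_upper[OF _ bdd_above_mean_field_max[OF \<beta>]]) (use that in simp)
  ultimately show "\<forall>\<^sub>F n in sequentially. mean_field_max n \<theta> \<beta> / real n < a"
    by (intro eventually_mono[OF eventually_ge_at_top[of 1]]) (rule le_less_trans)
next
  fix a assume "a < free_energy \<theta> \<beta>"
  then obtain N where N: "N \<ge> 1" and a: "a < mean_field_max N \<theta> \<beta> / real N"
    unfolding free_energy_def
    by (subst (asm) less_cSUP_iff[OF _ bdd_above_mean_field_max[OF \<beta>]]) auto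
  have lim: "(\<lambda>n. (1 - real N / real n) * (mean_field_max N \<theta> \<beta> / real N) - 2 * \<beta> * real N / real n)
      \<longlonglongrightarrow> (1 - 0) * (mean_field_max N \<theta> \<beta> / real N) - 0"
    by (intro tendsto_intros lim_const_over_n)
  have "\<forall>\<^sub>F n in sequentially. a < (1 - real N / real n) * (mean_field_max N \<theta> \<beta> / real N) - 2 * \<beta> * real N / real n"
    using order_tendstoD(1)[OF lim, of a] a by simp
  then show "\<forall>\<^sub>F n in sequentially. a < mean_field_max n \<theta> \<beta> / real n"
    using eventually_ge_at_top[of 1]
  proof eventually_elim
    case (elim n)
    have "n < (n div N) * N + N" using N dividend_less_div_times[of N n] by simp
    then have "real n - real N \<le> real (n div N) * real N"
      by (metis of_nat_add of_nat_mult of_nat_less_iff less_eq_real_def diff_le_eq)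
    then have "1 - real N / real n \<le> real (n div N) * real N / real n"
      using divide_right_mono[of "real n - real N" _ "real n"] elim by (simp add: diff_divide_distrib)
    then have "(1 - real N / real n) * (mean_field_max N \<theta> \<beta> / real N)
        \<le> real (n div N) * real N / real n * (mean_field_max N \<theta> \<beta> / real N)"
      using mean_field_max_nonneg by (intro mult_right_mono) auto
    also have "\<dots> = real (n div N) * mean_field_max N \<theta> \<beta> / real n" using N by simp
    finally have "(1 - real N / real n) * (mean_field_max N \<theta> \<beta> / real N) - 2 * \<beta> * real N / real n
       \<le> (real (n div N) * mean_field_max N \<theta> \<beta> - 2 * \<beta> * real N) / real n"
      by (simp add: diff_divide_distrib)
    also have "\<dots> \<le> mean_field_max n \<theta> \<beta> / real n"
      using mean_field_max_blocks[OF \<beta> N, of n \<theta>] elim by (intro divide_right_mono) auto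
    finally show ?case using elim by linarith
  qed
qed

lemma ln_partition_fun_tendsto:
  assumes \<beta>: "\<beta> \<ge> 0"
  shows "(\<lambda>n. ln (partition_fun n \<theta> \<beta>) / real n) \<longlonglongrightarrow> free_energy \<theta> \<beta>"
proof (rule order_tendstoI)
  fix a assume a: "a < free_energy \<theta> \<beta>"
  have "(\<lambda>n. mean_field_max n \<theta> \<beta> / real n - \<beta> / real n) \<longlonglongrightarrow> free_energy \<theta> \<beta> - 0"
    by (intro tendsto_diff mean_field_max_tendsto \<beta> lim_const_over_n)
  then have "\<forall>\<^sub>F n in sequentially. a < mean_field_max n \<theta> \<beta> / real n - \<beta> / real n"
    using a by (auto dest: order_tendstoD)
  then show "\<forall>\<^sub>F n in sequentially. a < ln (partition_fun n \<theta> \<beta>) / real n"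
    using eventually_ge_at_top[of 1]
  proof eventually_elim
    case (elim n)
    obtain b where "mean_field_max n \<theta> \<beta> = mean_field n \<theta> \<beta> b"
      using mean_field_max_attained by blast
    then have le: "exp (mean_field_max n \<theta> \<beta> - \<beta>) \<le> partition_fun n \<theta> \<beta>"
      using partition_fun_ge[of n \<beta> \<theta> b] elim \<beta> by simp
    have "0 < partition_fun n \<theta> \<beta>" by (rule less_le_trans[OF exp_gt_zero le])
    then have "mean_field_max n \<theta> \<beta> - \<beta> \<le> ln (partition_fun n \<theta> \<beta>)" using le by (simp add: ln_ge_iff)
    then have "(mean_field_max n \<theta> \<beta> - \<beta>) / real n \<le> ln (partition_fun n \<theta> \<beta>) / real n"
      by (intro divide_right_mono) auto
    then show ?case using elim by (simp add: diff_divide_distrib)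
  qed
next
  fix a assume a: "free_energy \<theta> \<beta> < a"
  define \<epsilon> where "\<epsilon> = a - free_energy \<theta> \<beta>"
  have \<epsilon>: "\<epsilon> > 0" using a by (simp add: \<epsilon>_def)
  \<comment> \<open>Order of the choices: \<open>K\<close> is fixed first, to make the linearisation
    error per site small; the size of the net is then constant in \<open>n\<close> and its logarithm
    vanishes after division by \<open>n\<close>.\<close>
  have "(\<lambda>K. 4 * \<beta> / (real K)\<^sup>2) \<longlonglongrightarrow> 0" by real_asymp
  then have "\<forall>\<^sub>F K in sequentially. 4 * \<beta> / (real K)\<^sup>2 < \<epsilon>" using \<epsilon> by (auto dest: order_tendstoD)
  then have "\<forall>\<^sub>F K in sequentially. 4 * \<beta> / (real K)\<^sup>2 < \<epsilon> \<and> K \<ge> 1"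
    using eventually_ge_at_top[of 1] by eventually_elim simp
  then obtain K :: nat where K: "4 * \<beta> / (real K)\<^sup>2 < \<epsilon>" "K \<ge> 1"
    using eventually_happens[of _ sequentially] by auto
  have "(\<lambda>n. mean_field_max n \<theta> \<beta> / real n + ln ((real K + 1) ^ K) / real n) \<longlonglongrightarrow> free_energy \<theta> \<beta> + 0"
    by (intro tendsto_add mean_field_max_tendsto \<beta> lim_const_over_n)
  then have "\<forall>\<^sub>F n in sequentially. mean_field_max n \<theta> \<beta> / real n + ln ((real K + 1) ^ K) / real n < a - 4 * \<beta> / (real K)\<^sup>2"
    using K by (intro order_tendstoD) (auto simp: \<epsilon>_def)
  then show "\<forall>\<^sub>F n in sequentially. ln (partition_fun n \<theta> \<beta>) / real n < a"
    using eventually_ge_at_top[of 1]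
  proof eventually_elim
    case (elim n)
    have le: "partition_fun n \<theta> \<beta> \<le> (real K + 1) ^ K * exp (mean_field_max n \<theta> \<beta> + 4 * \<beta> * real n / (real K)\<^sup>2)"
      using partition_fun_le[of n \<beta> K \<theta>] elim \<beta> K mean_field_le_max by blast
    have "0 < partition_fun n \<theta> \<beta>"
      using partition_fun_ge[of n \<beta> \<theta>] elim \<beta> by (meson exp_gt_zero less_le_trans)
    then have "ln (partition_fun n \<theta> \<beta>) \<le> ln ((real K + 1) ^ K * exp (mean_field_max n \<theta> \<beta> + 4 * \<beta> * real n / (real K)\<^sup>2))"
      using le by simp
    also have "\<dots> = ln ((real K + 1) ^ K) + (mean_field_max n \<theta> \<beta> + 4 * \<beta> * real n / (real K)\<^sup>2)"
      by (subst ln_mult) (auto simp: add_nonneg_pos)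
    finally have "ln (partition_fun n \<theta> \<beta>) / real n \<le>
        (ln ((real K + 1) ^ K) + (mean_field_max n \<theta> \<beta> + 4 * \<beta> * real n / (real K)\<^sup>2)) / real n"
      by (intro divide_right_mono) auto
    also have "\<dots> = mean_field_max n \<theta> \<beta> / real n + ln ((real K + 1) ^ K) / real n + 4 * \<beta> / (real K)\<^sup>2"
      using elim by (simp add: add_divide_distrib)
    finally show ?case using elim by linarith
  qed
qed

section \<open>Identification of the Lyapunov exponent\<close>

lemma has_lyapunov_exponent_free_energy:
  assumes bm: "standard_brownian_motion M W" and x0: "x0 > 0" and \<rho>: "\<rho> > 0" and \<beta>: "\<beta> > 0"
  shows "has_lyapunov_exponent M W x0 \<rho> \<beta> (free_energy (ln \<rho>) \<beta>)"
  unfolding has_lyapunov_exponent_def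
proof (intro allI impI)
  fix \<sigma> \<tau> :: "nat \<Rightarrow> real"
  assume A: "\<forall>n\<ge>1. \<sigma> n > 0 \<and> \<tau> n > 0 \<and> 1/2 * (\<sigma> n)\<^sup>2 * \<tau> n * (real n)\<^sup>2 = \<beta>"
  have "(\<lambda>n. ln x0 / real n + ln (partition_fun n (ln \<rho>) \<beta>) / real n) \<longlonglongrightarrow> 0 + free_energy (ln \<rho>) \<beta>"
    using \<beta> by (intro tendsto_add ln_partition_fun_tendsto lim_const_over_n) auto
  moreover have "\<forall>\<^sub>F n in sequentially. ln x0 / real n + ln (partition_fun n (ln \<rho>) \<beta>) / real n
      = 1 / real n * ln (\<integral>\<omega>. growth W x0 \<rho> (\<sigma> n) (\<tau> n) n \<omega> \<partial>M)"
    using eventually_ge_at_top[of 1]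
  proof eventually_elim
    case (elim n)
    have "0 < partition_fun n (ln \<rho>) \<beta>"
      using partition_fun_ge[of n \<beta> "ln \<rho>"] elim \<beta> by (meson exp_gt_zero less_le_trans less_imp_le)
    then show ?case
      using A elim x0 by (simp add: expectation_growth[OF bm \<rho>] ln_mult add_divide_distrib)
  qed
  ultimately show "(\<lambda>n. 1 / real n * ln (\<integral>\<omega>. growth W x0 \<rho> (\<sigma> n) (\<tau> n) n \<omega> \<partial>M)) \<longlonglongrightarrow> free_energy (ln \<rho>) \<beta>"
    using Lim_transform_eventually by fastforce
qed

lemma has_lyapunov_exponent_unique:
  assumes "has_lyapunov_exponent M W x0 \<rho> \<beta> L" "has_lyapunov_exponent M W x0 \<rho> \<beta> L'" and \<beta>: "\<beta> > 0"
  shows "L = L'"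
proof -
  \<comment> \<open>With \<open>\<sigma> = 1\<close> this is an admissible scaling, so the
    universally quantified definition is not vacuous and a single sequence determines the
    limit.\<close>
  define \<tau> where "\<tau> n = 2 * \<beta> / (real n)\<^sup>2" for n :: nat
  have "\<forall>n\<ge>1. (1::real) > 0 \<and> \<tau> n > 0 \<and> 1/2 * 1\<^sup>2 * \<tau> n * (real n)\<^sup>2 = \<beta>"
    using \<beta> by (simp add: \<tau>_def)
  then have "(\<lambda>n. 1 / real n * ln (\<integral>\<omega>. growth W x0 \<rho> 1 (\<tau> n) n \<omega> \<partial>M)) \<longlonglongrightarrow> L"
    "(\<lambda>n. 1 / real n * ln (\<integral>\<omega>. growth W x0 \<rho> 1 (\<tau> n) n \<omega> \<partial>M)) \<longlonglongrightarrow> L'"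
    using assms(1)[unfolded has_lyapunov_exponent_def, rule_format, of "\<lambda>_. 1" \<tau>]
      assms(2)[unfolded has_lyapunov_exponent_def, rule_format, of "\<lambda>_. 1" \<tau>] by auto
  then show ?thesis by (rule LIMSEQ_unique)
qed

lemma lyapunov_exponent_eq:
  assumes "standard_brownian_motion M W" "x0 > 0" "\<rho> > 0" "\<beta> > 0"
  shows "lyapunov_exponent M W x0 (\<rho>, \<beta>) = free_energy (ln \<rho>) \<beta>"
  unfolding lyapunov_exponent_def
  using has_lyapunov_exponent_free_energy[OF assms] has_lyapunov_exponent_unique[OF _ _ assms(4)]
  by (auto intro!: the_equality)

section \<open>Transit integrals\<close>

text \<open>The reciprocal of the occupation probability as a function of the energy:
  \<open>psi (softplus x) * sig x = 1\<close>.\<close>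

definition psi :: "'a::{real_normed_field,banach} \<Rightarrow> 'a" where
  "psi z = 1 / (1 - exp (- z))"

definition psi_deriv :: "'a::{real_normed_field,banach} \<Rightarrow> 'a" where
  "psi_deriv z = - exp (- z) / (1 - exp (- z))\<^sup>2"

text \<open>\<open>transit m R\<close> is the integral \<open>K(m, R)\<close> after the substitution \<open>s = m t\<close>. The type class covers both the
  real function and its holomorphic extension.\<close>

definition potential :: "'a::{real_normed_field,banach} \<Rightarrow> 'a \<Rightarrow> real \<Rightarrow> 'a" where
  "potential m R t = R + m\<^sup>2 * (1 - of_real t ^ 2)"

text \<open>Parameters for which \<open>psi\<close> meets no pole along the path of
  integration.\<close>

definition regular :: "('a::{real_normed_field,banach} \<times> 'a) set" where
  "regular = {(m, R). \<forall>t\<in>{0..1}. exp (- potential m R t) \<noteq> 1}"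

text \<open>Order 0 gives the transit integral. Order 2 represents the mean of
  \<open>b\<^sup>2\<close> along a maximiser, up to explicit factors, and enters the value of the
  maximum.\<close>

definition moment :: "nat \<Rightarrow> 'a::{real_normed_field,banach} \<Rightarrow> 'a \<Rightarrow> 'a" where
  "moment k m R = integral {0..1} (\<lambda>t. of_real t ^ k * psi (potential m R t))"

definition transit :: "'a::{real_normed_field,banach} \<Rightarrow> 'a \<Rightarrow> 'a" where
  "transit m R = m * moment 0 m R"

text \<open>The explicit result of differentiating under the integral sign, so that joint continuity
  in both arguments can be read off.\<close>

definition transit_deriv :: "'a::{real_normed_field,banach} \<Rightarrow> 'a \<Rightarrow> 'a" where
  "transit_deriv m R = moment 0 m R
     + m * integral {0..1} (\<lambda>t. psi_deriv (potential m R t) * (2 * m * (1 - of_real t ^ 2)))"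

lemma psi_has_field_derivative:
  "exp (- z) \<noteq> 1 \<Longrightarrow> (psi has_field_derivative psi_deriv z) (at z within A)"
  unfolding psi_def psi_deriv_def
  by (auto intro!: derivative_eq_intros simp: power2_eq_square)

lemma regular_real: "R > 0 \<Longrightarrow> (m, R :: real) \<in> regular"
proof -
  assume "R > 0"
  then have "0 < potential m R t" if "t \<in> {0..1}" for t
    using that by (auto simp: potential_def power_le_one intro: add_pos_nonneg)
  then show ?thesis by (auto simp: regular_def) (metis atLeastAtMost_iff less_irrefl)
qed

text \<open>In this sector \<open>m\<^sup>2\<close> has nonnegative real part, so the potential
  stays in the open right half plane, where \<open>exp (- z)\<close> cannot be 1.\<close>

lemma regular_complex:
  assumes "\<bar>Im m\<bar> \<le> Re m" "Re R > 0"
  shows "(m, R) \<in> regular"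
proof -
  have "0 < Re (potential m R t)" if t: "t \<in> {0..1}" for t
  proof -
    have "0 \<le> Re (m\<^sup>2)"
      using abs_le_square_iff[of "Im m" "Re m"] assms by (simp add: Re_power2)
    moreover have "0 \<le> 1 - t\<^sup>2" using t by (simp add: power_le_one)
    moreover have "potential m R t = R + m\<^sup>2 * of_real (1 - t\<^sup>2)" by (simp add: potential_def)
    ultimately show ?thesis using assms by (simp add: add_pos_nonneg)
  qed
  then show ?thesis by (fastforce simp: regular_def exp_eq_1)
qed

lemma exp_minus_of_real: "exp (- complex_of_real x) = of_real (exp (- x))"
  by (metis exp_of_real of_real_minus)

lemma continuous_on_psi_potential:
  "continuous_on (regular \<times> cbox 0 1) (\<lambda>(p, t). of_real t ^ k * psi (potential (fst p) (snd p) t))"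
  unfolding psi_def potential_def split_beta
  by (intro continuous_intros) (auto simp: regular_def potential_def)

lemma continuous_on_moment: "continuous_on regular (\<lambda>(m, R). moment k m R)"
proof -
  have "continuous_on regular (\<lambda>p. integral (cbox 0 1) (\<lambda>t. of_real t ^ k * psi (potential (fst p) (snd p) t)))"
    by (rule integral_continuous_on_param[OF continuous_on_psi_potential])
  then show ?thesis by (simp add: moment_def[abs_def] split_beta)
qed

lemma moment_integrable:
  assumes "(m, R) \<in> regular"
  shows "(\<lambda>t. of_real t ^ k * psi (potential m R t)) integrable_on {0..1}"
  unfolding psi_def potential_def using assms
  by (intro integrable_continuous_interval continuous_intros) (auto simp: regular_def potential_def)

lemma continuous_on_transit: "continuous_on regular (\<lambda>(m, R). transit m R)"
  using continuous_on_moment[of 0] by (auto simp: transit_def split_beta intro!: continuous_intros)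

lemma continuous_on_transit_deriv: "continuous_on regular (\<lambda>(m, R). transit_deriv m R)"
proof -
  have "continuous_on (regular \<times> cbox 0 1)
      (\<lambda>(p, t). psi_deriv (potential (fst p) (snd p) t) * (2 * fst p * (1 - of_real t ^ 2)))"
    unfolding psi_deriv_def potential_def split_beta
    by (intro continuous_intros) (auto simp: regular_def potential_def)
  from integral_continuous_on_param[OF this] continuous_on_moment[of 0] show ?thesis
    by (auto simp: transit_deriv_def split_beta intro!: continuous_intros)
qed

text \<open>The convex open set \<open>U\<close> is a parameter so that one proof serves the real
  line, a complex sector and small complex balls.\<close>

lemma transit_has_field_derivative:
  fixes m R :: "'a::{real_normed_field,banach}"
  assumes m: "m \<in> U" and U: "convex U" "open U" and reg: "\<And>x. x \<in> U \<Longrightarrow> (x, R) \<in> regular"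
  shows "((\<lambda>x. transit x R) has_field_derivative transit_deriv m R) (at m)"
proof -
  have cont: "continuous_on (U \<times> cbox 0 1) (\<lambda>(x, t). psi_deriv (potential x R t) * (2 * x * (1 - of_real t ^ 2)))"
    unfolding psi_deriv_def potential_def split_beta using reg
    by (intro continuous_intros) (auto simp: regular_def potential_def)
  have "((\<lambda>x. integral (cbox 0 1) (\<lambda>t. psi (potential x R t))) has_field_derivative
     integral (cbox 0 1) (\<lambda>t. psi_deriv (potential m R t) * (2 * m * (1 - of_real t ^ 2)))) (at m within U)"
  proof (rule leibniz_rule_field_derivative[OF _ _ cont m U(1)])
    fix x and t :: real assume xt: "x \<in> U" "t \<in> cbox 0 1"
    have "((\<lambda>x. potential x R t) has_field_derivative (2 * x * (1 - of_real t ^ 2))) (at x within U)"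
      unfolding potential_def by (auto intro!: derivative_eq_intros)
    moreover have "(psi has_field_derivative psi_deriv (potential x R t)) (at (potential x R t))"
      using reg[OF xt(1)] xt by (intro psi_has_field_derivative) (auto simp: regular_def)
    ultimately show "((\<lambda>x. psi (potential x R t)) has_field_derivative
       psi_deriv (potential x R t) * (2 * x * (1 - of_real t ^ 2))) (at x within U)"
      by (rule DERIV_chain2[rotated])
  next
    fix x assume "x \<in> U"
    then show "(\<lambda>t. psi (potential x R t)) integrable_on cbox 0 1"
      using moment_integrable[OF reg, of x 0] by simp
  qed
  then have "((\<lambda>x. moment 0 x R) has_field_derivative
     integral {0..1} (\<lambda>t. psi_deriv (potential m R t) * (2 * m * (1 - of_real t ^ 2)))) (at m)"
    using at_within_open[OF m U(2)] by (simp add: moment_def)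
  then show ?thesis
    unfolding transit_def transit_deriv_def by (auto intro!: derivative_eq_intros)
qed

lemma transit_has_real_derivative:
  "R > 0 \<Longrightarrow> ((\<lambda>x. transit x R) has_real_derivative transit_deriv m R) (at m)"
  by (rule transit_has_field_derivative[where U = UNIV]) (auto intro: regular_real)

text \<open>Composing with holomorphic curves makes the moments holomorphic in each parameter separately,
  which is all that the power series expansion will need.\<close>

lemma moment_holomorphic_on:
  assumes "m holomorphic_on U" "R holomorphic_on U" "open U" "convex U"
    and reg: "\<And>w. w \<in> U \<Longrightarrow> (m w, R w) \<in> regular"
  shows "(\<lambda>w. moment k (m w) (R w)) holomorphic_on U"
proof -
  define D where "D w t = of_real t ^ k * (psi_deriv (potential (m w) (R w) t)
     * (deriv R w + 2 * m w * deriv m w * (1 - of_real t ^ 2)))" for w and t :: real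
  have hol: "continuous_on U m" "continuous_on U R" "continuous_on U (deriv m)" "continuous_on U (deriv R)"
    using assms by (auto intro!: holomorphic_on_imp_continuous_on holomorphic_deriv)
  note [continuous_intros] = hol[THEN continuous_on_compose2, of "U \<times> cbox 0 (1::real)" fst]
  have "continuous_on (U \<times> cbox 0 1) (\<lambda>(w, t). D w t)"
    unfolding D_def psi_deriv_def potential_def split_beta using reg
    by (intro continuous_intros) (auto simp: regular_def potential_def)
  then have "(\<lambda>w. integral (cbox 0 1) (\<lambda>t. of_real t ^ k * psi (potential (m w) (R w) t))) holomorphic_on U"
  proof (rule leibniz_rule_holomorphic[rotated 2])
    fix w and t :: real assume wt: "w \<in> U" "t \<in> cbox 0 1"
    have dm: "(m has_field_derivative deriv m w) (at w within U)" "(R has_field_derivative deriv R w) (at w within U)"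
      using assms wt by (auto intro!: DERIV_subset[OF holomorphic_derivI])
    have "((\<lambda>w. potential (m w) (R w) t) has_field_derivative
        deriv R w + 2 * m w * deriv m w * (1 - of_real t ^ 2)) (at w within U)"
      unfolding potential_def by (auto intro!: derivative_eq_intros dm)
    moreover have "(psi has_field_derivative psi_deriv (potential (m w) (R w) t)) (at (potential (m w) (R w) t))"
      using reg[OF wt(1)] wt by (intro psi_has_field_derivative) (auto simp: regular_def)
    ultimately have "((\<lambda>w. psi (potential (m w) (R w) t)) has_field_derivative
       psi_deriv (potential (m w) (R w) t) * (deriv R w + 2 * m w * deriv m w * (1 - of_real t ^ 2))) (at w within U)"
      by (rule DERIV_chain2[rotated])
    then show "((\<lambda>w. of_real t ^ k * psi (potential (m w) (R w) t)) has_field_derivative D w t) (at w within U)"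
      unfolding D_def by (rule DERIV_cmult)
  next
    fix w assume "w \<in> U"
    then show "(\<lambda>t. of_real t ^ k * psi (potential (m w) (R w) t)) integrable_on cbox 0 1"
      using moment_integrable[OF reg] by simp
  qed (use assms in auto)
  then show ?thesis by (simp add: moment_def)
qed

section \<open>Agreement of the complex integrals with the real ones\<close>

lemma psi_of_real: "psi (complex_of_real x) = of_real (psi x)"
  by (simp add: psi_def exp_minus_of_real)

lemma psi_deriv_of_real: "psi_deriv (complex_of_real x) = of_real (psi_deriv x)"
  by (simp add: psi_deriv_def exp_minus_of_real)

lemma potential_of_real: "potential (complex_of_real m) (complex_of_real R) t = of_real (potential m R t)"
  by (simp add: potential_def)

lemma moment_of_real:
  assumes "R > 0"
  shows "moment k (complex_of_real m) (complex_of_real R) = of_real (moment k m R)"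
proof -
  have "((\<lambda>t. t ^ k * psi (potential m R t)) has_integral moment k m R) {0..1}"
    using moment_integrable[OF regular_real[OF assms], of k m] by (simp add: moment_def integrable_integral)
  from has_integral_of_real[OF this, where 'b = complex] show ?thesis
    unfolding moment_def[of k "complex_of_real m"]
    by (intro integral_unique) (simp add: potential_of_real psi_of_real)
qed

lemma transit_of_real: "R > 0 \<Longrightarrow> transit (complex_of_real m) (complex_of_real R) = of_real (transit m R)"
  by (simp add: transit_def moment_of_real)

lemma transit_deriv_of_real:
  assumes "R > 0"
  shows "transit_deriv (complex_of_real m) (complex_of_real R) = of_real (transit_deriv m R)"
proof -
  have "(\<lambda>t. psi_deriv (potential m R t) * (2 * m * (1 - t\<^sup>2))) integrable_on {0..1}"
    unfolding psi_deriv_def potential_def using regular_real[OF assms, of m]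
    by (intro integrable_continuous_interval continuous_intros) (auto simp: regular_def potential_def)
  then have "((\<lambda>t. psi_deriv (potential m R t) * (2 * m * (1 - t\<^sup>2))) has_integral
     integral {0..1} (\<lambda>t. psi_deriv (potential m R t) * (2 * m * (1 - t\<^sup>2)))) {0..1}"
    by (rule integrable_integral)
  from has_integral_of_real[OF this, where 'b = complex]
  have "integral {0..1} (\<lambda>t. psi_deriv (potential (complex_of_real m) (complex_of_real R) t) * (2 * complex_of_real m * (1 - of_real t ^ 2)))
     = of_real (integral {0..1} (\<lambda>t. psi_deriv (potential m R t) * (2 * m * (1 - t\<^sup>2))))"
    by (intro integral_unique) (simp add: potential_of_real psi_deriv_of_real)
  then show ?thesis by (simp add: transit_deriv_def moment_of_real[OF assms])
qed

section \<open>Elementary estimates for psi and transit\<close>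

lemma psi_pos: "u > 0 \<Longrightarrow> psi u > (0::real)"
  by (simp add: psi_def)

lemma psi_ge_1: "u > 0 \<Longrightarrow> psi u \<ge> (1::real)"
  by (simp add: psi_def)

lemma psi_antimono: "0 < u \<Longrightarrow> u \<le> v \<Longrightarrow> psi v \<le> psi (u::real)"
  by (simp add: psi_def frac_le)

lemma psi_ge_inverse:
  assumes "u > 0" shows "psi u \<ge> 1 / (u::real)"
proof -
  have "1 - exp (- u) \<le> u" using exp_ge_add_one_self[of "- u"] by linarith
  then show ?thesis using assms by (simp add: psi_def frac_le)
qed

lemma psi_le_inverse:
  assumes "u > 0" shows "psi u \<le> 1 + 1 / (u::real)"
proof -
  have "(1 + u) * exp (- u) \<le> exp u * exp (- u)"
    using exp_ge_add_one_self[of u] by (intro mult_right_mono) auto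
  then have "1 * u \<le> (1 + u) * (1 - exp (- u))" by (simp add: mult_exp_exp algebra_simps)
  then show ?thesis using assms by (simp add: psi_def field_simps)
qed

lemma abs_exp_minus_diff_le:
  assumes "0 \<le> u" "0 \<le> (v::real)" shows "\<bar>exp (- u) - exp (- v)\<bar> \<le> \<bar>u - v\<bar>"
proof -
  have *: "exp (- u) - exp (- v) \<le> v - u" if "0 \<le> u" "u \<le> v" for u v :: real
  proof -
    have "1 - exp (u - v) \<le> v - u"
      using exp_ge_add_one_self[of "u - v"] by linarith
    then have le: "exp (- u) * (1 - exp (u - v)) \<le> 1 * (v - u)"
      using that by (intro mult_mono) auto
    have "exp (- u) - exp (- v) = exp (- u) * (1 - exp (u - v))"
      by (simp add: algebra_simps mult_exp_exp)
    also note le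
    finally show ?thesis by simp
  qed
  show ?thesis
  proof (cases "u \<le> v")
    case True
    then show ?thesis using *[of u v] assms by (simp add: abs_if)
  next
    case False
    then show ?thesis using *[of v u] assms by (simp add: abs_if)
  qed
qed

text \<open>The difference of the two reciprocals is \<open>psi u * psi v\<close> times a difference
  of exponentials, and both factors are at most \<open>psi R\<close>.\<close>

lemma psi_lipschitz:
  assumes "0 < R" "R \<le> u" "R \<le> (v::real)"
  shows "\<bar>psi u - psi v\<bar> \<le> (psi R)\<^sup>2 * \<bar>u - v\<bar>"
proof -
  have "psi u - psi v = psi u * psi v * (exp (- u) - exp (- v))"
    using assms by (simp add: psi_def field_simps)
  then have "\<bar>psi u - psi v\<bar> = psi u * psi v * \<bar>exp (- u) - exp (- v)\<bar>"
    using assms psi_pos[of u] psi_pos[of v] by (simp add: abs_mult)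
  also have "\<dots> \<le> psi R * psi R * \<bar>u - v\<bar>"
    using assms psi_antimono[of R u] psi_antimono[of R v] psi_pos[of R] psi_pos[of u] psi_pos[of v]
    by (intro mult_mono abs_exp_minus_diff_le) auto
  finally show ?thesis by (simp add: power2_eq_square)
qed

lemma potential_ge: "R \<le> potential m R t" if "t \<in> {0..1}" for m R t :: real
  using that by (simp add: potential_def power_le_one)

lemma moment_ge:
  assumes "R > 0" shows "moment 0 m R \<ge> (1::real)"
proof -
  have "integral {0..1} (\<lambda>t::real. 1) \<le> moment 0 m R"
    unfolding moment_def
    using moment_integrable[OF regular_real[OF assms], of 0 m] potential_ge[of _ R m] assms
    by (intro integral_le) (auto intro!: psi_ge_1 intro: less_le_trans)
  then show ?thesis by simp
qed

text \<open>Since \<open>psi\<close> is at least 1. Hence every nonnegative solution of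
  \<open>transit m R = sqrt \<beta>\<close> lies between 0 and \<open>sqrt \<beta>\<close>, which
  supplies compactness later.\<close>

lemma transit_ge: "R > 0 \<Longrightarrow> m \<ge> 0 \<Longrightarrow> transit m R \<ge> (m::real)"
  using moment_ge[of R m] mult_left_mono[of 1 "moment 0 m R" m] by (simp add: transit_def)

text \<open>The substitution \<open>s = m * t\<close>. An integral over a fixed interval suits a
  varying \<open>m\<close>; the integral up to \<open>m\<close> is the one that Riemann sums along a
  maximiser approximate.\<close>

lemma moment_substitution:
  fixes m R :: real
  assumes "m \<ge> 0" "R > 0"
  shows "m ^ Suc k * moment k m R = integral {0..m} (\<lambda>s. s ^ k * psi (R + m\<^sup>2 - s\<^sup>2))"
proof -
  define h where "h s = s ^ k * psi (R + m\<^sup>2 - s\<^sup>2)" for s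
  define G where "G x = integral {0..x} h" for x
  have pos: "0 < R + m\<^sup>2 - s\<^sup>2" if "s \<in> {0..m}" for s
  proof -
    have "s\<^sup>2 \<le> m\<^sup>2" using that by (intro power_mono) auto
    then show ?thesis using assms by linarith
  qed
  then have cont: "continuous_on {0..m} h"
    unfolding h_def psi_def by (intro continuous_intros) (fastforce dest: pos)
  have "((\<lambda>t. h (m * t) * m) has_integral G (m * 1) - G (m * 0)) {0..1}"
  proof (rule fundamental_theorem_of_calculus)
    fix t :: real assume t: "t \<in> {0..1}"
    have img: "(*) m ` {0..1} \<subseteq> {0..m}" using assms by (auto simp: mult_left_le)
    have "(G has_real_derivative h (m * t)) (at (m * t) within {0..m})"
      unfolding G_def by (rule integral_has_real_derivative[OF cont]) (use assms t in \<open>auto simp: mult_left_le\<close>)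
    then have "(G has_real_derivative h (m * t)) (at (m * t) within (*) m ` {0..1})"
      by (rule DERIV_subset[OF _ img])
    then have "((\<lambda>t. G (m * t)) has_real_derivative h (m * t) * m) (at t within {0..1})"
      by (rule DERIV_image_chain[unfolded o_def]) (auto intro!: derivative_eq_intros)
    then show "((\<lambda>t. G (m * t)) has_vector_derivative h (m * t) * m) (at t within {0..1})"
      by (simp add: has_real_derivative_iff_has_vector_derivative)
  qed simp
  then have "((\<lambda>t. h (m * t) * m) has_integral G m) {0..1}" by (simp add: G_def)
  moreover have "(\<lambda>t. h (m * t) * m) = (\<lambda>t. m ^ Suc k * (t ^ k * psi (potential m R t)))"
    by (auto simp: h_def potential_def power_mult_distrib algebra_simps)
  ultimately have "((\<lambda>t. m ^ Suc k * (t ^ k * psi (potential m R t))) has_integral G m) {0..1}" by simp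
  moreover have "((\<lambda>t. m ^ Suc k * (t ^ k * psi (potential m R t))) has_integral m ^ Suc k * moment k m R) {0..1}"
    using moment_integrable[OF regular_real[OF assms(2)], of k m]
    by (intro has_integral_mult_right) (simp add: moment_def integrable_integral)
  ultimately show ?thesis unfolding G_def h_def by (metis has_integral_unique)
qed

section \<open>Maximisers at finite level\<close>

text \<open>Occupation probability of a site in the field \<open>x\<close>; it is the derivative of
  \<open>softplus\<close>.\<close>

definition sig :: "real \<Rightarrow> real" where
  "sig x = exp x / (1 + exp x)"

definition softplus :: "real \<Rightarrow> real" where
  "softplus x = ln (1 + exp x)"

lemma one_plus_exp_pos: "0 < 1 + exp (x::real)"
  by (simp add: add_pos_pos)

lemma softplus_pos: "softplus x > 0"
  unfolding softplus_def by (rule ln_gt_zero) simp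

lemma sig_bounds: "0 < sig x" "sig x \<le> 1"
  using one_plus_exp_pos[of x] by (auto simp: sig_def)

lemma exp_softplus: "exp (softplus x) = 1 + exp x"
  using one_plus_exp_pos[of x] by (simp add: softplus_def)

lemma sig_eq: "sig x = 1 - exp (- softplus x)"
  using one_plus_exp_pos[of x] by (simp add: exp_minus exp_softplus sig_def field_simps)

lemma psi_softplus: "psi (softplus x) * sig x = 1"
  using sig_bounds(1)[of x] by (simp add: psi_def sig_eq)

lemma softplus_mono: "x \<le> y \<Longrightarrow> softplus x \<le> softplus y"
  unfolding softplus_def by (rule ln_one_plus_exp_mono)

lemma softplus_lipschitz: "x \<le> y \<Longrightarrow> softplus y \<le> softplus x + (y - x)"
  unfolding softplus_def by (rule ln_one_plus_exp_lipschitz)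

lemma softplus_has_derivative: "(softplus has_real_derivative sig x) (at x)"
  unfolding softplus_def sig_def
  by (auto intro!: derivative_eq_intros simp: one_plus_exp_pos)

lemma sig_mono: "x \<le> y \<Longrightarrow> sig x \<le> sig y"
  by (simp add: sig_eq softplus_mono)

lemma sig_lipschitz: "x \<le> y \<Longrightarrow> sig y - sig x \<le> y - x"
  using abs_exp_minus_diff_le[of "softplus x" "softplus y"] softplus_lipschitz[of x y] softplus_mono[of x y]
    softplus_pos[of x] softplus_pos[of y] by (simp add: sig_eq)

lemma softplus_convex: "softplus x + sig x * (y - x) \<le> softplus y"
proof (cases x y rule: linorder_cases)
  case less
  obtain z where "x < z" "z < y" "softplus y - softplus x = (y - x) * sig z"
    using MVT2[OF less softplus_has_derivative] by blast
  moreover have "(y - x) * sig x \<le> (y - x) * sig z"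
    using less sig_mono[of x z] \<open>x < z\<close> by (intro mult_left_mono) auto
  ultimately show ?thesis unfolding mult.commute[of "sig x"] by linarith
next
  case greater
  obtain z where "y < z" "z < x" "softplus x - softplus y = (x - y) * sig z"
    using MVT2[OF greater softplus_has_derivative] by blast
  moreover have "(x - y) * sig z \<le> (x - y) * sig x"
    using greater sig_mono[of z x] \<open>z < x\<close> by (intro mult_left_mono) auto
  moreover have "sig x * (y - x) = - ((x - y) * sig x)" by (simp add: algebra_simps)
  ultimately show ?thesis by linarith
qed simp

section \<open>Fields on the sites and the fixed point equation of a maximiser\<close>

definition site :: "nat \<Rightarrow> real \<Rightarrow> real \<Rightarrow> (nat \<Rightarrow> real) \<Rightarrow> nat \<Rightarrow> real" where
  "site n \<theta> \<beta> b i = \<theta> + 2 * \<beta> / real n * (\<Sum>m<i. b m)"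

lemma mean_field_eq: "mean_field n \<theta> \<beta> b = (\<Sum>i<n. softplus (site n \<theta> \<beta> b i)) - \<beta> * (\<Sum>m<n. (b m)\<^sup>2)"
  by (simp add: mean_field_def site_def softplus_def)

text \<open>Only the \<open>softplus\<close> terms are bounded by tangents, the squares are kept
  exactly. Profile and parameters may both move: varying the profile yields the fixed point
  equation, varying the parameters yields the subgradients.\<close>

lemma mean_field_above_tangent:
  "mean_field n \<theta> \<beta> b + (\<Sum>i<n. sig (site n \<theta> \<beta> b i) * (site n \<theta>' \<beta>' b' i - site n \<theta> \<beta> b i))
     + \<beta> * (\<Sum>m<n. (b m)\<^sup>2) - \<beta>' * (\<Sum>m<n. (b' m)\<^sup>2) \<le> mean_field n \<theta>' \<beta>' b'"
proof -
  have "(\<Sum>i<n. softplus (site n \<theta> \<beta> b i) + sig (site n \<theta> \<beta> b i) * (site n \<theta>' \<beta>' b' i - site n \<theta> \<beta> b i))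
     \<le> (\<Sum>i<n. softplus (site n \<theta>' \<beta>' b' i))"
    by (intro sum_mono softplus_convex)
  then show ?thesis by (simp add: mean_field_eq sum.distrib)
qed

text \<open>Prefix sums and strict tail sums are adjoint; this is how tails of \<open>sig\<close>
  enter the equation for a maximiser.\<close>

lemma sum_mult_prefix_sums:
  fixes s c :: "nat \<Rightarrow> real"
  shows "(\<Sum>i<n. s i * (\<Sum>m<i. c m)) = (\<Sum>m<n. c m * (\<Sum>i\<in>{m<..<n}. s i))"
proof -
  have "(\<Sum>i<n. s i * (\<Sum>m<i. c m)) = (\<Sum>i<n. \<Sum>m<n. if m < i then s i * c m else 0)"
  proof (rule sum.cong[OF refl])
    fix i assume "i \<in> {..<n}"
    then have "{m \<in> {..<n}. m < i} = {..<i}" by auto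
    then show "s i * (\<Sum>m<i. c m) = (\<Sum>m<n. if m < i then s i * c m else 0)"
      by (simp add: sum_distrib_left flip: sum.inter_filter)
  qed
  also have "\<dots> = (\<Sum>m<n. \<Sum>i<n. if m < i then s i * c m else 0)" by (rule sum.swap)
  also have "\<dots> = (\<Sum>m<n. c m * (\<Sum>i\<in>{m<..<n}. s i))"
  proof (rule sum.cong[OF refl])
    fix m
    have "{i \<in> {..<n}. m < i} = {m<..<n}" by auto
    then show "(\<Sum>i<n. if m < i then s i * c m else 0) = c m * (\<Sum>i\<in>{m<..<n}. s i)"
      by (simp add: sum_distrib_left mult.commute flip: sum.inter_filter)
  qed
  finally show ?thesis .
qed

text \<open>The map \<open>T\<close> sending \<open>b\<close> to the tails of the occupation probabilities of its linearisation raises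
  the functional by at least \<open>\<beta> \<parallel>T b - b\<parallel>\<^sup>2\<close>, so a maximiser is a fixed point even on the boundary of the box.\<close>

lemma mean_field_maximiser_fixed_point:
  assumes \<beta>: "\<beta> > 0" and n: "n \<ge> 1" and m: "m < n" and b: "b \<in> unit_box"
    and max: "\<And>b'. b' \<in> unit_box \<Longrightarrow> mean_field n \<theta> \<beta> b' \<le> mean_field n \<theta> \<beta> b"
  shows "b m = (\<Sum>i\<in>{m<..<n}. sig (site n \<theta> \<beta> b i)) / real n"
proof -
  define T where "T m = (\<Sum>i\<in>{m<..<n}. sig (site n \<theta> \<beta> b i)) / real n" for m
  have "T \<in> unit_box"
  proof -
    have "0 \<le> T m \<and> T m \<le> 1" for m
    proof -
      have "(\<Sum>i\<in>{m<..<n}. sig (site n \<theta> \<beta> b i)) \<le> (\<Sum>i\<in>{m<..<n}. 1)"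
        by (intro sum_mono sig_bounds)
      also have "\<dots> \<le> real n" by simp
      finally show ?thesis
        using n sum_nonneg[of "{m<..<n}" "\<lambda>i. sig (site n \<theta> \<beta> b i)"] sig_bounds
        by (simp add: T_def less_imp_le)
    qed
    then show ?thesis by (simp add: unit_box_def)
  qed
  have "site n \<theta> \<beta> T i - site n \<theta> \<beta> b i = 2 * \<beta> / real n * (\<Sum>m<i. T m - b m)" for i
    by (simp only: site_def sum_subtractf right_diff_distrib)
  then have "(\<Sum>i<n. sig (site n \<theta> \<beta> b i) * (site n \<theta> \<beta> T i - site n \<theta> \<beta> b i))
    = 2 * \<beta> / real n * (\<Sum>i<n. sig (site n \<theta> \<beta> b i) * (\<Sum>m<i. T m - b m))"
    by (simp only: sum_distrib_left[of "2 * \<beta> / real n" _ "{..<n}"] mult.left_commute[of "sig _"])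
  also have "\<dots> = 2 * \<beta> / real n * (\<Sum>m<n. (T m - b m) * (\<Sum>i\<in>{m<..<n}. sig (site n \<theta> \<beta> b i)))"
    by (simp only: sum_mult_prefix_sums)
  also have "(\<lambda>m. \<Sum>i\<in>{m<..<n}. sig (site n \<theta> \<beta> b i)) = (\<lambda>m. real n * T m)"
    using n by (simp add: T_def)
  also have "2 * \<beta> / real n * (\<Sum>m<n. (T m - b m) * (real n * T m)) = 2 * \<beta> * (\<Sum>m<n. (T m - b m) * T m)"
    using n by (simp add: sum_distrib_left mult_ac)
  finally have "mean_field n \<theta> \<beta> b + 2 * \<beta> * (\<Sum>m<n. (T m - b m) * T m)
     + \<beta> * (\<Sum>m<n. (b m)\<^sup>2) - \<beta> * (\<Sum>m<n. (T m)\<^sup>2) \<le> mean_field n \<theta> \<beta> T"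
    using mean_field_above_tangent[of n \<theta> \<beta> b \<theta> \<beta> T] by simp
  also have "\<dots> \<le> mean_field n \<theta> \<beta> b" by (rule max[OF \<open>T \<in> unit_box\<close>])
  finally have "2 * \<beta> * (\<Sum>m<n. (T m - b m) * T m)
     + \<beta> * (\<Sum>m<n. (b m)\<^sup>2) - \<beta> * (\<Sum>m<n. (T m)\<^sup>2) \<le> 0" by simp
  moreover have "2 * \<beta> * (\<Sum>m<n. (T m - b m) * T m)
     + \<beta> * (\<Sum>m<n. (b m)\<^sup>2) - \<beta> * (\<Sum>m<n. (T m)\<^sup>2) = \<beta> * (\<Sum>m<n. (T m - b m)\<^sup>2)"
    by (simp add: sum_distrib_left flip: sum.distrib sum_subtractf) (simp add: power2_eq_square algebra_simps)
  ultimately have "(\<Sum>m<n. (T m - b m)\<^sup>2) \<le> 0" using \<beta> by (simp add: mult_le_0_iff)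
  then have "(\<Sum>m<n. (T m - b m)\<^sup>2) = 0" by (simp add: antisym sum_nonneg)
  then have "(T m - b m)\<^sup>2 = 0" using m by (subst (asm) sum_nonneg_eq_0_iff) auto
  then show ?thesis by (simp add: T_def)
qed

text \<open>Every cell from \<open>s (Suc i)\<close> to \<open>s i\<close> carries the same mass
  \<open>h\<close>, so the integral is close to \<open>h\<close> times a plain sum of values of
  \<open>W\<close>. The error \<open>L * \<delta> * psi R\<close> comes from moving \<open>W\<close>
  within a cell, the other one from replacing the exact energy by \<open>v i\<close>.\<close>

lemma riemann_sum_error:
  fixes s v :: "nat \<Rightarrow> real" and W :: "real \<Rightarrow> real"
  assumes R: "R > 0" and sN: "s N = 0"
    and dec: "\<And>i. i < N \<Longrightarrow> s (Suc i) < s i \<and> s i - s (Suc i) \<le> \<delta>"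
    and v: "\<And>i. i < N \<Longrightarrow> R \<le> v i"
    and h: "\<And>i. i < N \<Longrightarrow> psi (v i) * (s i - s (Suc i)) = h"
    and close: "\<And>i \<xi>. i < N \<Longrightarrow> s (Suc i) \<le> \<xi> \<Longrightarrow> \<xi> \<le> s i \<Longrightarrow> \<bar>(R + (s 0)\<^sup>2 - \<xi>\<^sup>2) - v i\<bar> \<le> \<eta>"
    and W: "\<And>x y. 0 \<le> x \<Longrightarrow> x \<le> y \<Longrightarrow> y \<le> s 0 \<Longrightarrow> \<bar>W x - W y\<bar> \<le> L * (y - x)"
      "\<And>x. 0 \<le> x \<Longrightarrow> x \<le> s 0 \<Longrightarrow> \<bar>W x\<bar> \<le> B" "continuous_on UNIV W"
    and L: "L \<ge> 0"
  shows "\<bar>integral {0..s 0} (\<lambda>x. W x * psi (R + (s 0)\<^sup>2 - x\<^sup>2)) - h * (\<Sum>i<N. W (s i))\<bar>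
     \<le> (L * \<delta> * psi R + B * ((psi R)\<^sup>2 * \<eta>)) * s 0"
proof -
  define k where "k x = W x * psi (R + (s 0)\<^sup>2 - x\<^sup>2)" for x
  define G where "G x = integral {0..x} k" for x
  define c where "c = L * \<delta> * psi R + B * ((psi R)\<^sup>2 * \<eta>)"
  have anti: "s j \<le> s i" if "i \<le> j" "j \<le> N" for i j
    using that
  proof (induction rule: dec_induct)
    case (step j)
    then show ?case using dec[of j] by simp
  qed simp
  have pos: "R \<le> R + (s 0)\<^sup>2 - x\<^sup>2" if "x \<in> {0..s 0}" for x
    using that by (simp add: power_mono)
  have cont: "continuous_on {0..s 0} k"
  proof -
    have "0 < R + (s 0)\<^sup>2 - x\<^sup>2" if "x \<in> {0..s 0}" for x using pos[OF that] R by linarith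
    then show ?thesis
      unfolding k_def psi_def
      by (intro continuous_intros continuous_on_subset[OF W(3)]) force+
  qed
  have step: "\<bar>(G (s i) - G (s (Suc i))) - h * W (s i)\<bar> \<le> c * (s i - s (Suc i))" if i: "i < N" for i
  proof -
    have le0: "s i \<le> s 0" "0 \<le> s (Suc i)" using anti[of 0 i] anti[of "Suc i" N] i sN by auto
    \<comment> \<open>The mean value theorem for the primitive \<open>G\<close> replaces the
      integral over one cell by a single value of the integrand, which can be compared
      pointwise.\<close>
    have "\<exists>\<xi>\<in>{s (Suc i)<..<s i}. G (s i) - G (s (Suc i)) = k \<xi> * (s i - s (Suc i))"
    proof (rule mvt_simple)
      show "s (Suc i) < s i" using dec[OF i] by simp
      fix x assume x: "s (Suc i) \<le> x" "x \<le> s i"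
      have "(G has_real_derivative k x) (at x within {0..s 0})"
        unfolding G_def by (rule integral_has_real_derivative[OF cont]) (use x le0 in auto)
      then have "(G has_real_derivative k x) (at x within {s (Suc i)..s i})"
        by (rule DERIV_subset) (use le0 in auto)
      then show "(G has_derivative (*) (k x)) (at x within {s (Suc i)..s i})"
        by (simp add: has_field_derivative_def)
    qed
    then obtain \<xi> where \<xi>: "s (Suc i) < \<xi>" "\<xi> < s i" "G (s i) - G (s (Suc i)) = k \<xi> * (s i - s (Suc i))"
      by auto
    have \<xi>0: "\<xi> \<in> {0..s 0}" using \<xi> le0 by auto
    define y where "y = R + (s 0)\<^sup>2 - \<xi>\<^sup>2"
    have yR: "R \<le> y" using pos[OF \<xi>0] by (simp add: y_def)
    have psi_y: "0 < psi y" "psi y \<le> psi R" using yR R psi_pos[of y] psi_antimono[of R y] by auto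
    have 1: "\<bar>W \<xi> - W (s i)\<bar> * psi y \<le> (L * \<delta>) * psi R"
    proof (rule mult_mono)
      have "\<bar>W \<xi> - W (s i)\<bar> \<le> L * (s i - \<xi>)" using W(1)[of \<xi> "s i"] \<xi> \<xi>0 le0 by auto
      also have "\<dots> \<le> L * \<delta>" using dec[OF i] \<xi> L by (intro mult_left_mono) auto
      finally show "\<bar>W \<xi> - W (s i)\<bar> \<le> L * \<delta>" .
      then show "0 \<le> L * \<delta>" by linarith
    qed (use psi_y in auto)
    have 2: "\<bar>W (s i)\<bar> * \<bar>psi y - psi (v i)\<bar> \<le> B * ((psi R)\<^sup>2 * \<eta>)"
    proof (rule mult_mono)
      show "\<bar>W (s i)\<bar> \<le> B" using W(2)[of "s i"] le0 dec[OF i] by auto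
      then show "0 \<le> B" by linarith
      have "\<bar>psi y - psi (v i)\<bar> \<le> (psi R)\<^sup>2 * \<bar>y - v i\<bar>" using psi_lipschitz[OF R yR v[OF i]] .
      also have "\<dots> \<le> (psi R)\<^sup>2 * \<eta>"
        using close[OF i, of \<xi>] \<xi> by (intro mult_left_mono) (auto simp: y_def)
      finally show "\<bar>psi y - psi (v i)\<bar> \<le> (psi R)\<^sup>2 * \<eta>" .
    qed auto
    have "k \<xi> - W (s i) * psi (v i) = (W \<xi> - W (s i)) * psi y + W (s i) * (psi y - psi (v i))"
      by (simp add: k_def y_def algebra_simps)
    also have "\<bar>\<dots>\<bar> \<le> \<bar>W \<xi> - W (s i)\<bar> * psi y + \<bar>W (s i)\<bar> * \<bar>psi y - psi (v i)\<bar>"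
      using psi_y by (intro order_trans[OF abs_triangle_ineq]) (simp add: abs_mult)
    finally have "\<bar>k \<xi> - W (s i) * psi (v i)\<bar> \<le> c" using 1 2 by (simp add: c_def)
    then have "\<bar>k \<xi> - W (s i) * psi (v i)\<bar> * (s i - s (Suc i)) \<le> c * (s i - s (Suc i))"
      using dec[OF i] by (intro mult_right_mono) auto
    moreover have "(G (s i) - G (s (Suc i))) - h * W (s i) = (k \<xi> - W (s i) * psi (v i)) * (s i - s (Suc i))"
      by (simp add: \<xi>(3) h[OF i, symmetric] algebra_simps)
    ultimately show ?thesis using dec[OF i] by (simp add: abs_mult)
  qed
  have tel: "(\<Sum>i<N. f (s i) - f (s (Suc i))) = f (s 0) - f (s N)" for f :: "real \<Rightarrow> real"
    using sum_lessThan_telescope'[of "\<lambda>i. f (s i)" N] .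
  have "G (s 0) - h * (\<Sum>i<N. W (s i)) = (\<Sum>i<N. (G (s i) - G (s (Suc i))) - h * W (s i))"
    using tel[of G] by (simp only: sum_subtractf sum_distrib_left) (simp add: sN G_def)
  also have "\<bar>\<dots>\<bar> \<le> (\<Sum>i<N. c * (s i - s (Suc i)))"
    by (intro order_trans[OF sum_abs] sum_mono step) simp
  also have "\<dots> = c * s 0"
    using tel[of "\<lambda>x. x"] by (simp add: sN flip: sum_distrib_left)
  finally show ?thesis by (simp add: G_def k_def[abs_def] c_def)
qed


text \<open>Data of a maximiser \<open>b\<close> at level \<open>n\<close>:
  \<open>s = sqrt \<beta> * b 0\<close>, \<open>q\<close> is the mean of the squares of
  \<open>b\<close>, and \<open>g\<close> is the mean occupation. The limiting equations hold up to
  \<open>C / n\<close>, whereas the subgradient inequality at the end is exact.\<close>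

definition level_profile :: "nat \<Rightarrow> real \<Rightarrow> real \<Rightarrow> real \<Rightarrow> real \<Rightarrow> real \<Rightarrow> real \<Rightarrow> bool" where
  "level_profile n \<theta> \<beta> C s q g \<longleftrightarrow>
     0 \<le> s \<and> s \<le> sqrt \<beta> \<and> 0 \<le> q \<and> q \<le> 1 \<and>
     \<bar>transit s (softplus \<theta>) - sqrt \<beta>\<bar> \<le> C / real n \<and>
     \<bar>s ^ 3 * moment 2 s (softplus \<theta>) - sqrt \<beta> * \<beta> * q\<bar> \<le> C / real n \<and>
     \<bar>sqrt \<beta> * g - s\<bar> \<le> C / real n \<and>
     \<bar>mean_field_max n \<theta> \<beta> / real n - (softplus \<theta> + s\<^sup>2 - 2 * \<beta> * q)\<bar> \<le> C / real n \<and>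
     (\<forall>\<theta>' \<beta>'. mean_field_max n \<theta> \<beta> / real n + (\<theta>' - \<theta>) * g + (\<beta>' - \<beta>) * q
         \<le> mean_field_max n \<theta>' \<beta>' / real n)"

text \<open>Along a maximiser the energy \<open>u i + \<beta> (b i)\<^sup>2\<close> is conserved up to \<open>O(1 / n)\<close>. This turns the recursion
  into \<open>psi (R + (s 0)\<^sup>2 - (s i)\<^sup>2) (s i - s (i + 1)) \<approx> sqrt \<beta> / n\<close> for \<open>s i = sqrt \<beta> * b i\<close>.\<close>

lemma level_profile_exists:
  assumes \<beta>: "\<beta> > 0"
  shows "\<exists>C. \<forall>n\<ge>1. \<exists>s q g. level_profile n \<theta> \<beta> C s q g"
proof -
  define R where "R = softplus \<theta>"
  have R: "R > 0" by (simp add: R_def softplus_pos)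
  define rt where "rt = sqrt \<beta>"
  have rt: "rt > 0" "rt * rt = \<beta>" "rt\<^sup>2 = \<beta>" using \<beta> by (auto simp: rt_def)
  \<comment> \<open>Bounds \<open>n\<^sup>2\<close> times the energy change in one step:
    \<open>\<beta>\<close> stems from the squared jump of \<open>b\<close>,
    \<open>4 * \<beta>\<^sup>2\<close> from the variation of \<open>sig\<close> across the
    step.\<close>
  define C1 where "C1 = \<beta> + 4 * \<beta>\<^sup>2"
  define E0 where "E0 = (psi R)\<^sup>2 * (C1 + 2 * \<beta>) * rt"
  define E2 where "E2 = (2 * rt * rt * psi R + \<beta> * ((psi R)\<^sup>2 * (C1 + 2 * \<beta>))) * rt"
  define C where "C = rt + E0 + E2 + C1"
  have psiR: "psi R > 0" using R by (rule psi_pos)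
  have nn: "C1 \<ge> 0" "E0 \<ge> 0" "E2 \<ge> 0" using \<beta> rt psiR by (auto simp: C1_def E0_def E2_def)
  have "\<exists>s q g. level_profile n \<theta> \<beta> C s q g" if n: "n \<ge> 1" for n
  proof -
    \<comment> \<open>The last entry \<open>b N\<close> is an empty tail and hence 0, so the
      partition ends at 0 and has \<open>n - 1\<close> cells. The missing cell costs
      \<open>sqrt \<beta> / n\<close>.\<close>
    obtain N where nN: "n = Suc N" using n by (cases n) auto
    obtain b where b: "b \<in> unit_box" "mean_field_max n \<theta> \<beta> = mean_field n \<theta> \<beta> b"
      "\<And>b'. b' \<in> unit_box \<Longrightarrow> mean_field n \<theta> \<beta> b' \<le> mean_field n \<theta> \<beta> b"
      using mean_field_max_attained by blast
    define x where "x = site n \<theta> \<beta> b"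
    define u where "u i = softplus (x i)" for i
    have b01: "0 \<le> b i" "b i \<le> 1" for i using b(1) by (auto simp: unit_box_def)
    have fixp: "b m = (\<Sum>i\<in>{m<..<n}. sig (x i)) / real n" if "m < n" for m
      unfolding x_def by (rule mean_field_maximiser_fixed_point[OF \<beta> n that b(1,3)])
    have bN: "b N = 0" using fixp[of N] atLeastSucLessThan_greaterThanLessThan[of N n] by (simp add: nN)
    have bstep: "b i = b (Suc i) + sig (x (Suc i)) / real n" if "i < N" for i
    proof -
      have "{i<..<n} = insert (Suc i) {Suc i<..<n}" using that nN by auto
      then show ?thesis
        using fixp[of i] fixp[of "Suc i"] that nN by (simp add: add_divide_distrib)
    qed
    have xstep: "x (Suc i) = x i + 2 * \<beta> / real n * b i" for i
      by (simp only: x_def site_def sum.lessThan_Suc distrib_left add.assoc)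
    have x0: "x 0 = \<theta>" by (simp add: x_def site_def)
    have xmono: "x i \<le> x (Suc i)" for i using b01 \<beta> by (simp add: xstep)
    have "R \<le> u i" for i
    proof (induction i)
      case (Suc i)
      then show ?case using softplus_mono[OF xmono[of i]] by (simp add: u_def)
    qed (simp add: u_def x0 R_def)
    note uR = this
    define e where "e i = u i + \<beta> * (b i)\<^sup>2" for i
    define e0 where "e0 = R + \<beta> * (b 0)\<^sup>2"
    have e00: "e 0 = e0" by (simp add: e_def e0_def u_def x0 R_def)
    have estep: "\<bar>e (Suc i) - e i\<bar> \<le> C1 / (real n)\<^sup>2" if i: "i < N" for i
    proof -
      define p where "p = sig (x i)"
      define r where "r = sig (x (Suc i))"
      define d where "d = 2 * \<beta> / real n * b i"
      have r01: "0 < r" "r \<le> 1" using sig_bounds by (auto simp: r_def)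
      have d0: "0 \<le> d" "d \<le> 2 * \<beta> / real n"
        using b01[of i] \<beta> mult_left_mono[of "b i" 1 "2 * \<beta> / real n"] by (auto simp: d_def)
      \<comment> \<open>The rise of \<open>u\<close> lies between \<open>p * d\<close> and
        \<open>r * d\<close>, while \<open>\<beta> b\<^sup>2\<close> falls by \<open>r * d\<close>
        up to a squared jump: the first-order terms cancel.\<close>
      have up: "u (Suc i) - u i \<le> r * d" and lo: "p * d \<le> u (Suc i) - u i"
        using softplus_convex[of "x (Suc i)" "x i"] softplus_convex[of "x i" "x (Suc i)"]
        by (auto simp: u_def r_def p_def xstep d_def)
      have bb: "\<beta> * (b (Suc i))\<^sup>2 - \<beta> * (b i)\<^sup>2 = - (r * d) + \<beta> * r\<^sup>2 / (real n)\<^sup>2"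
      proof -
        have eq: "b (Suc i) = b i - r / real n" using bstep[OF i] by (simp add: r_def)
        show ?thesis unfolding eq by (simp add: d_def power2_diff power_divide algebra_simps)
      qed
      have "\<beta> * r\<^sup>2 / (real n)\<^sup>2 \<le> \<beta> * 1 / (real n)\<^sup>2"
        using \<beta> r01 by (intro divide_right_mono mult_left_mono) (auto simp: power_le_one)
      moreover have "\<beta> * 1 / (real n)\<^sup>2 \<le> C1 / (real n)\<^sup>2"
        by (intro divide_right_mono) (auto simp: C1_def)
      ultimately have U: "e (Suc i) - e i \<le> C1 / (real n)\<^sup>2"
        using up bb by (simp add: e_def)
      have "r - p \<le> d" using sig_lipschitz[OF xmono[of i]] by (simp add: r_def p_def xstep d_def)
      then have "(r - p) * d \<le> d * d" using d0 by (intro mult_right_mono)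
      also have "\<dots> \<le> (2 * \<beta> / real n) * (2 * \<beta> / real n)" using d0 by (intro mult_mono) auto
      also have "\<dots> = 4 * \<beta>\<^sup>2 / (real n)\<^sup>2" by (simp add: power2_eq_square)
      also have "\<dots> \<le> C1 / (real n)\<^sup>2" using \<beta> by (intro divide_right_mono) (auto simp: C1_def)
      finally have "(r - p) * d \<le> C1 / (real n)\<^sup>2" .
      moreover have "0 \<le> \<beta> * r\<^sup>2 / (real n)\<^sup>2" using \<beta> by simp
      ultimately have "- (C1 / (real n)\<^sup>2) \<le> e (Suc i) - e i"
        using lo bb by (simp add: e_def left_diff_distrib)
      then show ?thesis using U by (simp add: abs_le_iff)
    qed
    have "\<bar>e i - e0\<bar> \<le> real i * (C1 / (real n)\<^sup>2)" if "i \<le> N" for i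
      using that
    proof (induction i)
      case (Suc i)
      have "real (Suc i) * (C1 / (real n)\<^sup>2) = real i * (C1 / (real n)\<^sup>2) + C1 / (real n)\<^sup>2"
        by (simp only: of_nat_Suc distrib_right mult_1_left)
      then show ?case using Suc estep[of i] by linarith
    qed (simp add: e00)
    moreover have "real i * (C1 / (real n)\<^sup>2) \<le> C1 / real n" if "i \<le> N" for i
    proof -
      have "real i * (C1 / (real n)\<^sup>2) \<le> real n * (C1 / (real n)\<^sup>2)"
        using that nN nn by (intro mult_right_mono) auto
      then show ?thesis using n by (simp add: power2_eq_square)
    qed
    ultimately have edrift: "\<bar>e i - e0\<bar> \<le> C1 / real n" if "i \<le> N" for i
      using that by (meson order_trans)
    define s where "s i = rt * b i" for i
    have s2: "(s i)\<^sup>2 = \<beta> * (b i)\<^sup>2" for i by (simp add: s_def power_mult_distrib rt)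
    have s_bounds: "0 \<le> s i" "s i \<le> rt" for i
      using b01[of i] rt by (auto simp: s_def mult_left_le)
    have sstep: "s i - s (Suc i) = rt / real n * sig (x (Suc i))" if "i < N" for i
      using bstep[OF that] by (simp add: s_def algebra_simps)
    have dec: "s (Suc i) < s i \<and> s i - s (Suc i) \<le> rt / real n" if "i < N" for i
    proof -
      have "0 < rt / real n * sig (x (Suc i))" "rt / real n * sig (x (Suc i)) \<le> rt / real n"
        using rt n sig_bounds[of "x (Suc i)"] mult_left_mono[of "sig (x (Suc i))" 1 "rt / real n"] by auto
      then show ?thesis using sstep[OF that] by linarith
    qed
    \<comment> \<open>The index is shifted because the jump of \<open>s\<close> over cell
      \<open>i\<close> is governed by site \<open>Suc i\<close>; the energies given to the Riemann
      sum are therefore \<open>u (Suc i)\<close>.\<close>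
    have hh: "psi (u (Suc i)) * (s i - s (Suc i)) = rt / real n" if "i < N" for i
      using psi_softplus[of "x (Suc i)"] by (simp add: sstep[OF that] u_def)
    have e0s: "e0 = R + (s 0)\<^sup>2" by (simp add: e0_def s2)
    have close: "\<bar>(R + (s 0)\<^sup>2 - \<xi>\<^sup>2) - u (Suc i)\<bar> \<le> (C1 + 2 * \<beta>) / real n"
      if i: "i < N" and \<xi>: "s (Suc i) \<le> \<xi>" "\<xi> \<le> s i" for i \<xi>
    proof -
      have "\<xi>\<^sup>2 - (s (Suc i))\<^sup>2 = (\<xi> - s (Suc i)) * (\<xi> + s (Suc i))"
        by (simp add: power2_eq_square algebra_simps)
      also have "\<dots> \<le> (rt / real n) * (2 * rt)"
        using dec[OF i] \<xi> s_bounds[of i] s_bounds[of "Suc i"] by (intro mult_mono) auto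
      also have "\<dots> = 2 * \<beta> / real n" using rt by (simp add: mult.assoc)
      finally have 1: "\<xi>\<^sup>2 - (s (Suc i))\<^sup>2 \<le> 2 * \<beta> / real n" .
      have 2: "0 \<le> \<xi>\<^sup>2 - (s (Suc i))\<^sup>2" using \<xi> s_bounds[of "Suc i"] by (simp add: power_mono)
      have "(R + (s 0)\<^sup>2 - \<xi>\<^sup>2) - u (Suc i) = (e0 - e (Suc i)) - (\<xi>\<^sup>2 - (s (Suc i))\<^sup>2)"
        by (simp add: e0s e_def s2)
      then show ?thesis
        using 1 2 edrift[of "Suc i"] i by (simp add: add_divide_distrib abs_le_iff)
    qed
    have s0: "0 \<le> s 0" "s 0 \<le> rt" using s_bounds by auto
    note riemann = riemann_sum_error[OF R _ dec uR hh close, of N]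
    have I0: "\<bar>integral {0..s 0} (\<lambda>x. 1 * psi (R + (s 0)\<^sup>2 - x\<^sup>2)) - rt / real n * (\<Sum>i<N. 1)\<bar>
      \<le> (0 * (rt / real n) * psi R + 1 * ((psi R)\<^sup>2 * ((C1 + 2 * \<beta>) / real n))) * s 0"
      by (rule riemann) (auto simp: s_def bN)
    have I2: "\<bar>integral {0..s 0} (\<lambda>x. x\<^sup>2 * psi (R + (s 0)\<^sup>2 - x\<^sup>2)) - rt / real n * (\<Sum>i<N. (s i)\<^sup>2)\<bar>
      \<le> (2 * rt * (rt / real n) * psi R + \<beta> * ((psi R)\<^sup>2 * ((C1 + 2 * \<beta>) / real n))) * s 0"
    proof (rule riemann)
      fix x y :: real assume xy: "0 \<le> x" "x \<le> y" "y \<le> s 0"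
      have "y\<^sup>2 - x\<^sup>2 = (y + x) * (y - x)" by (simp add: power2_eq_square algebra_simps)
      also have "\<dots> \<le> 2 * rt * (y - x)" using xy s0 by (intro mult_right_mono) auto
      finally have "y\<^sup>2 - x\<^sup>2 \<le> 2 * rt * (y - x)" .
      moreover have "x\<^sup>2 \<le> y\<^sup>2" using xy by (intro power_mono) auto
      ultimately show "\<bar>x\<^sup>2 - y\<^sup>2\<bar> \<le> 2 * rt * (y - x)" by linarith
    next
      fix x assume "0 \<le> x" "x \<le> s 0"
      then have "x\<^sup>2 \<le> rt\<^sup>2" using s0 by (intro power_mono) auto
      then show "\<bar>x\<^sup>2\<bar> \<le> \<beta>" by (simp add: rt)
    qed (use rt in \<open>auto simp: s_def bN intro!: continuous_intros\<close>)
    define q where "q = (\<Sum>m<n. (b m)\<^sup>2) / real n"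
    define g where "g = (\<Sum>i<n. sig (x i)) / real n"
    have leC: "a / real n \<le> C / real n" if "a \<le> C" for a using that by (intro divide_right_mono) auto
    have p1: "\<bar>transit (s 0) R - rt\<bar> \<le> C / real n"
    proof -
      have "transit (s 0) R = integral {0..s 0} (\<lambda>x. 1 * psi (R + (s 0)\<^sup>2 - x\<^sup>2))"
        using moment_substitution[of "s 0" R 0] s0 R by (simp add: transit_def)
      moreover have "rt / real n * (\<Sum>i<N. 1) = rt - rt / real n" using n by (simp add: nN field_simps)
      moreover have "(0 * (rt / real n) * psi R + 1 * ((psi R)\<^sup>2 * ((C1 + 2 * \<beta>) / real n))) * s 0
          \<le> (0 * (rt / real n) * psi R + 1 * ((psi R)\<^sup>2 * ((C1 + 2 * \<beta>) / real n))) * rt"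
        using s0 nn \<beta> psiR by (intro mult_left_mono) auto
      moreover have "(0 * (rt / real n) * psi R + 1 * ((psi R)\<^sup>2 * ((C1 + 2 * \<beta>) / real n))) * rt = E0 / real n"
        by (simp add: E0_def)
      moreover have "0 \<le> rt / real n" using rt by simp
      ultimately have "\<bar>transit (s 0) R - rt\<bar> \<le> E0 / real n + rt / real n" using I0 by linarith
      also have "\<dots> \<le> C / real n"
        using leC[of "E0 + rt"] nn by (simp add: C_def add_divide_distrib)
      finally show ?thesis .
    qed
    have p2: "\<bar>(s 0) ^ 3 * moment 2 (s 0) R - rt * \<beta> * q\<bar> \<le> C / real n"
    proof -
      have "(s 0) ^ 3 * moment 2 (s 0) R = integral {0..s 0} (\<lambda>x. x\<^sup>2 * psi (R + (s 0)\<^sup>2 - x\<^sup>2))"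
        using moment_substitution[of "s 0" R 2] s0 R by (simp add: eval_nat_numeral)
      moreover have "rt / real n * (\<Sum>i<N. (s i)\<^sup>2) = rt * \<beta> * q"
        by (simp add: s2 q_def nN bN sum_distrib_left sum_divide_distrib mult.assoc)
      moreover have "(2 * rt * (rt / real n) * psi R + \<beta> * ((psi R)\<^sup>2 * ((C1 + 2 * \<beta>) / real n))) * s 0
         \<le> (2 * rt * (rt / real n) * psi R + \<beta> * ((psi R)\<^sup>2 * ((C1 + 2 * \<beta>) / real n))) * rt"
        using s0 nn \<beta> psiR rt by (intro mult_left_mono) auto
      moreover have "(2 * rt * (rt / real n) * psi R + \<beta> * ((psi R)\<^sup>2 * ((C1 + 2 * \<beta>) / real n))) * rt = E2 / real n"
        using n by (simp add: E2_def field_simps)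
      ultimately have "\<bar>(s 0) ^ 3 * moment 2 (s 0) R - rt * \<beta> * q\<bar> \<le> E2 / real n" using I2 by linarith
      also have "\<dots> \<le> C / real n" using nn rt by (intro leC) (simp add: C_def)
      finally show ?thesis .
    qed
    have p3: "\<bar>rt * g - s 0\<bar> \<le> C / real n"
    proof -
      \<comment> \<open>\<open>b 0\<close> adds up the sites strictly beyond 0, so \<open>g\<close>
        exceeds it by the single term of site 0.\<close>
      have "{..<n} = insert 0 {0<..<n}" using nN by auto
      then have "g = sig (x 0) / real n + b 0"
        using fixp[of 0] n by (simp add: g_def add_divide_distrib)
      then have "rt * g - s 0 = rt * sig (x 0) / real n" by (simp add: s_def algebra_simps)
      moreover have "rt * sig (x 0) / real n \<le> rt / real n"
        using rt sig_bounds[of "x 0"] by (intro divide_right_mono) (auto simp: mult_left_le)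
      moreover have "rt / real n \<le> C / real n" using nn by (intro leC) (simp add: C_def)
      moreover have "0 \<le> rt * sig (x 0) / real n" using rt sig_bounds[of "x 0"] by simp
      ultimately show ?thesis by linarith
    qed
    have p4: "\<bar>mean_field_max n \<theta> \<beta> / real n - (R + (s 0)\<^sup>2 - 2 * \<beta> * q)\<bar> \<le> C / real n"
    proof -
      \<comment> \<open>Writing \<open>u i\<close> as \<open>e i - \<beta> * (b i)\<^sup>2\<close>
        makes the quadratic term count twice, which explains the
        \<open>2 * \<beta> * q\<close>.\<close>
      have "mean_field n \<theta> \<beta> b = (\<Sum>i<n. e i - \<beta> * (b i)\<^sup>2) - \<beta> * (\<Sum>m<n. (b m)\<^sup>2)"
        by (simp add: mean_field_eq e_def u_def x_def)
      also have "\<dots> = (\<Sum>i<n. e i) - 2 * \<beta> * (\<Sum>m<n. (b m)\<^sup>2)"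
        by (simp add: sum_subtractf flip: sum_distrib_left)
      also have "\<dots> = (\<Sum>i<n. e i - e0) + real n * e0 - 2 * \<beta> * (real n * q)"
        using n by (simp add: sum_subtractf q_def)
      finally have "mean_field_max n \<theta> \<beta> / real n - (R + (s 0)\<^sup>2 - 2 * \<beta> * q) = (\<Sum>i<n. e i - e0) / real n"
        using b(2) n by (simp add: e0s field_simps)
      moreover have "\<bar>\<Sum>i<n. e i - e0\<bar> \<le> (\<Sum>i<n. C1 / real n)"
        using nN by (intro order_trans[OF sum_abs] sum_mono edrift) auto
      moreover have "(\<Sum>i<n. C1 / real n) = C1" using n by simp
      ultimately have "\<bar>mean_field_max n \<theta> \<beta> / real n - (R + (s 0)\<^sup>2 - 2 * \<beta> * q)\<bar> \<le> C1 / real n"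
        by (simp add: divide_right_mono)
      also have "\<dots> \<le> C / real n" using nn rt by (intro leC) (simp add: C_def)
      finally show ?thesis .
    qed
    \<comment> \<open>The profile \<open>b\<close> is kept while the parameters move. By the fixed
      point equation the fields contribute \<open>2 * (\<beta>' - \<beta>) * q\<close> per site, the
      squares take away \<open>(\<beta>' - \<beta>) * q\<close>, and the slope \<open>q\<close>
      remains.\<close>
    have p5: "mean_field_max n \<theta> \<beta> / real n + (\<theta>' - \<theta>) * g + (\<beta>' - \<beta>) * q \<le> mean_field_max n \<theta>' \<beta>' / real n" for \<theta>' \<beta>'
    proof -
      have "site n \<theta>' \<beta>' b i - site n \<theta> \<beta> b i = (\<theta>' - \<theta>) + 2 * (\<beta>' - \<beta>) / real n * (\<Sum>m<i. b m)" for i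
        by (simp add: site_def left_diff_distrib diff_divide_distrib)
      then have "(\<Sum>i<n. sig (x i) * (site n \<theta>' \<beta>' b i - site n \<theta> \<beta> b i))
        = (\<theta>' - \<theta>) * (\<Sum>i<n. sig (x i)) + 2 * (\<beta>' - \<beta>) / real n * (\<Sum>i<n. sig (x i) * (\<Sum>m<i. b m))"
        by (simp only: distrib_left sum.distrib sum_distrib_left[of "2 * (\<beta>' - \<beta>) / real n" _ "{..<n}"]
            mult.left_commute[of "sig _"] sum_distrib_left[of "\<theta>' - \<theta>" _ "{..<n}"] mult.commute[of "sig _" "\<theta>' - \<theta>"])
      also have "(\<Sum>i<n. sig (x i) * (\<Sum>m<i. b m)) = (\<Sum>m<n. b m * (real n * b m))"
        unfolding sum_mult_prefix_sums using n by (intro sum.cong refl) (simp add: fixp)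
      also have "\<dots> = real n * (\<Sum>m<n. (b m)\<^sup>2)"
        by (simp add: power2_eq_square sum_distrib_left mult_ac)
      also have "(\<Sum>m<n. (b m)\<^sup>2) = real n * q"
        using n by (simp add: q_def)
      also have "(\<Sum>i<n. sig (x i)) = real n * g" using n by (simp add: g_def)
      also have "2 * (\<beta>' - \<beta>) / real n * (real n * (real n * q)) = 2 * (\<beta>' - \<beta>) * (real n * q)"
        using n by simp
      finally have "mean_field n \<theta> \<beta> b + ((\<theta>' - \<theta>) * (real n * g) + 2 * (\<beta>' - \<beta>) * (real n * q))
         + \<beta> * (real n * q) - \<beta>' * (real n * q) \<le> mean_field n \<theta>' \<beta>' b"
        using mean_field_above_tangent[of n \<theta> \<beta> b \<theta>' \<beta>' b] n by (simp add: x_def q_def)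
      also have "\<dots> \<le> mean_field_max n \<theta>' \<beta>'" by (rule mean_field_le_max[OF b(1)])
      finally have "mean_field n \<theta> \<beta> b + real n * ((\<theta>' - \<theta>) * g + (\<beta>' - \<beta>) * q) \<le> mean_field_max n \<theta>' \<beta>'"
        using n by (simp add: algebra_simps)
      then have "(mean_field n \<theta> \<beta> b + real n * ((\<theta>' - \<theta>) * g + (\<beta>' - \<beta>) * q)) / real n \<le> mean_field_max n \<theta>' \<beta>' / real n"
        by (intro divide_right_mono) auto
      then show ?thesis using n b(2) by (simp add: add_divide_distrib)
    qed
    have q0: "0 \<le> q" by (simp add: q_def sum_nonneg)
    have "(\<Sum>m<n. (b m)\<^sup>2) \<le> (\<Sum>m<n. 1)" using b01 by (intro sum_mono) (simp add: power_le_one)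
    then have q1: "q \<le> 1" using n by (simp add: q_def)
    have "level_profile n \<theta> \<beta> C (s 0) q g"
      unfolding level_profile_def using p1 p2 p3 p4 p5 q0 q1 s0 by (simp add: R_def rt_def)
    then show ?thesis by blast
  qed
  then show ?thesis by blast
qed

section \<open>The critical point\<close>

text \<open>The limit of \<open>level_profile\<close> with \<open>q\<close> eliminated. Writing
  \<open>q\<close> as \<open>(R + m\<^sup>2 - f) / (2 * \<beta>)\<close> allows the slope to be
  differentiated later through \<open>m\<close> and \<open>f\<close> alone, without the second
  moment. The bound by \<open>softplus \<theta> + m\<^sup>2\<close> records that \<open>q\<close> is
  nonnegative.\<close>

definition stationary :: "real \<Rightarrow> real \<Rightarrow> real \<Rightarrow> bool" where
  "stationary \<theta> \<beta> m \<longleftrightarrow> 0 \<le> m \<and> transit m (softplus \<theta>) = sqrt \<beta> \<and>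
     free_energy \<theta> \<beta> = softplus \<theta> + m\<^sup>2 - 2 * m ^ 3 * moment 2 m (softplus \<theta>) / sqrt \<beta> \<and>
     free_energy \<theta> \<beta> \<le> softplus \<theta> + m\<^sup>2 \<and>
     (\<forall>\<theta>' \<beta>'. \<beta>' > 0 \<longrightarrow> free_energy \<theta> \<beta> + (\<theta>' - \<theta>) * (m / sqrt \<beta>)
        + (\<beta>' - \<beta>) * ((softplus \<theta> + m\<^sup>2 - free_energy \<theta> \<beta>) / (2 * \<beta>)) \<le> free_energy \<theta>' \<beta>')"

text \<open>Compactness: the pairs \<open>(s, q)\<close> lie in a fixed rectangle, \<open>g\<close>
  follows \<open>s\<close>, and every relation passes to the limit along a subsequence.\<close>

lemma stationary_exists:
  assumes \<beta>: "\<beta> > 0"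
  shows "\<exists>m. stationary \<theta> \<beta> m"
proof -
  define R where "R = softplus \<theta>"
  have R: "R > 0" by (simp add: R_def softplus_pos)
  obtain C where "\<forall>n\<ge>1. \<exists>s q g. level_profile n \<theta> \<beta> C s q g"
    using level_profile_exists[OF \<beta>] by blast
  then have ex: "\<exists>s q g. level_profile (Suc n) \<theta> \<beta> C s q g" for n
    by (elim allE[where x = "Suc n"]) simp
  have "\<forall>n. \<exists>p. level_profile (Suc n) \<theta> \<beta> C (fst p) (fst (snd p)) (snd (snd p))"
  proof
    fix n
    obtain s q g where "level_profile (Suc n) \<theta> \<beta> C s q g" using ex[of n] by blast
    then have "level_profile (Suc n) \<theta> \<beta> C (fst (s, q, g)) (fst (snd (s, q, g))) (snd (snd (s, q, g)))"
      by simp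
    then show "\<exists>p. level_profile (Suc n) \<theta> \<beta> C (fst p) (fst (snd p)) (snd (snd p))" by (rule exI)
  qed
  from choice[OF this] obtain p
    where p: "\<forall>n. level_profile (Suc n) \<theta> \<beta> C (fst (p n)) (fst (snd (p n))) (snd (snd (p n)))" ..
  define s q g where "s n = fst (p n)" and "q n = fst (snd (p n))" and "g n = snd (snd (p n))" for n
  have lp: "level_profile (Suc n) \<theta> \<beta> C (s n) (q n) (g n)" for n
    using p by (simp add: s_def q_def g_def)
  have bounds: "0 \<le> s n \<and> s n \<le> sqrt \<beta> \<and> 0 \<le> q n \<and> q n \<le> 1"
    and e1: "\<bar>transit (s n) R - sqrt \<beta>\<bar> \<le> C / real (Suc n)"
    and e2: "\<bar>s n ^ 3 * moment 2 (s n) R - sqrt \<beta> * \<beta> * q n\<bar> \<le> C / real (Suc n)"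
    and e3: "\<bar>sqrt \<beta> * g n - s n\<bar> \<le> C / real (Suc n)"
    and e4: "\<bar>mean_field_max (Suc n) \<theta> \<beta> / real (Suc n) - (R + (s n)\<^sup>2 - 2 * \<beta> * q n)\<bar> \<le> C / real (Suc n)"
    and e5: "mean_field_max (Suc n) \<theta> \<beta> / real (Suc n) + (\<theta>' - \<theta>) * g n + (\<beta>' - \<beta>) * q n
         \<le> mean_field_max (Suc n) \<theta>' \<beta>' / real (Suc n)" for n \<theta>' \<beta>'
    using lp[of n] unfolding level_profile_def R_def by blast+
  have "\<forall>n. (s n, q n) \<in> {0..sqrt \<beta>} \<times> {0..1}"
    using bounds by simp
  moreover have "compact ({0..sqrt \<beta>} \<times> {0..1::real})" by (intro compact_Times compact_Icc)
  ultimately obtain m Q r where r: "strict_mono r" and lim: "((\<lambda>n. (s n, q n)) \<circ> r) \<longlonglongrightarrow> (m, Q)"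
    and mQ: "(m, Q) \<in> {0..sqrt \<beta>} \<times> {0..1}"
    unfolding compact_def by (metis (no_types, lifting) old.prod.exhaust)
  have sm: "(\<lambda>n. s (r n)) \<longlonglongrightarrow> m" and qQ: "(\<lambda>n. q (r n)) \<longlonglongrightarrow> Q"
    using tendsto_fst[OF lim] tendsto_snd[OF lim] by (auto simp: o_def)
  have r_inf: "filterlim r at_top sequentially" using r by (rule filterlim_subseq)
  have err: "(\<lambda>n. C / real (Suc (r n))) \<longlonglongrightarrow> 0"
    by (rule filterlim_compose[OF _ r_inf]) real_asymp
  have squeeze: "(\<lambda>n. f (r n)) \<longlonglongrightarrow> L" if "\<And>n. \<bar>f n - h n\<bar> \<le> C / real (Suc n)" "(\<lambda>n. h (r n)) \<longlonglongrightarrow> L"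
    for f h :: "nat \<Rightarrow> real" and L
  proof -
    have "(\<lambda>n. f (r n) - h (r n)) \<longlonglongrightarrow> 0"
      by (rule Lim_null_comparison[OF _ err]) (use that(1) in simp)
    from tendsto_add[OF this that(2)] show ?thesis by simp
  qed
  have cont: "continuous_on UNIV (\<lambda>x. moment k x R)" for k
  proof -
    have "continuous_on UNIV (\<lambda>x. case (x, R) of (x, R) \<Rightarrow> moment k x R)"
      by (rule continuous_on_compose2[OF continuous_on_moment]) (auto intro!: continuous_intros regular_real R)
    then show ?thesis by simp
  qed
  have mom: "(\<lambda>n. moment k (s (r n)) R) \<longlonglongrightarrow> moment k m R" for k
    by (rule continuous_on_tendsto_compose[OF cont sm]) auto
  have tr: "(\<lambda>n. transit (s (r n)) R) \<longlonglongrightarrow> transit m R"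
    unfolding transit_def by (intro tendsto_intros sm mom)
  have "(\<lambda>n. transit (s (r n)) R) \<longlonglongrightarrow> sqrt \<beta>"
    by (rule squeeze[where h = "\<lambda>_. sqrt \<beta>"]) (use e1 in auto)
  then have transit: "transit m R = sqrt \<beta>" using tr LIMSEQ_unique by blast
  have "(\<lambda>n. (s (r n)) ^ 3 * moment 2 (s (r n)) R) \<longlonglongrightarrow> sqrt \<beta> * \<beta> * Q"
    by (rule squeeze[where h = "\<lambda>n. sqrt \<beta> * \<beta> * q n"])
      (use e2 in \<open>auto intro!: tendsto_intros qQ\<close>)
  moreover have "(\<lambda>n. (s (r n)) ^ 3 * moment 2 (s (r n)) R) \<longlonglongrightarrow> m ^ 3 * moment 2 m R"
    by (intro tendsto_intros sm mom)
  ultimately have Q: "m ^ 3 * moment 2 m R = sqrt \<beta> * \<beta> * Q" using LIMSEQ_unique by blast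
  have "(\<lambda>n. sqrt \<beta> * g (r n)) \<longlonglongrightarrow> m"
    by (rule squeeze[where h = s]) (use e3 sm in auto)
  then have "(\<lambda>n. (sqrt \<beta> * g (r n)) / sqrt \<beta>) \<longlonglongrightarrow> m / sqrt \<beta>"
    by (intro tendsto_divide) (use \<beta> in auto)
  then have gm: "(\<lambda>n. g (r n)) \<longlonglongrightarrow> m / sqrt \<beta>" using \<beta> by simp
  have fe: "(\<lambda>n. mean_field_max (Suc (r n)) \<theta>' \<beta>' / real (Suc (r n))) \<longlonglongrightarrow> free_energy \<theta>' \<beta>'"
    if "\<beta>' > 0" for \<theta>' \<beta>'
    using filterlim_compose[OF LIMSEQ_Suc[OF mean_field_max_tendsto] r_inf] that by simp
  have "(\<lambda>n. mean_field_max (Suc (r n)) \<theta> \<beta> / real (Suc (r n))) \<longlonglongrightarrow> R + m\<^sup>2 - 2 * \<beta> * Q"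
    by (rule squeeze[where h = "\<lambda>n. R + (s n)\<^sup>2 - 2 * \<beta> * q n" and f = "\<lambda>n. mean_field_max (Suc n) \<theta> \<beta> / real (Suc n)"])
      (use e4 in \<open>auto intro!: tendsto_intros qQ sm\<close>)
  then have val: "free_energy \<theta> \<beta> = R + m\<^sup>2 - 2 * \<beta> * Q"
    using fe[OF \<beta>] LIMSEQ_unique by blast
  have sub: "free_energy \<theta> \<beta> + (\<theta>' - \<theta>) * (m / sqrt \<beta>) + (\<beta>' - \<beta>) * Q \<le> free_energy \<theta>' \<beta>'"
    if \<beta>': "\<beta>' > 0" for \<theta>' \<beta>'
  proof (rule LIMSEQ_le)
    show "(\<lambda>n. mean_field_max (Suc (r n)) \<theta> \<beta> / real (Suc (r n)) + (\<theta>' - \<theta>) * g (r n) + (\<beta>' - \<beta>) * q (r n))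
      \<longlonglongrightarrow> free_energy \<theta> \<beta> + (\<theta>' - \<theta>) * (m / sqrt \<beta>) + (\<beta>' - \<beta>) * Q"
      by (intro tendsto_intros fe \<beta> gm qQ)
    show "(\<lambda>n. mean_field_max (Suc (r n)) \<theta>' \<beta>' / real (Suc (r n))) \<longlonglongrightarrow> free_energy \<theta>' \<beta>'"
      by (rule fe[OF \<beta>'])
    show "\<exists>N. \<forall>n\<ge>N. mean_field_max (Suc (r n)) \<theta> \<beta> / real (Suc (r n)) + (\<theta>' - \<theta>) * g (r n) + (\<beta>' - \<beta>) * q (r n)
       \<le> mean_field_max (Suc (r n)) \<theta>' \<beta>' / real (Suc (r n))"
      by (intro exI allI impI) (rule e5)
  qed
  have Qeq: "(R + m\<^sup>2 - free_energy \<theta> \<beta>) / (2 * \<beta>) = Q"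
    unfolding val using \<beta> by simp
  have "2 * m ^ 3 * moment 2 m R / sqrt \<beta> = 2 * (m ^ 3 * moment 2 m R) / sqrt \<beta>" by simp
  also have "\<dots> = 2 * \<beta> * Q" unfolding Q using \<beta> by simp
  finally have "2 * m ^ 3 * moment 2 m R / sqrt \<beta> = 2 * \<beta> * Q" .
  then have val': "free_energy \<theta> \<beta> = R + m\<^sup>2 - 2 * m ^ 3 * moment 2 m R / sqrt \<beta>"
    using val by linarith
  have "0 \<le> Q" "0 \<le> m" using mQ by auto
  then have le: "free_energy \<theta> \<beta> \<le> R + m\<^sup>2" using val \<beta> by simp
  have "stationary \<theta> \<beta> m"
    unfolding stationary_def R_def[symmetric] Qeq
    by (intro conjI allI impI sub) (fact \<open>0 \<le> m\<close> transit val' le)+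
  then show ?thesis by blast
qed

section \<open>Expressing F and its derivative through transit\<close>

lemma softplus_ln: "\<rho> > 0 \<Longrightarrow> softplus (ln \<rho>) = ln (1 + \<rho>)"
  by (simp add: softplus_def)

lemma softplus_less: "x < y \<Longrightarrow> softplus x < softplus y"
  by (simp add: softplus_def add_pos_pos)

lemma softplus_diff_pos: "\<rho> > 0 \<Longrightarrow> a > ln \<rho> \<Longrightarrow> softplus a - ln (1 + \<rho>) > 0"
  using softplus_less[of "ln \<rho>" a] by (simp add: softplus_ln)

text \<open>With \<open>y = sqrt (softplus a - softplus x)\<close> one has
  \<open>dx / y = - 2 * psi (softplus a - y\<^sup>2) dy\<close>, because
  \<open>psi (softplus x) * sig x = 1\<close>. The singularity at \<open>x = a\<close>
  disappears.\<close>

lemma F_eq_transit: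
  assumes \<rho>: "\<rho> > 0" and a: "a > ln \<rho>"
  shows "F a \<rho> = 2 * transit (sqrt (softplus a - ln (1 + \<rho>))) (ln (1 + \<rho>))"
proof -
  define R where "R = ln (1 + \<rho>)"
  define A where "A = softplus a"
  define m where "m = sqrt (A - R)"
  define k where "k y = y ^ 0 * psi (A - y\<^sup>2)" for y
  define G where "G y = integral {0..y} k" for y
  define s where "s x = sqrt (A - softplus x)" for x
  have R: "R > 0" "R = softplus (ln \<rho>)" using \<rho> softplus_pos[of "ln \<rho>"] by (auto simp: R_def softplus_ln)
  note strict = softplus_less
  have AR: "R < A" using strict[OF a] R by (simp add: A_def)
  have m: "0 < m" "m\<^sup>2 = A - R" using AR by (auto simp: m_def)
  have cont: "continuous_on {0..m} k"
  proof -
    have "0 < A - y\<^sup>2" if "y \<in> {0..m}" for y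
    proof -
      have "y\<^sup>2 \<le> m\<^sup>2" using that by (intro power_mono) auto
      then show ?thesis using m R by simp
    qed
    then show ?thesis unfolding k_def psi_def by (intro continuous_intros) force+
  qed
  have dG: "(G has_real_derivative k y) (at y within {0..m})" if "y \<in> {0..m}" for y
    unfolding G_def by (rule integral_has_real_derivative[OF cont that])
  have s_range: "s x \<in> {0..m}" if "x \<in> {ln \<rho>..a}" for x
    using that softplus_mono[of "ln \<rho>" x] softplus_mono[of x a] by (auto simp: s_def m_def R A_def)
  have cont_s: "continuous_on {ln \<rho>..a} s"
    unfolding s_def softplus_def
    by (intro continuous_intros) (auto simp: less_imp_neq[OF one_plus_exp_pos, symmetric])
  \<comment> \<open>The interior form of the fundamental theorem is needed: \<open>s\<close>
    vanishes at \<open>a\<close>, where the square root has no derivative, and only continuity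
    survives.\<close>
  have "((\<lambda>x. 1 / s x) has_integral (- 2 * G (s a)) - (- 2 * G (s (ln \<rho>)))) {ln \<rho>..a}"
  proof (rule fundamental_theorem_of_calculus_interior)
    have "continuous_on {0..m} G" using dG by (meson DERIV_continuous_on)
    then have "continuous_on {ln \<rho>..a} (\<lambda>x. G (s x))"
      by (rule continuous_on_compose2[OF _ cont_s]) (use s_range in auto)
    then show "continuous_on {ln \<rho>..a} (\<lambda>x. - 2 * G (s x))" by (intro continuous_intros)
    fix x assume x: "x \<in> {ln \<rho><..<a}"
    have sp: "softplus x < A" "R < softplus x" using x strict[of x a] strict[of "ln \<rho>" x] by (auto simp: A_def R)
    have sx: "0 < s x" "s x < m" "(s x)\<^sup>2 = A - softplus x" using sp by (auto simp: s_def m_def)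
    have dGs: "(G has_real_derivative k (s x)) (at (s x))"
      using dG[of "s x"] sx at_within_interior[of "s x" "{0..m}"] by simp
    have "(s has_real_derivative (- sig x) * (inverse (sqrt (A - softplus x)) / 2)) (at x)"
      unfolding s_def
      by (rule DERIV_chain2[OF DERIV_real_sqrt, THEN DERIV_cong])
        (use sp in \<open>auto intro!: derivative_eq_intros softplus_has_derivative\<close>)
    from DERIV_cmult[OF DERIV_chain2[OF dGs this], of "- 2"]
    have "((\<lambda>x. - 2 * G (s x)) has_real_derivative
       - 2 * (k (s x) * ((- sig x) * (inverse (sqrt (A - softplus x)) / 2)))) (at x)" .
    also have "- 2 * (k (s x) * ((- sig x) * (inverse (sqrt (A - softplus x)) / 2))) = (psi (softplus x) * sig x) / s x"
      by (simp add: k_def sx(3)) (simp add: s_def field_simps)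
    finally show "((\<lambda>x. - 2 * G (s x)) has_vector_derivative 1 / s x) (at x)"
      by (simp add: psi_softplus has_real_derivative_iff_has_vector_derivative)
  qed (use a in simp)
  moreover have "s a = 0" "s (ln \<rho>) = m" by (auto simp: s_def A_def m_def R)
  ultimately have "((\<lambda>x. 1 / s x) has_integral 2 * G m) {ln \<rho>..a}" by (simp add: G_def)
  moreover have "s x = sqrt (ln ((1 + exp a) / (1 + exp x)))" for x
    using one_plus_exp_pos[of a] one_plus_exp_pos[of x] by (simp add: s_def A_def softplus_def ln_div)
  ultimately have "F a \<rho> = 2 * G m" unfolding F_def by (intro integral_unique) simp
  also have "G m = transit m R"
    using moment_substitution[of m R 0] m R by (simp add: transit_def G_def k_def[abs_def])
  finally show ?thesis by (simp add: m_def A_def R_def)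
qed

lemma F_has_derivative:
  assumes \<rho>: "\<rho> > 0" and a: "a > ln \<rho>"
  defines "m \<equiv> sqrt (softplus a - ln (1 + \<rho>))"
  shows "((\<lambda>b. F b \<rho>) has_real_derivative transit_deriv m (ln (1 + \<rho>)) * (sig a / m)) (at a)"
proof -
  have R: "ln (1 + \<rho>) > 0" using \<rho> by simp
  have pos: "softplus a - ln (1 + \<rho>) > 0"
    using a \<rho> by (rule softplus_diff_pos[rotated])
  have "((\<lambda>b. sqrt (softplus b - ln (1 + \<rho>))) has_real_derivative sig a * (inverse m / 2)) (at a)"
    unfolding m_def
    by (rule DERIV_chain2[OF DERIV_real_sqrt, THEN DERIV_cong])
      (use pos in \<open>auto intro!: derivative_eq_intros softplus_has_derivative\<close>)
  then have "((\<lambda>b. transit (sqrt (softplus b - ln (1 + \<rho>))) (ln (1 + \<rho>))) has_real_derivative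
     transit_deriv m (ln (1 + \<rho>)) * (sig a * (inverse m / 2))) (at a)"
    unfolding m_def by (rule DERIV_chain2[OF transit_has_real_derivative[OF R]])
  then have "((\<lambda>b. 2 * transit (sqrt (softplus b - ln (1 + \<rho>))) (ln (1 + \<rho>))) has_real_derivative
     2 * (transit_deriv m (ln (1 + \<rho>)) * (sig a * (inverse m / 2)))) (at a)"
    by (rule DERIV_cmult)
  then have "((\<lambda>b. F b \<rho>) has_real_derivative
     2 * (transit_deriv m (ln (1 + \<rho>)) * (sig a * (inverse m / 2)))) (at a)"
    by (rule has_field_derivative_transform_within_open[where S = "{ln \<rho><..}"]) (use a \<rho> in \<open>auto simp: F_eq_transit\<close>)
  then show ?thesis by (simp add: field_simps)
qed

section \<open>Finiteness and positivity of rho_c\<close>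

definition unstable :: "real set" where
  "unstable = {\<rho>. \<rho> > 0 \<and> (\<exists>m>0. transit_deriv m (ln (1 + \<rho>)) < 0)}"

text \<open>The values \<open>a > ln \<rho>\<close> correspond to \<open>m > 0\<close> by
  \<open>m\<^sup>2 = softplus a - ln (1 + \<rho>)\<close>, and the chain rule factor
  \<open>sig a / m\<close> is positive, so the signs of the two derivatives agree.\<close>

lemma rho_c_eq: "rho_c = Sup unstable"
proof -
  have "(\<exists>a > ln \<rho>. \<exists>D < 0. ((\<lambda>b. F b \<rho>) has_real_derivative D) (at a)) \<longleftrightarrow>
     (\<exists>m>0. transit_deriv m (ln (1 + \<rho>)) < 0)" if \<rho>: "\<rho> > 0" for \<rho>
  proof
    assume "\<exists>a > ln \<rho>. \<exists>D < 0. ((\<lambda>b. F b \<rho>) has_real_derivative D) (at a)"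
    then obtain a D where aD: "a > ln \<rho>" "D < 0" "((\<lambda>b. F b \<rho>) has_real_derivative D) (at a)" by blast
    define m where "m = sqrt (softplus a - ln (1 + \<rho>))"
    have "softplus a - ln (1 + \<rho>) > 0"
      using \<rho> aD(1) by (rule softplus_diff_pos)
    then have m: "m > 0" by (simp add: m_def)
    have "D = transit_deriv m (ln (1 + \<rho>)) * (sig a / m)"
      using DERIV_unique[OF aD(3) F_has_derivative[OF \<rho> aD(1)]] by (simp add: m_def)
    then have "transit_deriv m (ln (1 + \<rho>)) < 0"
      using aD(2) m sig_bounds(1)[of a] by (auto simp: mult_less_0_iff divide_less_0_iff)
    then show "\<exists>m>0. transit_deriv m (ln (1 + \<rho>)) < 0" using m by blast
  next
    assume "\<exists>m>0. transit_deriv m (ln (1 + \<rho>)) < 0"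
    then obtain m where m: "m > 0" "transit_deriv m (ln (1 + \<rho>)) < 0" by blast
    \<comment> \<open>Solves \<open>softplus a = ln (1 + \<rho>) + m\<^sup>2\<close> for
      \<open>a\<close>.\<close>
    define a where "a = ln (exp (ln (1 + \<rho>) + m\<^sup>2) - 1)"
    have "1 + \<rho> < exp (ln (1 + \<rho>) + m\<^sup>2)"
      using m \<rho> by (simp add: exp_add)
    then have h: "\<rho> < exp (ln (1 + \<rho>) + m\<^sup>2) - 1" by simp
    then have ea: "exp a = exp (ln (1 + \<rho>) + m\<^sup>2) - 1" "ln \<rho> < a"
      unfolding a_def using \<rho> by (simp_all only: exp_ln ln_less_cancel_iff less_trans[OF \<rho> h])
    then have "softplus a = ln (1 + \<rho>) + m\<^sup>2" by (simp add: softplus_def)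
    then have "sqrt (softplus a - ln (1 + \<rho>)) = m" using m by simp
    then have "((\<lambda>b. F b \<rho>) has_real_derivative transit_deriv m (ln (1 + \<rho>)) * (sig a / m)) (at a)"
      using F_has_derivative[OF \<rho> ea(2)] by simp
    moreover have "transit_deriv m (ln (1 + \<rho>)) * (sig a / m) < 0"
      using m sig_bounds(1)[of a] by (intro mult_neg_pos) auto
    ultimately show "\<exists>a > ln \<rho>. \<exists>D < 0. ((\<lambda>b. F b \<rho>) has_real_derivative D) (at a)" using ea(2) by blast
  qed
  then show ?thesis unfolding rho_c_def unstable_def by (metis (no_types, lifting))
qed

text \<open>The integrand is already nonnegative pointwise once \<open>1 + 2 * V \<le> exp V\<close>
  for the potential \<open>V\<close>, since \<open>m\<^sup>2 * (1 - t\<^sup>2) \<le> V\<close>. From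
  \<open>V = 2\<close> on this follows from the quadratic Taylor bound. It makes
  \<open>rho_c\<close> finite.\<close>

lemma transit_deriv_nonneg:
  fixes m R :: real
  assumes R: "R \<ge> 2"
  shows "transit_deriv m R \<ge> 0"
proof -
  have int1: "(\<lambda>t. psi (potential m R t)) integrable_on {0..1}"
    using moment_integrable[OF regular_real, of R 0 m] R by simp
  have int2: "(\<lambda>t. psi_deriv (potential m R t) * (2 * m * (1 - t\<^sup>2))) integrable_on {0..1}"
    unfolding psi_deriv_def potential_def using regular_real[of R m] R
    by (intro integrable_continuous_interval continuous_intros) (auto simp: regular_def potential_def)
  have "transit_deriv m R = integral {0..1} (\<lambda>t. psi (potential m R t) + m * (psi_deriv (potential m R t) * (2 * m * (1 - t\<^sup>2))))"
    unfolding transit_deriv_def moment_def using int1 int2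
    by (subst Henstock_Kurzweil_Integration.integral_add) (auto intro: integrable_on_mult_right)
  also have "\<dots> \<ge> 0"
  proof (rule integral_nonneg)
    show "(\<lambda>t. psi (potential m R t) + m * (psi_deriv (potential m R t) * (2 * m * (1 - t\<^sup>2)))) integrable_on {0..1}"
      using int1 int2 by (intro integrable_add integrable_on_mult_right)
    fix t :: real assume t: "t \<in> {0..1}"
    define V where "V = potential m R t"
    have V: "V \<ge> 2" using potential_ge[OF t, of R m] R by (simp add: V_def)
    define E where "E = exp (- V)"
    have E: "0 < E" "E < 1" using V by (auto simp: E_def)
    have "1 + V + V\<^sup>2 / 2 \<le> exp V" using V by (intro exp_lower_Taylor_quadratic) auto
    moreover have "2 * V \<le> V\<^sup>2" using V by (simp add: power2_eq_square)
    ultimately have "1 + 2 * V \<le> exp V" by simp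
    then have "(1 + 2 * V) * E \<le> exp V * E" using E by (intro mult_right_mono) auto
    then have key: "2 * V * E \<le> 1 - E" by (simp add: E_def mult_exp_exp algebra_simps)
    have "2 * m\<^sup>2 * (1 - t\<^sup>2) * E \<le> 2 * V * E"
      using E R by (intro mult_right_mono) (auto simp: V_def potential_def)
    then have "2 * m\<^sup>2 * (1 - t\<^sup>2) * E / (1 - E)\<^sup>2 \<le> (1 - E) / (1 - E)\<^sup>2"
      using key by (intro divide_right_mono) auto
    also have "\<dots> = 1 / (1 - E)" using E by (simp add: power2_eq_square)
    finally show "0 \<le> psi (potential m R t) + m * (psi_deriv (potential m R t) * (2 * m * (1 - t\<^sup>2)))"
      unfolding V_def[symmetric] psi_def psi_deriv_def E_def[symmetric] by (simp add: power2_eq_square mult_ac)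
  qed
  finally show ?thesis .
qed

lemma bdd_above_unstable: "bdd_above unstable"
proof (rule bdd_aboveI)
  fix \<rho> assume "\<rho> \<in> unstable"
  then obtain m where "\<rho> > 0" "transit_deriv m (ln (1 + \<rho>)) < 0" by (auto simp: unstable_def)
  then have "ln (1 + \<rho>) < 2" using transit_deriv_nonneg[of "ln (1 + \<rho>)" m] by linarith
  then have "1 + \<rho> < exp 2" using \<open>\<rho> > 0\<close> by (metis add_pos_pos exp_less_mono exp_ln zero_less_one)
  then show "\<rho> \<le> exp 2" by simp
qed

text \<open>For small \<open>R\<close> the transit integral is of order \<open>1 / sqrt R\<close> at
  \<open>m = sqrt R\<close>, but only logarithmic in \<open>1 / R\<close> at \<open>m = 1\<close>,
  so it has to decrease in between. The value \<open>1 / 10000\<close> is small enough for crude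
  bounds: at least 50 at \<open>m = 1 / 100\<close>, at most 15 at \<open>m = 1\<close>.\<close>

lemma unstable_nonempty: "unstable \<noteq> {}"
proof -
  define R :: real where "R = 1 / 10000"
  define \<rho> where "\<rho> = exp R - 1"
  have R: "R > 0" by (simp add: R_def)
  have \<rho>: "\<rho> > 0" "ln (1 + \<rho>) = R" using R by (auto simp: \<rho>_def)
  have low: "transit (1/100) R \<ge> 50"
  proof -
    have "integral {0..1} (\<lambda>t::real. 5000) \<le> moment 0 (1/100) R"
      unfolding moment_def
    proof (rule integral_le)
      fix t :: real assume t: "t \<in> {0..1}"
      have "potential (1/100) R t \<le> 2 * R" by (simp add: potential_def R_def power2_eq_square field_simps)
      moreover have "0 < potential (1/100) R t" using potential_ge[OF t, of R "1/100"] R by linarith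
      ultimately have "1 / (2 * R) \<le> 1 / potential (1/100) R t" by (intro divide_left_mono) auto
      also have "\<dots> \<le> psi (potential (1/100) R t)"
        using \<open>0 < potential (1/100) R t\<close> by (rule psi_ge_inverse)
      finally show "5000 \<le> of_real t ^ 0 * psi (potential (1/100) R t)" by (simp add: R_def)
    qed (use moment_integrable[OF regular_real[OF R], of 0 "1/100"] in auto)
    then show ?thesis by (simp add: transit_def)
  qed
  have high: "transit 1 R \<le> 15"
  proof -
    have int: "((\<lambda>t. 1 + 1 / (R + 1 - t)) has_integral (1 - ln (R + 1 - 1)) - (0 - ln (R + 1 - 0))) {0..1}"
    proof (rule fundamental_theorem_of_calculus)
      fix t :: real assume "t \<in> {0..1}"
      then have "R + 1 - t > 0" using R by simp
      then have "((\<lambda>t. t - ln (R + 1 - t)) has_real_derivative 1 + 1 / (R + 1 - t)) (at t within {0..1})"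
        by (auto intro!: derivative_eq_intros simp: divide_simps)
      then show "((\<lambda>t. t - ln (R + 1 - t)) has_vector_derivative 1 + 1 / (R + 1 - t)) (at t within {0..1})"
        by (simp add: has_real_derivative_iff_has_vector_derivative)
    qed simp
    have "moment 0 1 R \<le> integral {0..1} (\<lambda>t. 1 + 1 / (R + 1 - t))"
      unfolding moment_def
    proof (rule integral_le)
      fix t :: real assume t: "t \<in> {0..1}"
      \<comment> \<open>Comparing \<open>1 - t\<^sup>2\<close> with \<open>1 - t\<close> leaves an
        integrand with an elementary primitive.\<close>
      have "t\<^sup>2 \<le> t" using t by (simp add: power2_eq_square mult_left_le)
      then have le: "R + 1 - t \<le> potential 1 R t" by (simp add: potential_def)
      have pos: "0 < R + 1 - t" using t R by simp
      have "psi (potential 1 R t) \<le> 1 + 1 / potential 1 R t" using le pos by (intro psi_le_inverse) auto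
      also have "1 / potential 1 R t \<le> 1 / (R + 1 - t)" using le pos by (intro divide_left_mono) auto
      finally show "of_real t ^ 0 * psi (potential 1 R t) \<le> 1 + 1 / (R + 1 - t)" by simp
    qed (use moment_integrable[OF regular_real[OF R], of 0 1] int in auto)
    also have "\<dots> = 1 + (ln (R + 1) - ln R)" using int by (simp add: integral_unique)
    also have "ln (R + 1) - ln R = ln ((R + 1) / R)" using R by (simp add: ln_div)
    also have "(R + 1) / R = 10001" by (simp add: R_def)
    also have "ln (10001::real) \<le> ln (2 ^ 14)" by (subst ln_le_cancel_iff) auto
    also have "\<dots> = 14 * ln (2::real)" by (subst ln_realpow) auto
    also have "\<dots> \<le> 14" using ln_2_less_1 by simp
    finally show ?thesis by (simp add: transit_def)
  qed
  obtain z where "1/100 < z" "z < 1" "transit 1 R - transit (1/100) R = (1 - 1/100) * transit_deriv z R"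
    using MVT2[of "1/100" 1 "\<lambda>x. transit x R" "\<lambda>x. transit_deriv x R"] transit_has_real_derivative[OF R] by auto
  then have "z > 0 \<and> transit_deriv z R < 0" using low high by auto
  then have "\<rho> \<in> unstable" using \<rho> by (auto simp: unstable_def)
  then show ?thesis by blast
qed

lemma rho_c_pos: "rho_c > 0"
proof -
  obtain \<rho> where \<rho>: "\<rho> \<in> unstable" using unstable_nonempty by blast
  then have "\<rho> \<le> rho_c" unfolding rho_c_eq by (rule cSup_upper[OF _ bdd_above_unstable])
  then show ?thesis using \<rho> by (simp add: unstable_def)
qed

definition R_c :: real where
  "R_c = ln (1 + rho_c)"

lemma R_c_pos: "R_c > 0"
  using rho_c_pos by (simp add: R_c_def)

text \<open>No parameter above the supremum \<open>rho_c\<close> is unstable, and the inequality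
  survives as the parameter decreases to \<open>rho_c\<close>.\<close>

lemma transit_deriv_critical_nonneg:
  assumes m: "m > 0"
  shows "transit_deriv m R_c \<ge> 0"
proof -
  have "continuous_on {0<..} (\<lambda>R. case (m, R) of (m, R) \<Rightarrow> transit_deriv m R)"
    by (rule continuous_on_compose2[OF continuous_on_transit_deriv])
      (auto intro!: continuous_intros regular_real)
  then have cont: "continuous_on {0<..} (\<lambda>R. transit_deriv m R)" by simp
  have lim: "(\<lambda>n. ln (1 + (rho_c + 1 / real (Suc n)))) \<longlonglongrightarrow> ln (1 + (rho_c + 0))"
    using rho_c_pos by (intro tendsto_intros LIMSEQ_Suc[OF lim_const_over_n]) auto
  have "(\<lambda>n. transit_deriv m (ln (1 + (rho_c + 1 / real (Suc n))))) \<longlonglongrightarrow> transit_deriv m R_c"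
    by (rule continuous_on_tendsto_compose[OF cont])
      (use lim rho_c_pos in \<open>auto simp: R_c_def add_pos_pos intro!: ln_gt_zero always_eventually\<close>)
  moreover have "transit_deriv m (ln (1 + (rho_c + 1 / real (Suc n)))) \<ge> 0" for n
  proof (rule ccontr)
    assume "\<not> ?thesis"
    then have "rho_c + 1 / real (Suc n) \<in> unstable"
      using m rho_c_pos by (auto simp: unstable_def intro!: add_pos_pos exI[of _ m])
    then have "rho_c + 1 / real (Suc n) \<le> rho_c"
      unfolding rho_c_eq by (rule cSup_upper[OF _ bdd_above_unstable])
    then show False by (simp add: field_simps)
  qed
  ultimately show ?thesis by (intro LIMSEQ_le_const) auto
qed

text \<open>A convex sector around the positive axis on which \<open>regular_complex\<close>
  applies; it is the domain for the identity theorem.\<close>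

definition cone :: "complex set" where
  "cone = {z. \<bar>Im z\<bar> < Re z}"

lemma cone: "open cone" "convex cone" "connected cone"
proof -
  have eq: "cone = {z. Im z < Re z} \<inter> {z. - Im z < Re z}" by (auto simp: cone_def)
  show "open cone" unfolding eq by (intro open_Int open_Collect_less continuous_intros)
  have "{z. Im z < Re z} = {z. inner (Complex (-1) 1) z < 0}" "{z. - Im z < Re z} = {z. inner (Complex (-1) (-1)) z < 0}"
    by (auto simp: inner_complex_def)
  then show "convex cone" unfolding eq by (simp add: convex_Int convex_halfspace_lt)
  then show "connected cone" by (rule convex_connected)
qed

lemma transit_cone:
  assumes R: "Re R > 0" and z: "z \<in> cone"
  shows "((\<lambda>z. transit z R) has_field_derivative transit_deriv z R) (at z)"
  by (rule transit_has_field_derivative[OF z cone(2,1)]) (use R in \<open>auto simp: cone_def intro!: regular_complex\<close>)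

text \<open>A level set of \<open>transit \<cdot> R\<close> with an accumulation point would be everything, by the identity theorem.\<close>

lemma transit_nonconstant:
  fixes R a b :: real
  assumes R: "R > 0" and ab: "0 < a" "a < b"
  shows "\<exists>x\<in>{a..b}. transit x R \<noteq> transit a R"
proof (rule ccontr)
  assume "\<not> ?thesis"
  then have const: "transit x R = transit a R" if "x \<in> {a..b}" for x using that by blast
  define f where "f z = transit z (complex_of_real R) - of_real (transit a R)" for z
  have hol: "f holomorphic_on cone"
    unfolding f_def using transit_cone[of "complex_of_real R"] R
    by (intro holomorphic_intros) (auto simp: holomorphic_on_open cone(1))
  have sub: "of_real ` {a..b} \<subseteq> cone" and a_in: "of_real a \<in> cone" using ab by (auto simp: cone_def)
  have limpt: "complex_of_real a islimpt of_real ` {a..b}"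
  proof (rule islimptI)
    fix T assume "complex_of_real a \<in> T" "open T"
    then obtain e where e: "e > 0" "ball (complex_of_real a) e \<subseteq> T" by (meson openE)
    define y where "y = min (a + e / 2) b"
    have y: "a < y" "y \<le> b" "y - a < e" using e ab by (auto simp: y_def)
    then have "complex_of_real y \<in> ball (of_real a) e"
      by (simp add: dist_of_real dist_real_def)
    moreover have "complex_of_real y \<in> of_real ` {a..b}" using y by (intro imageI) simp
    moreover have "complex_of_real y \<noteq> of_real a" using y by simp
    ultimately show "\<exists>y\<in>of_real ` {a..b}. y \<in> T \<and> y \<noteq> complex_of_real a" using e(2) by blast
  qed
  have fz: "f z = 0" if z: "z \<in> of_real ` {a..b}" for z
  proof -
    obtain x where "x \<in> {a..b}" "z = of_real x" using z by blast
    then show ?thesis using const[of x] R by (simp add: f_def transit_of_real)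
  qed
  have zero: "f z = 0" if "z \<in> cone" for z
    by (rule analytic_continuation[OF hol cone(1,3) sub a_in limpt fz that])
  \<comment> \<open>A point beyond the alleged constant value: \<open>transit x R\<close> is at
    least \<open>x\<close>, which contradicts constancy.\<close>
  define x where "x = \<bar>transit a R\<bar> + 1"
  have "complex_of_real x \<in> cone" by (simp add: cone_def x_def add_nonneg_pos)
  then have "complex_of_real (transit x R) = of_real (transit a R)"
    using zero[of "of_real x"] transit_of_real[OF R, of x] by (simp add: f_def)
  then have "transit x R = transit a R" by (simp only: of_real_eq_iff)
  moreover have "transit x R \<ge> x" using R by (intro transit_ge) (auto simp: x_def)
  ultimately show False by (simp add: x_def)
qed

lemma transit_critical_mono:
  assumes "0 \<le> a" "a \<le> b" shows "transit a R_c \<le> transit b R_c"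
proof (rule DERIV_nonneg_imp_increasing_open[OF assms(2)])
  fix x assume "a < x" "x < b"
  then show "\<exists>y. ((\<lambda>x. transit x R_c) has_real_derivative y) (at x) \<and> 0 \<le> y"
    using transit_has_real_derivative[OF R_c_pos] transit_deriv_critical_nonneg[of x] assms by auto
next
  show "continuous_on {a..b} (\<lambda>x. transit x R_c)"
    by (rule DERIV_continuous_on[OF has_field_derivative_at_within[OF transit_has_real_derivative[OF R_c_pos]]])
qed

text \<open>By monotonicity a repeated value would make the function constant on an interval, which
  \<open>transit_nonconstant\<close> excludes. So at \<open>rho_c\<close> the solution is unique for
  every \<open>\<beta>\<close>.\<close>

lemma transit_critical_inj:
  assumes "0 \<le> a" "0 \<le> b" "transit a R_c = transit b R_c"
  shows "a = b"
proof -
  have False if ab: "0 \<le> a" "a < b" "transit a R_c = transit b R_c" for a b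
  proof -
    \<comment> \<open>The midpoint, because \<open>a\<close> may be 0 and
      \<open>transit_nonconstant\<close> asks for a positive left end.\<close>
    define a' where "a' = (a + b) / 2"
    have a': "0 < a'" "a < a'" "a' < b" using ab by (auto simp: a'_def)
    have eq: "transit x R_c = transit b R_c" if "x \<in> {a'..b}" for x
      using transit_critical_mono[of a x] transit_critical_mono[of x b] that ab a' by auto
    obtain x where "x \<in> {a'..b}" "transit x R_c \<noteq> transit a' R_c"
      using transit_nonconstant[OF R_c_pos a'(1,3)] by blast
    then show False using eq[of x] eq[of a'] a' by auto
  qed
  then show ?thesis using assms by (metis linorder_neqE_linordered_idom)
qed

text \<open>A nonnegative derivative with isolated zeros is positive just to the right of any point.
  This provides nondegenerate points arbitrarily close to the critical one.\<close>

lemma transit_deriv_critical_pos_right: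
  assumes m: "m > 0"
  shows "\<exists>\<epsilon>>0. \<forall>x. m < x \<and> x < m + \<epsilon> \<longrightarrow> transit_deriv x R_c > 0"
proof (cases "transit_deriv m R_c = 0")
  case True
  define f where "f = deriv (\<lambda>z. transit z (complex_of_real R_c))"
  have f_eq: "f z = transit_deriv z (complex_of_real R_c)" if "z \<in> cone" for z
    unfolding f_def by (rule DERIV_imp_deriv[OF transit_cone]) (use that R_c_pos in auto)
  have "(\<lambda>z. transit z (complex_of_real R_c)) holomorphic_on cone"
    using transit_cone[of "complex_of_real R_c"] R_c_pos by (auto simp: holomorphic_on_open cone(1))
  then have hol: "f holomorphic_on cone" unfolding f_def by (rule holomorphic_deriv) (rule cone(1))
  have real_f: "f (of_real x) = of_real (transit_deriv x R_c)" if "x > 0" for x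
    using f_eq[of "of_real x"] that R_c_pos by (simp add: cone_def transit_deriv_of_real)
  \<comment> \<open>Isolation of zeros requires a point at which the derivative is nonzero;
    nonconstancy and the mean value theorem supply one.\<close>
  obtain x where x: "x \<in> {m..m+1}" "transit x R_c \<noteq> transit m R_c"
    using transit_nonconstant[OF R_c_pos m, of "m + 1"] by auto
  then have "m < x" by (cases "x = m") auto
  then obtain z where "m < z" "z < x" "transit x R_c - transit m R_c = (x - m) * transit_deriv z R_c"
    using MVT2[of m x "\<lambda>x. transit x R_c" "\<lambda>x. transit_deriv x R_c"] transit_has_real_derivative[OF R_c_pos] by auto
  then have z: "z > 0" "transit_deriv z R_c \<noteq> 0" using x m by auto
  obtain r where r: "0 < r" "ball (of_real m) r \<subseteq> cone" "\<And>w. w \<in> ball (of_real m) r - {of_real m} \<Longrightarrow> f w \<noteq> 0"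
    using isolated_zeros[OF hol cone(1,3), of "of_real m" "of_real z"] m z True real_f by (auto simp: cone_def)
  have "transit_deriv y R_c > 0" if "m < y" "y < m + r" for y
  proof -
    have "complex_of_real y \<in> ball (of_real m) r - {of_real m}"
      using that by (simp add: dist_of_real dist_real_def)
    then have "f (of_real y) \<noteq> 0" using r(3) by blast
    then show ?thesis using real_f[of y] transit_deriv_critical_nonneg[of y] that m by auto
  qed
  then show ?thesis using r(1) by blast
next
  case False
  then have pos: "transit_deriv m R_c > 0" using transit_deriv_critical_nonneg[OF m] by simp
  have "continuous_on UNIV (\<lambda>x. case (x, R_c) of (m, R) \<Rightarrow> transit_deriv m R)"
    by (rule continuous_on_compose2[OF continuous_on_transit_deriv])
      (auto intro!: continuous_intros regular_real R_c_pos)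
  then have "isCont (\<lambda>x. transit_deriv x R_c) m" by (simp add: continuous_on_eq_continuous_at)
  then have "((\<lambda>x. transit_deriv x R_c) \<longlongrightarrow> transit_deriv m R_c) (nhds m)"
    using tendsto_at_iff_tendsto_nhds[of "\<lambda>x. transit_deriv x R_c" m] by (simp add: isCont_def)
  then have "\<forall>\<^sub>F x in nhds m. transit_deriv x R_c > 0"
    using pos by (rule order_tendstoD(1))
  then obtain d where "d > 0" "\<And>x. dist x m < d \<Longrightarrow> transit_deriv x R_c > 0"
    by (auto simp: eventually_nhds_metric)
  then show ?thesis by (auto simp: dist_real_def intro!: exI[of _ d])
qed

section \<open>Power series in two variables\<close>

lemma Cauchy_coefficient_bound:
  assumes hol: "f holomorphic_on ball 0 r" and s: "0 < s" "s < r"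
    and bound: "\<And>z. z \<in> ball 0 r \<Longrightarrow> norm (f z) \<le> M"
  shows "norm ((deriv ^^ n) f 0 / fact n) \<le> M / s ^ n"
proof -
  have "norm ((deriv ^^ n) f 0) \<le> fact n * M / s ^ n"
  proof (rule Cauchy_inequality)
    show "f holomorphic_on ball 0 s" using s by (intro holomorphic_on_subset[OF hol]) auto
    show "continuous_on (cball 0 s) f"
      using s by (intro holomorphic_on_imp_continuous_on holomorphic_on_subset[OF hol]) auto
  qed (use s bound in auto)
  then show ?thesis by (simp add: norm_divide field_simps)
qed

text \<open>After removing the first \<open>j\<close> terms and dividing by \<open>w ^ j\<close>,
  the rest is \<open>c j\<close> plus a geometric tail. The bound depends on \<open>c\<close> only
  through \<open>M\<close> and \<open>s\<close>, so it is uniform over a family of series.\<close>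

lemma power_series_head_approx:
  fixes c :: "nat \<Rightarrow> complex"
  assumes s: "s > 0" and c: "\<And>k. norm (c k) \<le> M / s ^ k" and w: "w \<noteq> 0" "norm w \<le> s / 2"
    and sums: "(\<lambda>k. c k * w ^ k) sums S"
  shows "norm ((S - (\<Sum>i<j. c i * w ^ i)) / w ^ j - c j) \<le> 2 * M / s ^ j / s * norm w"
proof -
  have M: "M \<ge> 0" using order_trans[OF norm_ge_zero c[of 0]] by simp
  define x where "x = norm w / s"
  have x: "0 \<le> x" "x \<le> 1 / 2" using w s by (auto simp: x_def field_simps)
  have "(\<lambda>k. c (k + Suc j) * w ^ (k + Suc j)) sums (S - (\<Sum>i<Suc j. c i * w ^ i))"
    using sums by (rule sums_split_initial_segment)
  from sums_divide[OF this, of "w ^ j"]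
  have T: "(\<lambda>k. c (k + Suc j) * w ^ Suc k) sums ((S - (\<Sum>i<Suc j. c i * w ^ i)) / w ^ j)"
    using w by (simp add: power_add mult_ac)
  have eq: "(S - (\<Sum>i<Suc j. c i * w ^ i)) / w ^ j = (S - (\<Sum>i<j. c i * w ^ i)) / w ^ j - c j"
    using w by (simp add: field_simps)
  have le: "norm (c (k + Suc j) * w ^ Suc k) \<le> M / s ^ j * x * (1 / 2) ^ k" for k
  proof -
    have "norm (c (k + Suc j) * w ^ Suc k) \<le> M / s ^ (k + Suc j) * norm w ^ Suc k"
      unfolding norm_mult norm_power by (intro mult_right_mono c) auto
    also have "\<dots> = M / s ^ j * x * x ^ k"
      using s by (simp add: x_def power_add power_divide mult_ac)
    also have "\<dots> \<le> M / s ^ j * x * (1 / 2) ^ k"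
      using M s x by (intro mult_left_mono power_mono) auto
    finally show ?thesis .
  qed
  have geo: "(\<lambda>k. M / s ^ j * x * (1 / 2) ^ k) sums (M / s ^ j * x * 2)"
    using sums_mult[OF power_half_series[THEN sums_mult[of _ _ 2]], of "M / s ^ j * x"] by simp
  have "norm (suminf (\<lambda>k. c (k + Suc j) * w ^ Suc k)) \<le> suminf (\<lambda>k. M / s ^ j * x * (1 / 2) ^ k)"
    by (rule norm_suminf_le[OF le sums_summable[OF geo]])
  then have "norm ((S - (\<Sum>i<j. c i * w ^ i)) / w ^ j - c j) \<le> M / s ^ j * x * 2"
    using sums_unique[OF T] sums_unique[OF geo] eq by simp
  then show ?thesis by (simp add: x_def mult_ac)
qed

text \<open>Each coefficient of the expansion in \<open>z\<close> is holomorphic in \<open>w\<close>: by induction it is a uniform limit of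
  divided remainders. Boundedness alone suffices, no joint continuity is needed.\<close>

lemma separately_holomorphic_power_series:
  fixes g :: "complex \<Rightarrow> complex \<Rightarrow> complex"
  assumes r: "r > 0"
    and hol1: "\<And>w. w \<in> ball 0 r \<Longrightarrow> (\<lambda>z. g z w) holomorphic_on ball 0 r"
    and hol2: "\<And>z. z \<in> ball 0 r \<Longrightarrow> (\<lambda>w. g z w) holomorphic_on ball 0 r"
    and bound: "\<And>z w. z \<in> ball 0 r \<Longrightarrow> w \<in> ball 0 r \<Longrightarrow> norm (g z w) \<le> M"
  shows "\<exists>c. \<forall>z w. norm z < r / 4 \<and> norm w < r / 4 \<longrightarrow>
     ((\<lambda>(i, j). c i j * z ^ i * w ^ j) has_sum g z w) UNIV"
proof -
  \<comment> \<open>Coefficients are estimated at radius \<open>r / 2\<close> and evaluated within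
    \<open>r / 4\<close>, so all terms are dominated by
    \<open>M * (1 / 2) ^ (i + j)\<close>.\<close>
  define s where "s = r / 2"
  have s: "0 < s" "s < r" using r by (auto simp: s_def)
  define a where "a i w = (deriv ^^ i) (\<lambda>z. g z w) 0 / fact i" for i w
  have a_bound: "norm (a i w) \<le> M / s ^ i" if "w \<in> ball 0 r" for i w
    unfolding a_def by (rule Cauchy_coefficient_bound[OF hol1[OF that] s]) (use bound that in auto)
  have a_sums: "(\<lambda>i. a i w * z ^ i) sums g z w" if "w \<in> ball 0 r" "z \<in> ball 0 r" for w z
    using holomorphic_power_series[OF hol1[OF that(1)] that(2)] by (simp add: a_def)
  have a_hol: "a i holomorphic_on ball 0 r" for i
  proof (induction i rule: less_induct)
    case (less j)
    \<comment> \<open>Nonzero points tending to 0, at which the divided remainders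
      \<open>h n\<close> are formed.\<close>
    define z where "z n = complex_of_real (s / 2 / real (Suc n))" for n
    have z: "z n \<noteq> 0" "norm (z n) \<le> s / 2" "z n \<in> ball 0 r" for n
    proof -
      have "norm (z n) = s / 2 / real (Suc n)" using s by (simp only: z_def norm_of_real) simp
      also have "\<dots> \<le> s / 2 / 1" using s by (intro divide_left_mono) auto
      finally show "norm (z n) \<le> s / 2" by simp
      then show "z n \<in> ball 0 r" using s by simp
      show "z n \<noteq> 0" unfolding z_def of_real_eq_0_iff using s by simp
    qed
    have nz_lim: "(\<lambda>n. 2 * M / s ^ j / s * norm (z n)) \<longlonglongrightarrow> 0"
    proof -
      have "(\<lambda>n. 2 * M / s ^ j / s * (s / 2 / real (Suc n))) \<longlonglongrightarrow> 2 * M / s ^ j / s * 0"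
        by (intro tendsto_mult tendsto_const LIMSEQ_Suc[OF lim_const_over_n])
      moreover have "norm (z n) = s / 2 / real (Suc n)" for n using s by (simp only: z_def norm_of_real) simp
      ultimately show ?thesis by simp
    qed
    define h where "h n w = (g (z n) w - (\<Sum>i<j. a i w * z n ^ i)) / z n ^ j" for n w
    show ?case
    proof (rule holomorphic_uniform_sequence[of _ h])
      fix n show "h n holomorphic_on ball 0 r"
        unfolding h_def using z less by (intro holomorphic_intros hol2) auto
    next
      fix x :: complex assume "x \<in> ball 0 r"
      then obtain d where d: "d > 0" "cball x d \<subseteq> ball 0 r" by (meson open_ball open_contains_cball_eq)
      have "uniform_limit (ball 0 r) h (a j) sequentially"
      proof (rule uniform_limitI)
        fix e :: real assume "e > 0"
        then have "\<forall>\<^sub>F n in sequentially. 2 * M / s ^ j / s * norm (z n) < e"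
          by (rule order_tendstoD(2)[OF nz_lim])
        then show "\<forall>\<^sub>F n in sequentially. \<forall>w\<in>ball 0 r. dist (h n w) (a j w) < e"
        proof eventually_elim
          case (elim n)
          show ?case
          proof
            fix w :: complex assume w: "w \<in> ball 0 r"
            have "norm (h n w - a j w) \<le> 2 * M / s ^ j / s * norm (z n)"
              unfolding h_def
              by (rule power_series_head_approx[OF s(1) a_bound[OF w] z(1,2) a_sums[OF w z(3)]])
            then show "dist (h n w) (a j w) < e" using elim by (simp add: dist_norm)
          qed
        qed
      qed
      then show "\<exists>d>0. cball x d \<subseteq> ball 0 r \<and> uniform_limit (cball x d) h (a j) sequentially"
        using d uniform_limit_on_subset by blast
    qed simp
  qed
  define c where "c i j = (deriv ^^ j) (a i) 0 / fact j" for i j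
  have c_bound: "norm (c i j) \<le> M / s ^ i / s ^ j" for i j
    unfolding c_def by (rule Cauchy_coefficient_bound[OF a_hol s a_bound])
  have c_sums: "(\<lambda>j. c i j * w ^ j) sums a i w" if "w \<in> ball 0 r" for i w
    using holomorphic_power_series[OF a_hol that] by (simp add: c_def)
  have M: "M \<ge> 0" using norm_ge_zero order_trans bound[of 0 0] r by (metis centre_in_ball)
  have "((\<lambda>(i, j). c i j * z ^ i * w ^ j) has_sum g z w) (UNIV \<times> UNIV)"
    if zw: "norm z < r / 4" "norm w < r / 4" for z w
  proof (rule has_sum_SigmaI)
    have half: "norm z / s \<le> 1 / 2" "norm w / s \<le> 1 / 2" using zw s by (auto simp: s_def field_simps)
    have wr: "w \<in> ball 0 r" "z \<in> ball 0 r" using zw r by auto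
    have half_sum: "((\<lambda>i. (1 / 2) ^ i :: real) has_sum 2) UNIV"
      using sums_mult[OF power_half_series, of 2] by (intro norm_summable_imp_has_sum) auto
    have entry: "norm (c i j * z ^ i * w ^ j) \<le> M * (1 / 2) ^ i * (1 / 2) ^ j" for i j
    proof -
      have "norm (c i j * z ^ i * w ^ j) \<le> M / s ^ i / s ^ j * norm z ^ i * norm w ^ j"
        unfolding norm_mult norm_power by (intro mult_right_mono c_bound) auto
      also have "\<dots> = M * (norm z / s) ^ i * (norm w / s) ^ j" by (simp add: power_divide)
      also have "\<dots> \<le> M * (1 / 2) ^ i * (1 / 2) ^ j"
        using M half s by (intro mult_mono power_mono mult_left_mono) auto
      finally show ?thesis .
    qed
    have "(\<lambda>(i, j). M * (1 / 2) ^ i * (1 / 2) ^ j) summable_on UNIV \<times> (UNIV :: nat set)"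
    proof (rule summable_on_SigmaI)
      show "((\<lambda>j. case (i, j) of (i, j) \<Rightarrow> M * (1 / 2) ^ i * (1 / 2) ^ j) has_sum M * (1 / 2) ^ i * 2) UNIV" for i :: nat
        using has_sum_cmult_right[OF half_sum, of "M * (1 / 2) ^ i"] by simp
      show "(\<lambda>i. M * (1 / 2) ^ i * 2) summable_on (UNIV :: nat set)"
        using has_sum_imp_summable[OF half_sum] by (intro summable_on_cmult_left summable_on_cmult_right)
    qed (use M in auto)
    then have "(\<lambda>p. norm (case p of (i, j) \<Rightarrow> c i j * z ^ i * w ^ j)) summable_on UNIV \<times> UNIV"
      by (rule summable_on_comparison_test) (use entry in auto)
    then show "(\<lambda>(i, j). c i j * z ^ i * w ^ j) summable_on UNIV \<times> UNIV"
      by (rule abs_summable_summable)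
    have geo: "summable (\<lambda>i. C * (1 / 2) ^ i :: real)" for C by (intro summable_mult summable_geometric) simp
    show "((\<lambda>i. a i w * z ^ i) has_sum g z w) UNIV"
    proof (rule norm_summable_imp_has_sum[OF _ a_sums[OF wr]])
      have "norm (a i w * z ^ i) \<le> M * (1 / 2) ^ i" for i
      proof -
        have "norm (a i w * z ^ i) \<le> M / s ^ i * norm z ^ i"
          unfolding norm_mult norm_power by (intro mult_right_mono a_bound wr) auto
        also have "\<dots> = M * (norm z / s) ^ i" by (simp add: power_divide)
        also have "\<dots> \<le> M * (1 / 2) ^ i" using M half s by (intro mult_left_mono power_mono) auto
        finally show ?thesis .
      qed
      then show "summable (\<lambda>i. norm (a i w * z ^ i))"
        by (intro summable_comparison_test[OF _ geo]) auto
    qed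
    fix i
    have "((\<lambda>j. c i j * w ^ j) has_sum a i w) UNIV"
    proof (rule norm_summable_imp_has_sum[OF _ c_sums[OF wr(1)]])
      have "norm (c i j * w ^ j) \<le> M / s ^ i * (1 / 2) ^ j" for j
      proof -
        have "norm (c i j * w ^ j) \<le> M / s ^ i / s ^ j * norm w ^ j"
          unfolding norm_mult norm_power by (intro mult_right_mono c_bound) auto
        also have "\<dots> = M / s ^ i * (norm w / s) ^ j" by (simp add: power_divide)
        also have "\<dots> \<le> M / s ^ i * (1 / 2) ^ j" using M half s by (intro mult_left_mono power_mono) auto
        finally show ?thesis .
      qed
      then show "summable (\<lambda>j. norm (c i j * w ^ j))"
        by (intro summable_comparison_test'[OF geo[of "M / s ^ i"]]) (simp only: real_norm_def abs_norm_cancel)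
    qed
    from has_sum_cmult_left[OF this, of "z ^ i"]
    show "((\<lambda>j. case (i, j) of (i, j) \<Rightarrow> c i j * z ^ i * w ^ j) has_sum a i w * z ^ i) UNIV"
      by (simp add: mult_ac)
  qed
  then show ?thesis by auto
qed

text \<open>At real arguments the sum is real, so the real parts of the complex coefficients
  represent the same function.\<close>

lemma real_analytic_at_complex:
  fixes g :: "complex \<Rightarrow> complex \<Rightarrow> complex"
  assumes r: "r > 0"
    and "\<And>w. w \<in> ball 0 r \<Longrightarrow> (\<lambda>z. g z w) holomorphic_on ball 0 r"
    and "\<And>z. z \<in> ball 0 r \<Longrightarrow> (\<lambda>w. g z w) holomorphic_on ball 0 r"
    and "\<And>z w. z \<in> ball 0 r \<Longrightarrow> w \<in> ball 0 r \<Longrightarrow> norm (g z w) \<le> M"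
    and eq: "\<And>h k. \<bar>h\<bar> < r \<Longrightarrow> \<bar>k\<bar> < r \<Longrightarrow> of_real (f (p + (h, k))) = g (of_real h) (of_real k)"
  shows "real_analytic_at f p"
proof -
  obtain c where c: "\<And>z w. norm z < r / 4 \<Longrightarrow> norm w < r / 4 \<Longrightarrow>
     ((\<lambda>(i, j). c i j * z ^ i * w ^ j) has_sum g z w) UNIV"
    using separately_holomorphic_power_series[OF assms(1-4)] by blast
  have "((\<lambda>(i, j). Re (c i j) * h ^ i * k ^ j) has_sum f (p + (h, k))) UNIV"
    if hk: "\<bar>h\<bar> < r / 4" "\<bar>k\<bar> < r / 4" for h k
  proof -
    have "((\<lambda>(i, j). c i j * of_real h ^ i * of_real k ^ j) has_sum of_real (f (p + (h, k)))) UNIV"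
      using c[of "of_real h" "of_real k"] hk r by (simp add: eq)
    from has_sum_Re[OF this]
    have "((\<lambda>p. Re (case p of (i, j) \<Rightarrow> c i j * of_real h ^ i * of_real k ^ j)) has_sum f (p + (h, k))) UNIV"
      by simp
    moreover have "Re (c i j * of_real h ^ i * of_real k ^ j) = Re (c i j) * h ^ i * k ^ j" for i j
      by (simp flip: of_real_power)
    ultimately show ?thesis by (simp add: case_prod_unfold)
  qed
  then show ?thesis
    unfolding real_analytic_at_def using r by (intro exI[of _ "\<lambda>i j. Re (c i j)"] exI[of _ "r / 4"]) auto
qed

section \<open>Derivatives of real double power series\<close>

definition double_series :: "(nat \<Rightarrow> nat \<Rightarrow> real) \<Rightarrow> real \<Rightarrow> (real \<Rightarrow> real \<Rightarrow> real) \<Rightarrow> bool" where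
  "double_series c r \<phi> \<longleftrightarrow> r > 0 \<and> (\<forall>h k. \<bar>h\<bar> < r \<and> \<bar>k\<bar> < r \<longrightarrow>
     ((\<lambda>(i, j). c i j * h ^ i * k ^ j) has_sum \<phi> h k) UNIV)"

lemma double_series_swap: "double_series c r \<phi> \<Longrightarrow> double_series (\<lambda>i j. c j i) r (\<lambda>h k. \<phi> k h)"
  unfolding double_series_def
proof (elim conjE, intro conjI allI impI)
  fix h k :: real
  assume "\<forall>h k. \<bar>h\<bar> < r \<and> \<bar>k\<bar> < r \<longrightarrow> ((\<lambda>(i, j). c i j * h ^ i * k ^ j) has_sum \<phi> h k) UNIV" "\<bar>h\<bar> < r \<and> \<bar>k\<bar> < r"
  then have "((\<lambda>(i, j). c i j * k ^ i * h ^ j) has_sum \<phi> k h) (UNIV \<times> UNIV)" by simp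
  then show "((\<lambda>(i, j). c j i * h ^ i * k ^ j) has_sum \<phi> k h) UNIV"
    by (subst (asm) has_sum_swap) (simp add: mult_ac)
qed

lemma double_series_sums:
  assumes ds: "double_series c r \<phi>" and hk: "\<bar>h\<bar> < r" "\<bar>k\<bar> < r"
  shows "(\<lambda>i. (\<Sum>\<^sub>\<infinity>j. c i j * k ^ j) * h ^ i) sums \<phi> h k" "(\<lambda>j. c i j * k ^ j) summable_on UNIV"
proof -
  have inner: "(\<lambda>j. c i j * k ^ j) summable_on UNIV" for i
  proof -
    have r: "r > 0" using ds by (simp add: double_series_def)
    \<comment> \<open>Evaluating at the nonzero value \<open>r / 2\<close> in the first variable
      allows the power to be divided out of each row.\<close>
    then have "((\<lambda>(i, j). c i j * (r / 2) ^ i * k ^ j) has_sum \<phi> (r / 2) k) UNIV"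
      using ds hk unfolding double_series_def by simp
    then have "(\<lambda>(i, j). c i j * (r / 2) ^ i * k ^ j) summable_on (UNIV \<times> UNIV)"
      by (simp add: has_sum_imp_summable)
    then have "(\<lambda>j. c i j * (r / 2) ^ i * k ^ j) summable_on UNIV"
      by (rule summable_on_SigmaD1) simp
    then have "(\<lambda>j. (c i j * (r / 2) ^ i * k ^ j) * (1 / (r / 2) ^ i)) summable_on UNIV"
      by (rule summable_on_cmult_left)
    then show ?thesis using r by simp
  qed
  then show "(\<lambda>j. c i j * k ^ j) summable_on UNIV" .
  have "((\<lambda>(i, j). c i j * h ^ i * k ^ j) has_sum \<phi> h k) (UNIV \<times> UNIV)"
    using ds hk unfolding double_series_def by simp
  then have "((\<lambda>i. (\<Sum>\<^sub>\<infinity>j. c i j * k ^ j) * h ^ i) has_sum \<phi> h k) UNIV"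
  proof (rule has_sum_SigmaD)
    fix i
    from has_sum_cmult_left[OF has_sum_infsum[OF inner[of i]], of "h ^ i"]
    show "((\<lambda>j. case (i, j) of (i, j) \<Rightarrow> c i j * h ^ i * k ^ j) has_sum (\<Sum>\<^sub>\<infinity>j. c i j * k ^ j) * h ^ i) UNIV"
      by (simp add: mult_ac)
  qed
  then show "(\<lambda>i. (\<Sum>\<^sub>\<infinity>j. c i j * k ^ j) * h ^ i) sums \<phi> h k" by (rule has_sum_imp_sums)
qed

text \<open>Applied to a series and to its swap, the second clause identifies both mixed derivatives
  with the same coefficient, which is how their equality is obtained.\<close>

lemma double_series_derivs:
  assumes ds: "double_series c r \<phi>"
  shows "\<And>h k. \<bar>h\<bar> < r \<Longrightarrow> \<bar>k\<bar> < r \<Longrightarrow> (\<lambda>x. \<phi> x k) field_differentiable (at h)"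
    and "((\<lambda>k. deriv (\<lambda>x. \<phi> x k) 0) has_real_derivative c 1 1) (at 0)"
    and "(\<lambda>h. deriv (\<lambda>x. \<phi> x 0) h) field_differentiable (at 0)"
proof -
  have r: "r > 0" using ds by (simp add: double_series_def)
  define a where "a k i = (\<Sum>\<^sub>\<infinity>j. c i j * k ^ j)" for k i
  have summ: "summable (\<lambda>i. a k i * h ^ i)" if "\<bar>k\<bar> < r" "norm h < r" for h k :: real
    using double_series_sums(1)[OF ds _ that(1), of h] that(2) by (simp add: a_def sums_iff)
  have D: "((\<lambda>x. \<phi> x k) has_real_derivative (\<Sum>n. diffs (a k) n * h ^ n)) (at h)"
    if hk: "\<bar>h\<bar> < r" "\<bar>k\<bar> < r" for h k
  proof -
    have "((\<lambda>z. \<Sum>n. a k n * z ^ n) has_field_derivative (\<Sum>n. diffs (a k) n * h ^ n)) (at h)"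
      by (rule termdiffs_strong'[of r]) (use summ hk in auto)
    then show ?thesis
    proof (rule has_field_derivative_transform_within_open[where S = "ball 0 r"])
      fix x :: real assume "x \<in> ball 0 r"
      then show "(\<Sum>n. a k n * x ^ n) = \<phi> x k"
        using double_series_sums(1)[OF ds _ hk(2), of x] by (simp add: a_def sums_iff)
    qed (use hk in auto)
  qed
  then show "(\<lambda>x. \<phi> x k) field_differentiable (at h)" if "\<bar>h\<bar> < r" "\<bar>k\<bar> < r" for h k
    using that by (auto simp: field_differentiable_def)
  have a1: "deriv (\<lambda>x. \<phi> x k) 0 = (\<Sum>n. c 1 n * k ^ n)" if "\<bar>k\<bar> < r" for k
  proof -
    have "(\<lambda>j. c 1 j * k ^ j) summable_on UNIV" using double_series_sums(2)[OF ds _ that, of 0] r by simp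
    then have "a k 1 = (\<Sum>n. c 1 n * k ^ n)"
      unfolding a_def by (metis has_sum_imp_sums has_sum_infsum sums_unique)
    moreover have "(\<Sum>n. diffs (a k) n * 0 ^ n) = a k 1" by (simp add: diffs_def powser_zero)
    ultimately show ?thesis using DERIV_imp_deriv[OF D[of 0 k]] that r by simp
  qed
  have "((\<lambda>z. \<Sum>n. c 1 n * z ^ n) has_field_derivative (\<Sum>n. diffs (c 1) n * 0 ^ n)) (at 0)"
    by (rule termdiffs_strong'[of r]) (use summable_on_imp_summable[OF double_series_sums(2)[OF ds, of 0]] r in auto)
  then have "((\<lambda>z. \<Sum>n. c 1 n * z ^ n) has_field_derivative c 1 1) (at 0)"
    by (simp add: diffs_def powser_zero)
  then show "((\<lambda>k. deriv (\<lambda>x. \<phi> x k) 0) has_real_derivative c 1 1) (at 0)"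
    by (rule has_field_derivative_transform_within_open[where S = "ball 0 r"]) (use r a1 in auto)
  have "((\<lambda>z. \<Sum>n. diffs (a 0) n * z ^ n) has_field_derivative (\<Sum>n. diffs (diffs (a 0)) n * 0 ^ n)) (at 0)"
    by (rule termdiffs_strong'[of r]) (use termdiff_converges[OF _ summ] r in auto)
  then have "((\<lambda>h. deriv (\<lambda>x. \<phi> x 0) h) has_field_derivative (\<Sum>n. diffs (diffs (a 0)) n * 0 ^ n)) (at 0)"
    by (rule has_field_derivative_transform_within_open[where S = "ball 0 r"])
      (use r DERIV_imp_deriv[OF D] in auto)
  then show "(\<lambda>h. deriv (\<lambda>x. \<phi> x 0) h) field_differentiable (at 0)"
    by (auto simp: field_differentiable_def)
qed

section \<open>Analyticity at nondegenerate points\<close>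

text \<open>Otherwise there are solutions at parameters tending to the base point that stay away
  from \<open>m0\<close>. They are bounded by \<open>transit_ge\<close>, and by continuity an
  accumulation point would be a second solution.\<close>

lemma transit_solution_close:
  assumes \<rho>0: "\<rho>0 > 0" and \<beta>0: "\<beta>0 > 0"
    and unique: "\<And>m. m \<ge> 0 \<Longrightarrow> transit m (ln (1 + \<rho>0)) = sqrt \<beta>0 \<Longrightarrow> m = m0" and \<epsilon>: "\<epsilon> > 0"
  shows "\<exists>\<delta>>0. \<forall>\<rho> \<beta> m. \<bar>\<rho> - \<rho>0\<bar> < \<delta> \<and> \<bar>\<beta> - \<beta>0\<bar> < \<delta> \<and> m \<ge> 0 \<and> transit m (ln (1 + \<rho>)) = sqrt \<beta>
     \<longrightarrow> \<bar>m - m0\<bar> < \<epsilon>"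
proof (rule ccontr)
  assume neg: "\<not> ?thesis"
  \<comment> \<open>The minimum keeps the perturbed first parameter positive and the second one
    below \<open>\<beta>0 + 1\<close>.\<close>
  define \<delta> where "\<delta> n = min (\<rho>0 / 2) 1 / real (Suc n)" for n
  have \<delta>: "\<delta> n > 0" for n using \<rho>0 by (simp add: \<delta>_def)
  have \<delta>le: "\<delta> n \<le> \<rho>0 / 2" "\<delta> n \<le> 1" for n
  proof -
    have "\<delta> n \<le> min (\<rho>0 / 2) 1 / 1" unfolding \<delta>_def using \<rho>0 by (intro divide_left_mono) auto
    then show "\<delta> n \<le> \<rho>0 / 2" "\<delta> n \<le> 1" by auto
  qed
  have "\<forall>n. \<exists>p. \<bar>fst p - \<rho>0\<bar> < \<delta> n \<and> \<bar>fst (snd p) - \<beta>0\<bar> < \<delta> n \<and> snd (snd p) \<ge> 0 \<and>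
      transit (snd (snd p)) (ln (1 + fst p)) = sqrt (fst (snd p)) \<and> \<not> \<bar>snd (snd p) - m0\<bar> < \<epsilon>"
  proof
    fix n
    obtain \<rho> \<beta> m where "\<bar>\<rho> - \<rho>0\<bar> < \<delta> n \<and> \<bar>\<beta> - \<beta>0\<bar> < \<delta> n \<and> m \<ge> 0 \<and> transit m (ln (1 + \<rho>)) = sqrt \<beta> \<and> \<not> \<bar>m - m0\<bar> < \<epsilon>"
      using neg \<delta>[of n] by meson
    then show "\<exists>p. \<bar>fst p - \<rho>0\<bar> < \<delta> n \<and> \<bar>fst (snd p) - \<beta>0\<bar> < \<delta> n \<and> snd (snd p) \<ge> 0 \<and>
      transit (snd (snd p)) (ln (1 + fst p)) = sqrt (fst (snd p)) \<and> \<not> \<bar>snd (snd p) - m0\<bar> < \<epsilon>"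
      by (intro exI[of _ "(\<rho>, \<beta>, m)"]) simp
  qed
  from choice[OF this] obtain P where P: "\<forall>n. \<bar>fst (P n) - \<rho>0\<bar> < \<delta> n \<and> \<bar>fst (snd (P n)) - \<beta>0\<bar> < \<delta> n \<and> snd (snd (P n)) \<ge> 0 \<and>
      transit (snd (snd (P n))) (ln (1 + fst (P n))) = sqrt (fst (snd (P n))) \<and> \<not> \<bar>snd (snd (P n)) - m0\<bar> < \<epsilon>" ..
  define \<rho> \<beta> m where "\<rho> n = fst (P n)" and "\<beta> n = fst (snd (P n))" and "m n = snd (snd (P n))" for n
  have \<rho>: "\<bar>\<rho> n - \<rho>0\<bar> < \<delta> n" and \<beta>: "\<bar>\<beta> n - \<beta>0\<bar> < \<delta> n" and m: "m n \<ge> 0"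
    and sol: "transit (m n) (ln (1 + \<rho> n)) = sqrt (\<beta> n)" and far: "\<not> \<bar>m n - m0\<bar> < \<epsilon>" for n
    using P by (auto simp: \<rho>_def \<beta>_def m_def)
  have \<delta>_lim: "\<delta> \<longlonglongrightarrow> 0"
    unfolding \<delta>_def by (rule LIMSEQ_Suc[OF lim_const_over_n])
  have "(\<lambda>n. \<rho> n - \<rho>0) \<longlonglongrightarrow> 0" "(\<lambda>n. \<beta> n - \<beta>0) \<longlonglongrightarrow> 0"
    using \<rho> \<beta> by (auto intro!: Lim_null_comparison[OF _ \<delta>_lim] simp: less_imp_le)
  then have \<rho>_lim: "\<rho> \<longlonglongrightarrow> \<rho>0" and \<beta>_lim: "\<beta> \<longlonglongrightarrow> \<beta>0" by (auto simp: LIM_zero_iff)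
  have \<rho>_pos: "\<rho> n > 0" for n using \<rho>[of n] \<delta>le[of n] \<rho>0 by linarith
  have ln_pos: "0 < ln (1 + \<rho> n)" for n using \<rho>_pos[of n] by (intro ln_gt_zero) simp
  have "m n \<le> sqrt (\<beta>0 + 1)" for n
  proof -
    have "m n \<le> transit (m n) (ln (1 + \<rho> n))" using \<rho>_pos[of n] m by (intro transit_ge) auto
    also have "\<dots> \<le> sqrt (\<beta>0 + 1)" unfolding sol using \<beta>[of n] \<delta>le[of n] by simp
    finally show ?thesis .
  qed
  then have "\<forall>n. m n \<in> {0..sqrt (\<beta>0 + 1)}" using m by simp
  then obtain l r where l: "l \<in> {0..sqrt (\<beta>0 + 1)}" and r: "strict_mono r" and lim: "(m \<circ> r) \<longlonglongrightarrow> l"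
    using compact_Icc[of 0 "sqrt (\<beta>0 + 1)"] unfolding compact_def by blast
  have "(\<lambda>n. case (m (r n), ln (1 + \<rho> (r n))) of (m, R) \<Rightarrow> transit m R)
     \<longlonglongrightarrow> (case (l, ln (1 + \<rho>0)) of (m, R) \<Rightarrow> transit m R)"
  proof (rule continuous_on_tendsto_compose[OF continuous_on_transit])
    have "(\<lambda>n. ln (1 + \<rho> (r n))) \<longlonglongrightarrow> ln (1 + \<rho>0)"
      using LIMSEQ_subseq_LIMSEQ[OF \<rho>_lim r] \<rho>0 by (auto intro!: tendsto_intros simp: o_def)
    then show "(\<lambda>n. (m (r n), ln (1 + \<rho> (r n)))) \<longlonglongrightarrow> (l, ln (1 + \<rho>0))"
      using lim by (auto intro!: tendsto_Pair simp: o_def)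
  qed (use ln_pos \<rho>0 in \<open>auto intro!: regular_real always_eventually\<close>)
  then have "(\<lambda>n. sqrt (\<beta> (r n))) \<longlonglongrightarrow> transit l (ln (1 + \<rho>0))" by (simp add: sol)
  moreover have "(\<lambda>n. sqrt (\<beta> (r n))) \<longlonglongrightarrow> sqrt \<beta>0"
    using LIMSEQ_subseq_LIMSEQ[OF \<beta>_lim r] by (auto intro!: tendsto_intros simp: o_def)
  ultimately have "transit l (ln (1 + \<rho>0)) = sqrt \<beta>0" by (rule LIMSEQ_unique)
  then have "l = m0" using unique l by simp
  then have "\<forall>\<^sub>F n in sequentially. dist ((m \<circ> r) n) m0 < \<epsilon>" using lim \<epsilon> by (auto dest: tendstoD)
  then show False using far by (auto simp: dist_real_def eventually_sequentially)
qed

lemma regular_near: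
  fixes m R :: complex
  assumes "m0 > 0" "R0 > 0"
    and m: "norm (m - of_real m0) < m0 / 2" and R: "norm (R - of_real R0) < R0 / 2"
  shows "(m, R) \<in> regular"
proof (rule regular_complex)
  have "\<bar>Re (m - of_real m0)\<bar> < m0 / 2" "\<bar>Im (m - of_real m0)\<bar> < m0 / 2"
    using m abs_Re_le_cmod[of "m - of_real m0"] abs_Im_le_cmod[of "m - of_real m0"] by linarith+
  moreover have "Re (m - of_real m0) = Re m - m0" "Im (m - of_real m0) = Im m" by auto
  ultimately show "\<bar>Im m\<bar> \<le> Re m" by linarith
  have "\<bar>Re (R - of_real R0)\<bar> < R0 / 2"
    using R abs_Re_le_cmod[of "R - of_real R0"] by linarith
  moreover have "Re (R - of_real R0) = Re R - R0" by simp
  ultimately show "Re R > 0" by linarith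
qed

text \<open>Newton's method with the slope frozen at the base point. Its fixed points for
  \<open>c \<noteq> 0\<close> are the solutions of \<open>transit m R = w\<close>, and every iterate
  is holomorphic in the parameters.\<close>

definition newton :: "real \<Rightarrow> complex \<Rightarrow> complex \<Rightarrow> complex \<Rightarrow> complex" where
  "newton c R w m = m - (transit m R - w) / of_real c"

context
  fixes \<rho>0 \<beta>0 m0 c :: real
  assumes \<rho>0: "\<rho>0 > 0" and \<beta>0: "\<beta>0 > 0" and m0: "m0 > 0"
    and sol: "transit m0 (ln (1 + \<rho>0)) = sqrt \<beta>0"
    and c_def: "c = transit_deriv m0 (ln (1 + \<rho>0))" and c: "c \<noteq> 0"
begin

text \<open>The derivative of the map is \<open>1 - transit_deriv x R / c\<close>, of norm at most
  \<open>1 / 2\<close> while \<open>transit_deriv\<close> stays within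
  \<open>\<bar>c\<bar> / 2\<close> of its base value.\<close>

lemma newton_contraction:
  "\<exists>r d. 0 < r \<and> r < m0 / 2 \<and> 0 < d \<and> d < ln (1 + \<rho>0) / 2 \<and>
    (\<forall>R w. norm (R - of_real (ln (1 + \<rho>0))) < d \<and> norm (w - of_real (sqrt \<beta>0)) < d \<longrightarrow>
      newton c R w ` cball (of_real m0) r \<subseteq> cball (of_real m0) r \<and>
      (\<forall>x\<in>cball (of_real m0) r. \<forall>y\<in>cball (of_real m0) r. dist (newton c R w x) (newton c R w y) \<le> 1 / 2 * dist x y))"
proof -
  define R0 where "R0 = ln (1 + \<rho>0)"
  have R0: "R0 > 0" using \<rho>0 by (simp add: R0_def)
  define B where "B = ball (complex_of_real m0) (m0 / 2) \<times> ball (complex_of_real R0) (R0 / 2)"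
  note reg = regular_near[OF m0 R0]
  have Breg: "B \<subseteq> regular" using reg by (auto simp: B_def dist_norm norm_minus_commute)
  have oB: "open B" and B0: "(of_real m0, of_real R0) \<in> B"
    using m0 R0 by (auto simp: B_def intro!: open_Times)
  have "continuous_on B (\<lambda>(m, R). transit_deriv m R)" "continuous_on B (\<lambda>(m, R). transit m R)"
    using continuous_on_subset[OF continuous_on_transit_deriv Breg] continuous_on_subset[OF continuous_on_transit Breg] .
  then have "isCont (\<lambda>(m, R). transit_deriv m R) (complex_of_real m0, complex_of_real R0)"
     and "isCont (\<lambda>(m, R). transit m R) (complex_of_real m0, complex_of_real R0)"
    using oB B0 by (simp_all add: continuous_on_eq_continuous_at)
  then obtain e where e: "e > 0" "\<And>p. dist p (of_real m0, of_real R0) < e \<Longrightarrow>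
      dist (case p of (m, R) \<Rightarrow> transit_deriv m R) (transit_deriv (of_real m0) (complex_of_real R0)) < \<bar>c\<bar> / 2"
    unfolding continuous_at_eps_delta using c by (metis (mono_tags, lifting) case_prod_conv half_gt_zero zero_less_abs_iff)
  have c_eq: "transit_deriv (of_real m0) (complex_of_real R0) = of_real c"
    using transit_deriv_of_real[OF R0] by (simp add: c_def R0_def)
  define r where "r = min (m0 / 4) (e / 4)"
  have r: "r > 0" "r < m0 / 2" "r \<le> e / 4" using m0 e by (auto simp: r_def)
  have "isCont (\<lambda>(m, R). transit m R) (complex_of_real m0, complex_of_real R0)" by fact
  then obtain e' where e': "e' > 0" "\<And>p. dist p (of_real m0, of_real R0) < e' \<Longrightarrow>
      dist (case p of (m, R) \<Rightarrow> transit m R) (transit (of_real m0) (complex_of_real R0)) < \<bar>c\<bar> * r / 8"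
    unfolding continuous_at_eps_delta using c r
    by (metis (mono_tags, lifting) case_prod_conv divide_pos_pos mult_pos_pos zero_less_abs_iff zero_less_numeral)
  \<comment> \<open>The two bounds \<open>\<bar>c\<bar> * r / 8\<close>, on the change of
    \<open>transit\<close> and on that of \<open>w\<close>, move the centre by at most
    \<open>r / 4\<close>; with the contracted radius \<open>r / 2\<close> the image stays in the
    ball.\<close>
  define d where "d = Min {R0 / 4, e / 4, e', \<bar>c\<bar> * r / 8}"
  have d: "0 < d" "d < R0 / 2" "d \<le> e / 4" "d \<le> e'" "d \<le> \<bar>c\<bar> * r / 8"
    using R0 e e' c r by (auto simp: d_def)
  have main: "newton c R w ` cball (of_real m0) r \<subseteq> cball (of_real m0) r \<and>
      (\<forall>x\<in>cball (of_real m0) r. \<forall>y\<in>cball (of_real m0) r. dist (newton c R w x) (newton c R w y) \<le> 1 / 2 * dist x y)"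
    if Rw: "norm (R - of_real R0) < d" "norm (w - of_real (sqrt \<beta>0)) < d" for R w
  proof -
    have dn: "norm (1 - transit_deriv x R / of_real c) \<le> 1 / 2" if x: "x \<in> cball (of_real m0) r" for x
    proof -
      have "dist (x, R) (of_real m0, of_real R0) \<le> dist x (of_real m0) + dist R (of_real R0)"
        using dist_triangle[of "(x, R)" "(of_real m0, of_real R0)" "(of_real m0, R)"] by (simp add: dist_Pair_Pair)
      also have "\<dots> < e" using x Rw r d e by (simp add: dist_norm norm_minus_commute)
      finally have "norm (transit_deriv x R - of_real c) < \<bar>c\<bar> / 2"
        using e(2)[of "(x, R)"] by (simp add: c_eq dist_norm)
      moreover have "1 - transit_deriv x R / of_real c = - (transit_deriv x R - of_real c) / of_real c"
        using c by (simp add: field_simps)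
      ultimately show ?thesis using c by (simp add: norm_divide norm_minus_commute field_simps)
    qed
    have deriv: "(newton c R w has_field_derivative (1 - transit_deriv x R / of_real c)) (at x within cball (of_real m0) r)"
      if x: "x \<in> cball (of_real m0) r" for x
    proof -
      have "((\<lambda>x. transit x R) has_field_derivative transit_deriv x R) (at x)"
        by (rule transit_has_field_derivative[where U = "ball (of_real m0) (m0 / 2)"])
          (use x r Rw d reg in \<open>auto simp: dist_norm norm_minus_commute\<close>)
      then have "(newton c R w has_field_derivative (1 - transit_deriv x R / of_real c)) (at x)"
        unfolding newton_def[abs_def] using c by (auto intro!: derivative_eq_intros)
      then show ?thesis by (rule has_field_derivative_at_within)
    qed
    have lip: "dist (newton c R w x) (newton c R w y) \<le> 1 / 2 * dist x y"
      if "x \<in> cball (of_real m0) r" "y \<in> cball (of_real m0) r" for x y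
      using field_differentiable_bound[OF convex_cball deriv dn that] by (simp add: dist_norm)
    have "newton c R w x \<in> cball (of_real m0) r" if x: "x \<in> cball (of_real m0) r" for x
    proof -
      have m0in: "of_real m0 \<in> cball (complex_of_real m0) r" using r by simp
      have "dist (newton c R w x) (newton c R w (of_real m0)) \<le> 1 / 2 * r"
        using lip[OF x m0in] x by (simp add: dist_commute)
      moreover have "dist (newton c R w (of_real m0)) (of_real m0) \<le> r / 4"
      proof -
        have "dist (complex_of_real m0, R) (of_real m0, of_real R0) < e'"
          using Rw d by (simp add: dist_Pair_Pair dist_norm)
        then have "norm (transit (of_real m0) R - transit (of_real m0) (of_real R0)) < \<bar>c\<bar> * r / 8"
          using e'(2)[of "(of_real m0, R)"] by (simp add: dist_norm)
        moreover have "transit (of_real m0) (of_real R0) = complex_of_real (sqrt \<beta>0)"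
          using transit_of_real[OF R0, of m0] sol by (simp add: R0_def)
        moreover have "norm (transit (of_real m0) R - w) \<le>
            norm (transit (of_real m0) R - complex_of_real (sqrt \<beta>0)) + norm (w - complex_of_real (sqrt \<beta>0))"
          using norm_triangle_ineq4[of "transit (of_real m0) R - complex_of_real (sqrt \<beta>0)" "w - complex_of_real (sqrt \<beta>0)"] by simp
        ultimately have "norm (transit (of_real m0) R - w) \<le> \<bar>c\<bar> * r / 4" using Rw d by simp
        then have "norm (transit (of_real m0) R - w) / \<bar>c\<bar> \<le> r / 4" using c by (simp add: field_simps)
        then show ?thesis by (simp add: newton_def dist_norm norm_divide)
      qed
      ultimately show ?thesis
        using dist_triangle[of "newton c R w x" "of_real m0" "newton c R w (of_real m0)"] r by (simp add: dist_commute)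
    qed
    then show ?thesis using lip by blast
  qed
  then show ?thesis unfolding R0_def[symmetric] using r d by blast
qed


text \<open>The iterates converge geometrically, uniformly in both parameters, so the fixed point is
  holomorphic in each of them. At real parameters \<open>transit_solution_close\<close> puts the
  maximiser into the same ball, where the fixed point is unique, so the two coincide.\<close>

lemma free_energy_holomorphic_extension:
  assumes unique: "\<And>m. m \<ge> 0 \<Longrightarrow> transit m (ln (1 + \<rho>0)) = sqrt \<beta>0 \<Longrightarrow> m = m0"
  shows "\<exists>s>0. \<exists>G M. s < \<rho>0 \<and> s < \<beta>0 \<and>
     (\<forall>\<zeta>\<in>ball 0 s. (\<lambda>z. G z \<zeta>) holomorphic_on ball 0 s) \<and>
     (\<forall>z\<in>ball 0 s. (\<lambda>\<zeta>. G z \<zeta>) holomorphic_on ball 0 s) \<and>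
     (\<forall>z\<in>ball 0 s. \<forall>\<zeta>\<in>ball 0 s. norm (G z \<zeta>) \<le> M) \<and>
     (\<forall>h k. \<bar>h\<bar> < s \<and> \<bar>k\<bar> < s \<longrightarrow> complex_of_real (free_energy (ln (\<rho>0 + h)) (\<beta>0 + k)) = G (of_real h) (of_real k))"
proof -
  define R0 where "R0 = ln (1 + \<rho>0)"
  have R0: "R0 > 0" using \<rho>0 by (simp add: R0_def)
  from newton_contraction[folded R0_def] obtain r d
    where rd: "0 < r \<and> r < m0 / 2 \<and> 0 < d \<and> d < R0 / 2"
    and nt': "\<forall>R w. norm (R - of_real R0) < d \<and> norm (w - of_real (sqrt \<beta>0)) < d \<longrightarrow>
      newton c R w ` cball (of_real m0) r \<subseteq> cball (of_real m0) r \<and>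
      (\<forall>x\<in>cball (of_real m0) r. \<forall>y\<in>cball (of_real m0) r. dist (newton c R w x) (newton c R w y) \<le> 1 / 2 * dist x y)"
    by (elim exE conjE) (rule that, (intro conjI; assumption), assumption)
  from rd have r: "0 < r" "r < m0 / 2" and d: "0 < d" "d < R0 / 2" by auto
  have nt: "newton c R w ` cball (of_real m0) r \<subseteq> cball (of_real m0) r"
    "\<And>x y. x \<in> cball (of_real m0) r \<Longrightarrow> y \<in> cball (of_real m0) r \<Longrightarrow>
      dist (newton c R w x) (newton c R w y) \<le> 1 / 2 * dist x y"
    if "norm (R - of_real R0) < d" "norm (w - of_real (sqrt \<beta>0)) < d" for R w
    using nt'[rule_format, OF conjI, OF that] by blast+
  define R where "R z = Ln (1 + of_real \<rho>0 + z)" for z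
  define w where "w \<zeta> = csqrt (of_real \<beta>0 + \<zeta>)" for \<zeta>
  have R_real: "R (of_real h) = of_real (ln (1 + (\<rho>0 + h)))" if "1 + \<rho>0 + h > 0" for h
    using that Ln_of_real[of "1 + (\<rho>0 + h)"] by (simp add: R_def add.assoc)
  have w_real: "w (of_real k) = of_real (sqrt (\<beta>0 + k))" if "\<beta>0 + k \<ge> 0" for k
    using that csqrt_of_real[of "\<beta>0 + k"] by (simp add: w_def)
  have R_0: "R 0 = of_real R0" and w_0: "w 0 = of_real (sqrt \<beta>0)"
    using R_real[of 0] w_real[of 0] \<rho>0 \<beta>0 by (auto simp: R0_def)
  have np: "of_real a + z \<notin> \<real>\<^sub>\<le>\<^sub>0" if "norm z < a" for z :: complex and a :: real
    using that abs_Re_le_cmod[of z] by (auto simp: complex_nonpos_Reals_iff)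
  have R_hol: "R holomorphic_on ball 0 \<rho>0"
    unfolding R_def using np[of _ "1 + \<rho>0"] by (intro holomorphic_intros) (auto simp: add.assoc)
  have w_hol: "w holomorphic_on ball 0 \<beta>0"
    unfolding w_def using np[of _ \<beta>0] by (intro holomorphic_intros) auto
  \<comment> \<open>The smaller radius also keeps \<open>w\<close> away from 0, since
    \<open>G\<close> divides by it.\<close>
  define d' where "d' = min d (sqrt \<beta>0 / 2)"
  have d': "0 < d'" "d' \<le> d" "d' \<le> sqrt \<beta>0 / 2" using d \<beta>0 by (auto simp: d'_def)
  have "isCont R 0" "isCont w 0"
    using holomorphic_on_imp_continuous_on[OF R_hol] holomorphic_on_imp_continuous_on[OF w_hol] \<rho>0 \<beta>0
    by (auto simp: continuous_on_eq_continuous_at)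
  then obtain s1 s2 where s12: "s1 > 0" "\<And>z. norm z < s1 \<Longrightarrow> norm (R z - of_real R0) < d"
     "s2 > 0" "\<And>z. norm z < s2 \<Longrightarrow> norm (w z - of_real (sqrt \<beta>0)) < d'"
    using d d' unfolding continuous_at_eps_delta R_0 w_0 dist_norm by (metis diff_zero)
  obtain \<delta> where \<delta>: "\<delta> > 0" "\<And>\<rho> \<beta> m. \<bar>\<rho> - \<rho>0\<bar> < \<delta> \<Longrightarrow> \<bar>\<beta> - \<beta>0\<bar> < \<delta> \<Longrightarrow> m \<ge> 0 \<Longrightarrow>
      transit m (ln (1 + \<rho>)) = sqrt \<beta> \<Longrightarrow> \<bar>m - m0\<bar> < r"
    using transit_solution_close[OF \<rho>0 \<beta>0 unique r(1)] by blast
  define s where "s = Min {s1, s2, \<delta>, \<rho>0 / 2, \<beta>0 / 2}"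
  have s: "s > 0" "s \<le> s1" "s \<le> s2" "s \<le> \<delta>" "s < \<rho>0" "s < \<beta>0"
    using s12 \<delta> \<rho>0 \<beta>0 by (auto simp: s_def min_less_iff_disj)
  have R_holo: "R holomorphic_on ball 0 s" and w_holo: "w holomorphic_on ball 0 s"
    using s by (auto intro!: holomorphic_on_subset[OF R_hol] holomorphic_on_subset[OF w_hol])
  have R_near: "norm (R z - of_real R0) < d" if "z \<in> ball 0 s" for z using that s by (intro s12) auto
  have w_near': "norm (w z - of_real (sqrt \<beta>0)) < d'" if "z \<in> ball 0 s" for z using that s by (intro s12) auto
  then have w_near: "norm (w z - of_real (sqrt \<beta>0)) < d" if "z \<in> ball 0 s" for z using that d' by fastforce
  define D where "D = cball (complex_of_real m0) r"
  have w_low: "norm (w z) \<ge> sqrt \<beta>0 / 2" if "z \<in> ball 0 s" for z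
  proof -
    have "norm (complex_of_real (sqrt \<beta>0)) \<le> norm (w z) + norm (w z - of_real (sqrt \<beta>0))"
      using norm_triangle_ineq4[of "w z" "w z - of_real (sqrt \<beta>0)"] by simp
    then show ?thesis using w_near'[OF that] d' \<beta>0 by simp
  qed
  have w_nz: "w z \<noteq> 0" if "z \<in> ball 0 s" for z using w_low[OF that] \<beta>0 by auto
  have reg: "(m, R z) \<in> regular" if "m \<in> D" "z \<in> ball 0 s" for m z
    using that R_near[OF that(2)] r d
    by (intro regular_near[OF m0 R0]) (auto simp: D_def dist_norm norm_minus_commute)
  define it where "it k z \<zeta> = (newton c (R z) (w \<zeta>) ^^ k) (of_real m0)" for k z \<zeta>
  have it_Suc: "it (Suc k) z \<zeta> = it k z \<zeta> - (it k z \<zeta> * moment 0 (it k z \<zeta>) (R z) - w \<zeta>) / of_real c" for k z \<zeta>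
    by (simp add: it_def newton_def transit_def)
  have it_D: "it k z \<zeta> \<in> D" if "z \<in> ball 0 s" "\<zeta> \<in> ball 0 s" for k z \<zeta>
  proof (induction k)
    case (Suc k)
    show ?case
      using subsetD[OF nt(1)[OF R_near[OF that(1)] w_near[OF that(2)]] imageI[OF Suc[unfolded D_def]]]
      by (simp add: it_def D_def)
  qed (use r in \<open>simp add: it_def D_def\<close>)
  have it_hol1: "(\<lambda>z. it k z \<zeta>) holomorphic_on ball 0 s" if "\<zeta> \<in> ball 0 s" for k \<zeta>
  proof (induction k)
    case (Suc k)
    then show ?case unfolding it_Suc using c that
      by (intro holomorphic_intros moment_holomorphic_on R_holo) (auto intro!: reg it_D)
  qed (simp add: it_def)
  have it_hol2: "(\<lambda>\<zeta>. it k z \<zeta>) holomorphic_on ball 0 s" if "z \<in> ball 0 s" for k z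
  proof (induction k)
    case (Suc k)
    then show ?case unfolding it_Suc using c that
      by (intro holomorphic_intros moment_holomorphic_on w_holo) (auto intro!: reg it_D)
  qed (simp add: it_def)
  have ex1: "\<exists>!x\<in>D. newton c (R z) (w \<zeta>) x = x" if "z \<in> ball 0 s" "\<zeta> \<in> ball 0 s" for z \<zeta>
  proof (rule Banach_fix[where c = "1 / 2", OF compact_imp_complete])
    show "compact D" "D \<noteq> {}" using r by (auto simp: D_def)
    show "newton c (R z) (w \<zeta>) ` D \<subseteq> D"
      unfolding D_def by (rule nt(1)[OF R_near[OF that(1)] w_near[OF that(2)]])
    show "dist (newton c (R z) (w \<zeta>) x) (newton c (R z) (w \<zeta>) y) \<le> 1 / 2 * dist x y" if "x \<in> D" "y \<in> D" for x y
      using nt(2)[OF R_near[OF \<open>z \<in> ball 0 s\<close>] w_near[OF \<open>\<zeta> \<in> ball 0 s\<close>]] that unfolding D_def .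
  qed auto
  define lim where "lim z \<zeta> = (THE x. x \<in> D \<and> newton c (R z) (w \<zeta>) x = x)" for z \<zeta>
  have lim: "lim z \<zeta> \<in> D \<and> newton c (R z) (w \<zeta>) (lim z \<zeta>) = lim z \<zeta>"
    if "z \<in> ball 0 s" "\<zeta> \<in> ball 0 s" for z \<zeta>
    unfolding lim_def by (rule theI') (use ex1[OF that] in blast)
  have lim_eq: "lim z \<zeta> = x" if "z \<in> ball 0 s" "\<zeta> \<in> ball 0 s" "x \<in> D" "newton c (R z) (w \<zeta>) x = x" for z \<zeta> x
    using ex1[OF that(1,2)] lim[OF that(1,2)] that(3,4) by blast
  have rate: "dist (it k z \<zeta>) (lim z \<zeta>) \<le> r * (1 / 2) ^ k" if "z \<in> ball 0 s" "\<zeta> \<in> ball 0 s" for k z \<zeta>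
  proof (induction k)
    case 0
    then show ?case using lim[OF that] by (simp add: it_def D_def)
  next
    case (Suc k)
    have "dist (it (Suc k) z \<zeta>) (lim z \<zeta>) = dist (newton c (R z) (w \<zeta>) (it k z \<zeta>)) (newton c (R z) (w \<zeta>) (lim z \<zeta>))"
      using lim[OF that] by (simp add: it_def)
    also have "\<dots> \<le> 1 / 2 * dist (it k z \<zeta>) (lim z \<zeta>)"
      using it_D[OF that, of k] lim[OF that] unfolding D_def
      by (intro nt(2)[OF R_near[OF that(1)] w_near[OF that(2)]]) auto
    finally show ?case using Suc by simp
  qed
  have rate_lim: "(\<lambda>k. r * (1 / 2) ^ k) \<longlonglongrightarrow> 0"
    using tendsto_mult_right_zero[OF LIMSEQ_power_zero[of "1 / 2 :: real"], of r] by simp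
  have unif: "uniform_limit S (\<lambda>k x. it k (p x) (q x)) (\<lambda>x. lim (p x) (q x)) sequentially"
    if "\<And>x. x \<in> S \<Longrightarrow> p x \<in> ball 0 s" "\<And>x. x \<in> S \<Longrightarrow> q x \<in> ball 0 s" for S p q
  proof (rule uniform_limitI)
    fix e :: real assume "e > 0"
    then have "\<forall>\<^sub>F k in sequentially. r * (1 / 2) ^ k < e" by (rule order_tendstoD(2)[OF rate_lim])
    then show "\<forall>\<^sub>F k in sequentially. \<forall>x\<in>S. dist (it k (p x) (q x)) (lim (p x) (q x)) < e"
      by eventually_elim (use rate that in \<open>blast intro: le_less_trans\<close>)
  qed
  have cb: "\<exists>e>0. cball x e \<subseteq> ball 0 s" if "x \<in> ball 0 s" for x :: complex
    using that by (meson open_ball open_contains_cball_eq)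
  have lim_hol1: "(\<lambda>z. lim z \<zeta>) holomorphic_on ball 0 s" if "\<zeta> \<in> ball 0 s" for \<zeta>
  proof (rule holomorphic_uniform_sequence[OF open_ball it_hol1[OF that]])
    fix x :: complex assume "x \<in> ball 0 s"
    then obtain e where "e > 0" "cball x e \<subseteq> ball 0 s" using cb by blast
    then show "\<exists>e>0. cball x e \<subseteq> ball 0 s \<and> uniform_limit (cball x e) (\<lambda>k z. it k z \<zeta>) (\<lambda>z. lim z \<zeta>) sequentially"
      using that by (intro exI[of _ e] conjI unif) auto
  qed
  have lim_hol2: "(\<lambda>\<zeta>. lim z \<zeta>) holomorphic_on ball 0 s" if "z \<in> ball 0 s" for z
  proof (rule holomorphic_uniform_sequence[OF open_ball it_hol2[OF that]])
    fix x :: complex assume "x \<in> ball 0 s"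
    then obtain e where "e > 0" "cball x e \<subseteq> ball 0 s" using cb by blast
    then show "\<exists>e>0. cball x e \<subseteq> ball 0 s \<and> uniform_limit (cball x e) (\<lambda>k \<zeta>. it k z \<zeta>) (\<lambda>\<zeta>. lim z \<zeta>) sequentially"
      using that by (intro exI[of _ e] conjI unif) auto
  qed
  \<comment> \<open>The value formula in \<open>stationary\<close>, with the complex fixed point in
    place of \<open>m\<close>.\<close>
  define G where "G z \<zeta> = R z + (lim z \<zeta>)\<^sup>2 - 2 * (lim z \<zeta>) ^ 3 * moment 2 (lim z \<zeta>) (R z) / w \<zeta>" for z \<zeta>
  have G1: "(\<lambda>z. G z \<zeta>) holomorphic_on ball 0 s" if "\<zeta> \<in> ball 0 s" for \<zeta>
    unfolding G_def using that
    by (intro holomorphic_intros moment_holomorphic_on R_holo lim_hol1) (auto intro!: reg simp: lim w_nz)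
  have G2: "(\<lambda>\<zeta>. G z \<zeta>) holomorphic_on ball 0 s" if "z \<in> ball 0 s" for z
    unfolding G_def using that
    by (intro holomorphic_intros moment_holomorphic_on w_holo lim_hol2) (auto intro!: reg simp: lim w_nz)
  \<comment> \<open>Compactness bounds the second moment uniformly, which provides the joint bound
    required by the power series theorem.\<close>
  have "D \<times> cball (of_real R0) d \<subseteq> regular"
    using r d by (auto simp: D_def dist_norm norm_minus_commute intro!: regular_near[OF m0 R0])
  then have "continuous_on (D \<times> cball (of_real R0) d) (\<lambda>(m, R). moment 2 m R)"
    by (rule continuous_on_subset[OF continuous_on_moment])
  then have "compact ((\<lambda>(m, R). moment 2 m R) ` (D \<times> cball (of_real R0) d))"
    by (rule compact_continuous_image) (simp add: D_def compact_Times)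
  then obtain Bm where Bm: "\<And>m R. m \<in> D \<Longrightarrow> R \<in> cball (of_real R0) d \<Longrightarrow> norm (moment 2 m R) \<le> Bm"
    using compact_imp_bounded by (fastforce simp: bounded_iff)
  have G_bound: "norm (G z \<zeta>) \<le> (R0 + d) + (m0 + r)\<^sup>2 + 2 * (m0 + r) ^ 3 * Bm / (sqrt \<beta>0 / 2)"
    if z: "z \<in> ball 0 s" and \<zeta>: "\<zeta> \<in> ball 0 s" for z \<zeta>
  proof -
    have nl: "norm (lim z \<zeta>) \<le> m0 + r"
      using lim[OF z \<zeta>] norm_triangle_ineq2[of "lim z \<zeta>" "of_real m0"] m0
      by (simp add: D_def dist_norm norm_minus_commute)
    have nR: "norm (R z) \<le> R0 + d"
      using R_near[OF z] norm_triangle_ineq2[of "R z" "of_real R0"] R0 by simp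
    have nm: "norm (moment 2 (lim z \<zeta>) (R z)) \<le> Bm"
      using R_near[OF z] lim[OF z \<zeta>] by (intro Bm) (auto simp: dist_norm norm_minus_commute)
    have Bm0: "0 \<le> Bm" using nm norm_ge_zero order_trans by blast
    have "norm (G z \<zeta>) \<le> norm (R z) + norm ((lim z \<zeta>)\<^sup>2) + norm (2 * (lim z \<zeta>) ^ 3 * moment 2 (lim z \<zeta>) (R z) / w \<zeta>)"
      unfolding G_def by (rule order_trans[OF norm_triangle_ineq4 add_right_mono[OF norm_triangle_ineq]])
    also have "norm ((lim z \<zeta>)\<^sup>2) \<le> (m0 + r)\<^sup>2" using nl by (simp add: norm_power power_mono)
    also have "norm (2 * (lim z \<zeta>) ^ 3 * moment 2 (lim z \<zeta>) (R z) / w \<zeta>) \<le> 2 * (m0 + r) ^ 3 * Bm / (sqrt \<beta>0 / 2)"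
      unfolding norm_divide norm_mult norm_power
      using nl nm Bm0 w_low[OF \<zeta>] \<beta>0 m0 r by (intro frac_le mult_mono power_mono) auto
    finally show ?thesis using nR by simp
  qed
  have G_real: "complex_of_real (free_energy (ln (\<rho>0 + h)) (\<beta>0 + k)) = G (of_real h) (of_real k)"
    if hk: "\<bar>h\<bar> < s" "\<bar>k\<bar> < s" for h k
  proof -
    have pos: "\<rho>0 + h > 0" "\<beta>0 + k > 0" using hk s by auto
    have R1: "ln (1 + (\<rho>0 + h)) > 0" using pos by (intro ln_gt_zero) simp
    obtain m where m: "stationary (ln (\<rho>0 + h)) (\<beta>0 + k) m" using stationary_exists[OF pos(2)] by blast
    have m': "m \<ge> 0" "transit m (ln (1 + (\<rho>0 + h))) = sqrt (\<beta>0 + k)"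
      "free_energy (ln (\<rho>0 + h)) (\<beta>0 + k) = ln (1 + (\<rho>0 + h)) + m\<^sup>2 - 2 * m ^ 3 * moment 2 m (ln (1 + (\<rho>0 + h))) / sqrt (\<beta>0 + k)"
      using m pos unfolding stationary_def softplus_ln[OF pos(1)] by auto
    have "\<bar>m - m0\<bar> < r" using \<delta>(2)[of "\<rho>0 + h" "\<beta>0 + k" m] m' hk s by simp
    then have mD: "of_real m \<in> D" by (simp add: D_def dist_of_real dist_real_def abs_minus_commute)
    have Rh: "R (of_real h) = of_real (ln (1 + (\<rho>0 + h)))" using pos by (intro R_real) simp
    have wk: "w (of_real k) = of_real (sqrt (\<beta>0 + k))" using pos by (intro w_real) simp
    have in_ball: "complex_of_real h \<in> ball 0 s" "complex_of_real k \<in> ball 0 s" using hk by auto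
    have "newton c (R (of_real h)) (w (of_real k)) (of_real m) = of_real m"
      unfolding newton_def Rh wk transit_of_real[OF R1] m'(2) by simp
    then have "lim (of_real h) (of_real k) = of_real m" by (rule lim_eq[OF in_ball mD])
    then show ?thesis unfolding G_def Rh wk m'(3) by (simp add: moment_of_real[OF R1])
  qed
  show ?thesis
    using s(1,5,6) by (intro exI[of _ s] conjI exI[of _ G]
        exI[of _ "(R0 + d) + (m0 + r)\<^sup>2 + 2 * (m0 + r) ^ 3 * Bm / (sqrt \<beta>0 / 2)"]
        ballI allI impI G1 G2 G_bound G_real) auto
qed

text \<open>The extension around the base point is re-centred at every point of a ball of half the
  size. This gives a neighbourhood of analytic points, as phases have to be open.\<close>

lemma free_energy_analytic:
  assumes unique: "\<And>m. m \<ge> 0 \<Longrightarrow> transit m (ln (1 + \<rho>0)) = sqrt \<beta>0 \<Longrightarrow> m = m0"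
    and f: "\<And>\<rho> \<beta>. \<rho> > 0 \<Longrightarrow> \<beta> > 0 \<Longrightarrow> f (\<rho>, \<beta>) = free_energy (ln \<rho>) \<beta>"
  shows "\<exists>\<delta>>0. \<forall>p\<in>ball (\<rho>0, \<beta>0) \<delta>. p \<in> analytic_points f"
proof -
  obtain s G M where s: "s > 0" "s < \<rho>0" "s < \<beta>0"
    and G1: "\<And>\<zeta>. \<zeta> \<in> ball 0 s \<Longrightarrow> (\<lambda>z. G z \<zeta>) holomorphic_on ball 0 s"
    and G2: "\<And>z. z \<in> ball 0 s \<Longrightarrow> (\<lambda>\<zeta>. G z \<zeta>) holomorphic_on ball 0 s"
    and G3: "\<And>z \<zeta>. z \<in> ball 0 s \<Longrightarrow> \<zeta> \<in> ball 0 s \<Longrightarrow> norm (G z \<zeta>) \<le> M"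
    and G4: "\<And>h k. \<bar>h\<bar> < s \<Longrightarrow> \<bar>k\<bar> < s \<Longrightarrow>
       complex_of_real (free_energy (ln (\<rho>0 + h)) (\<beta>0 + k)) = G (of_real h) (of_real k)"
    using free_energy_holomorphic_extension[OF unique] by metis
  have "p \<in> analytic_points f" if p: "p \<in> ball (\<rho>0, \<beta>0) (s / 2)" for p
  proof -
    obtain \<rho> \<beta> where p_eq: "p = (\<rho>, \<beta>)" by (cases p)
    define h0 k0 where "h0 = \<rho> - \<rho>0" and "k0 = \<beta> - \<beta>0"
    have "dist \<rho> \<rho>0 \<le> dist (\<rho>0, \<beta>0) p" "dist \<beta> \<beta>0 \<le> dist (\<rho>0, \<beta>0) p"
      using dist_fst_le[of "(\<rho>0, \<beta>0)" p] dist_snd_le[of "(\<rho>0, \<beta>0)" p] by (auto simp: p_eq dist_commute)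
    then have hk: "\<bar>h0\<bar> < s / 2" "\<bar>k0\<bar> < s / 2" using p by (auto simp: h0_def k0_def dist_real_def)
    have shift: "of_real h + z \<in> ball 0 s" if "\<bar>h\<bar> < s / 2" "z \<in> ball 0 (s / 2)" for h :: real and z :: complex
      using that norm_triangle_ineq[of "of_real h" z] by simp
    have img: "(\<lambda>z. complex_of_real h + z) ` ball 0 (s / 2) \<subseteq> ball 0 s" if "\<bar>h\<bar> < s / 2" for h
      by (rule image_subsetI) (rule shift[OF that])
    have trans: "(\<lambda>z. complex_of_real h + z) holomorphic_on ball 0 (s / 2)" for h
      by (intro holomorphic_intros)
    have "real_analytic_at f p"
    proof (rule real_analytic_at_complex[where r = "s / 2" and M = M and g = "\<lambda>z \<zeta>. G (of_real h0 + z) (of_real k0 + \<zeta>)"])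
      fix \<zeta> :: complex assume "\<zeta> \<in> ball 0 (s / 2)"
      then have "(\<lambda>z. G z (of_real k0 + \<zeta>)) holomorphic_on ball 0 s" by (intro G1 shift hk)
      then show "(\<lambda>z. G (of_real h0 + z) (of_real k0 + \<zeta>)) holomorphic_on ball 0 (s / 2)"
        using holomorphic_on_compose_gen[OF trans _ img[OF hk(1)]] by (simp add: o_def)
    next
      fix z :: complex assume "z \<in> ball 0 (s / 2)"
      then have "(\<lambda>\<zeta>. G (of_real h0 + z) \<zeta>) holomorphic_on ball 0 s" by (intro G2 shift hk)
      then show "(\<lambda>\<zeta>. G (of_real h0 + z) (of_real k0 + \<zeta>)) holomorphic_on ball 0 (s / 2)"
        using holomorphic_on_compose_gen[OF trans _ img[OF hk(2)]] by (simp add: o_def)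
    next
      fix z \<zeta> :: complex assume "z \<in> ball 0 (s / 2)" "\<zeta> \<in> ball 0 (s / 2)"
      then show "norm (G (of_real h0 + z) (of_real k0 + \<zeta>)) \<le> M" by (intro G3 shift hk)
    next
      fix h k assume hk': "\<bar>h\<bar> < s / 2" "\<bar>k\<bar> < s / 2"
      have "\<rho>0 + (h0 + h) > 0" "\<beta>0 + (k0 + k) > 0" using hk hk' s by linarith+
      then have "f (p + (h, k)) = free_energy (ln (\<rho>0 + (h0 + h))) (\<beta>0 + (k0 + k))"
        using f[of "\<rho>0 + (h0 + h)" "\<beta>0 + (k0 + k)"] by (simp add: p_eq h0_def k0_def)
      then show "complex_of_real (f (p + (h, k))) = G (of_real h0 + of_real h) (of_real k0 + of_real k)"
        using G4[of "h0 + h" "k0 + k"] hk hk' by simp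
    qed (use s in simp)
    moreover have "\<rho> > 0" "\<beta> > 0" using hk s unfolding h0_def k0_def by linarith+
    then have "p \<in> parameter_space" by (simp add: p_eq parameter_space_def)
    ultimately show ?thesis by (simp add: analytic_points_def)
  qed
  then show ?thesis using s by (intro exI[of _ "s / 2"]) auto
qed

end

section \<open>Second derivatives at analytic points\<close>

text \<open>An arbitrary selection, as the solution may fail to be unique;
  \<open>partial_rho_eq\<close> shows that it is determined wherever the \<rho>-derivative
  exists.\<close>

definition opt :: "real \<Rightarrow> real \<Rightarrow> real" where
  "opt \<rho> \<beta> = (SOME m. stationary (ln \<rho>) \<beta> m)"

text \<open>The \<beta>-component of the subgradient. It is the limiting mean of
  \<open>b\<^sup>2\<close> for the chosen maximiser, hence nonnegative.\<close>

definition slope :: "real \<Rightarrow> real \<Rightarrow> real" where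
  "slope \<rho> \<beta> = (ln (1 + \<rho>) + (opt \<rho> \<beta>)\<^sup>2 - free_energy (ln \<rho>) \<beta>) / (2 * \<beta>)"

lemma opt_stationary: "\<beta> > 0 \<Longrightarrow> stationary (ln \<rho>) \<beta> (opt \<rho> \<beta>)"
  unfolding opt_def by (rule someI_ex[OF stationary_exists])

lemma opt_props:
  assumes "\<rho> > 0" "\<beta> > 0"
  shows "opt \<rho> \<beta> > 0" "transit (opt \<rho> \<beta>) (ln (1 + \<rho>)) = sqrt \<beta>" "slope \<rho> \<beta> \<ge> 0"
proof -
  have st: "0 \<le> opt \<rho> \<beta>" "transit (opt \<rho> \<beta>) (ln (1 + \<rho>)) = sqrt \<beta>"
    "free_energy (ln \<rho>) \<beta> \<le> ln (1 + \<rho>) + (opt \<rho> \<beta>)\<^sup>2"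
    using opt_stationary[OF assms(2), of \<rho>] assms(1) by (simp_all add: stationary_def softplus_ln)
  then show "transit (opt \<rho> \<beta>) (ln (1 + \<rho>)) = sqrt \<beta>" "slope \<rho> \<beta> \<ge> 0"
    using assms by (simp_all add: slope_def)
  have "opt \<rho> \<beta> \<noteq> 0" using st(2) assms by (auto simp: transit_def)
  then show "opt \<rho> \<beta> > 0" using st by simp
qed

lemma deriv_shift: "((\<lambda>t. g (x + t)) has_real_derivative D) (at 0) \<longleftrightarrow> (g has_real_derivative D) (at x)"
  using DERIV_shift[of g D 0 x] by (simp add: add.commute)

lemma deriv_shift_eq: "deriv (\<lambda>t. g (x + t)) 0 = deriv g x" for g :: "real \<Rightarrow> real"
  unfolding deriv_def deriv_shift ..

lemma DERIV_nonneg_if_right_mono: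
  fixes g :: "real \<Rightarrow> real"
  assumes "(g has_real_derivative D) (at 0)" "r > 0" "\<And>t. 0 < t \<Longrightarrow> t < r \<Longrightarrow> g 0 \<le> g t"
  shows "D \<ge> 0"
proof (rule ccontr)
  assume "\<not> D \<ge> 0"
  then obtain d where d: "d > 0" "\<And>h. h > 0 \<Longrightarrow> h < d \<Longrightarrow> g (0 + h) < g 0"
    using DERIV_neg_dec_right[OF assms(1)] by auto
  define t where "t = min d r / 2"
  have "0 < t" "t < d" "t < r" using d assms by (auto simp: t_def)
  then show False using d(2)[of t] assms(3)[of t] by simp
qed

text \<open>A function squeezed between its own subgradient inequalities is differentiable wherever the
  subgradient is continuous.\<close>

lemma DERIV_of_subgradients:
  fixes g l s :: "real \<Rightarrow> real"
  assumes l: "(l has_real_derivative l') (at x)" and s: "(s \<longlongrightarrow> s0) (at x)"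
    and sub: "\<forall>\<^sub>F t in at x. (l t - l x) * s0 \<le> g t - g x \<and> (l x - l t) * s t \<le> g x - g t"
  shows "(g has_real_derivative l' * s0) (at x)"
proof -
  have l_lim: "((\<lambda>t. (l t - l x) / (t - x)) \<longlongrightarrow> l') (at x)"
    using l by (simp add: has_field_derivative_iff)
  have "((\<lambda>t. \<bar>(l t - l x) / (t - x)\<bar> * \<bar>s t - s0\<bar>) \<longlongrightarrow> \<bar>l'\<bar> * \<bar>s0 - s0\<bar>) (at x)"
    by (intro tendsto_intros l_lim s)
  then have zero: "((\<lambda>t. \<bar>(l t - l x) / (t - x)\<bar> * \<bar>s t - s0\<bar>) \<longlongrightarrow> 0) (at x)" by simp
  have "((\<lambda>t. (g t - g x) / (t - x) - (l t - l x) / (t - x) * s0) \<longlongrightarrow> 0) (at x)"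
  proof (rule Lim_null_comparison[OF _ zero])
    show "\<forall>\<^sub>F t in at x. norm ((g t - g x) / (t - x) - (l t - l x) / (t - x) * s0) \<le> \<bar>(l t - l x) / (t - x)\<bar> * \<bar>s t - s0\<bar>"
      using sub
    proof eventually_elim
      case (elim t)
      have "\<bar>(g t - g x) - (l t - l x) * s0\<bar> \<le> \<bar>(l t - l x) * (s t - s0)\<bar>"
        using elim by (simp add: algebra_simps)
      then have "\<bar>(g t - g x) - (l t - l x) * s0\<bar> / \<bar>t - x\<bar> \<le> \<bar>(l t - l x) * (s t - s0)\<bar> / \<bar>t - x\<bar>"
        by (rule divide_right_mono) simp
      moreover have "(g t - g x) / (t - x) - (l t - l x) / (t - x) * s0 = ((g t - g x) - (l t - l x) * s0) / (t - x)"
        by (simp only: diff_divide_distrib[of "g t - g x"] times_divide_eq_left)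
      ultimately show ?case by (simp add: abs_mult)
    qed
  qed
  from tendsto_add[OF this tendsto_mult_right[OF l_lim, of s0]]
  show ?thesis by (simp add: has_field_derivative_iff)
qed

definition curvature :: "real \<Rightarrow> real \<Rightarrow> real" where
  "curvature \<rho> \<beta> = transit_deriv (opt \<rho> \<beta>) (ln (1 + \<rho>))"

text \<open>Differentiating \<open>transit m R = sqrt \<beta>\<close> in \<open>\<beta>\<close> gives \<open>opt_beta\<close>. The first derivatives of \<open>f\<close> are
  \<open>m / (\<rho> sqrt \<beta>)\<close> and \<open>(R + m\<^sup>2 - f) / (2 \<beta>)\<close>; equality of the mixed second derivatives then gives \<open>opt_rho\<close>.\<close>

definition opt_beta :: "real \<Rightarrow> real \<Rightarrow> real" where
  "opt_beta \<rho> \<beta> = 1 / (2 * sqrt \<beta>) * (1 / curvature \<rho> \<beta>)"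

text \<open>The \<beta>-derivative of \<open>opt \<rho> \<beta> / (\<rho> * sqrt \<beta>)\<close> by
  the quotient rule.\<close>

definition mixed :: "real \<Rightarrow> real \<Rightarrow> real" where
  "mixed \<rho> \<beta> = 1 / (\<rho> * sqrt \<beta>) * opt_beta \<rho> \<beta> - opt \<rho> \<beta> / (2 * \<rho> * \<beta> * sqrt \<beta>)"

definition opt_rho :: "real \<Rightarrow> real \<Rightarrow> real" where
  "opt_rho \<rho> \<beta> = (2 * \<beta> * mixed \<rho> \<beta> + (opt \<rho> \<beta> / (\<rho> * sqrt \<beta>) - 1 / (1 + \<rho>))) / (2 * opt \<rho> \<beta>)"

context
  fixes f :: "real \<times> real \<Rightarrow> real"
  assumes f: "\<And>\<rho> \<beta>. \<rho> > 0 \<Longrightarrow> \<beta> > 0 \<Longrightarrow> f (\<rho>, \<beta>) = free_energy (ln \<rho>) \<beta>"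
begin

lemma subgradient:
  assumes "\<rho> > 0" "\<beta> > 0" "\<rho>' > 0" "\<beta>' > 0"
  shows "f (\<rho>, \<beta>) + (ln \<rho>' - ln \<rho>) * (opt \<rho> \<beta> / sqrt \<beta>) + (\<beta>' - \<beta>) * slope \<rho> \<beta> \<le> f (\<rho>', \<beta>')"
proof -
  have "\<forall>\<theta>' \<beta>'. \<beta>' > 0 \<longrightarrow> free_energy (ln \<rho>) \<beta> + (\<theta>' - ln \<rho>) * (opt \<rho> \<beta> / sqrt \<beta>)
        + (\<beta>' - \<beta>) * ((softplus (ln \<rho>) + (opt \<rho> \<beta>)\<^sup>2 - free_energy (ln \<rho>) \<beta>) / (2 * \<beta>)) \<le> free_energy \<theta>' \<beta>'"
    using opt_stationary[OF assms(2), of \<rho>] unfolding stationary_def by (elim conjE)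
  from this[rule_format, OF assms(4), of "ln \<rho>'"] show ?thesis
    unfolding slope_def f[OF assms(1,2)] f[OF assms(3,4)] softplus_ln[OF assms(1)] .
qed

text \<open>Subtracting the supporting function from \<open>f\<close> leaves a local minimum at
  \<open>\<rho>\<close>, where the derivative must vanish.\<close>

lemma partial_rho_eq:
  assumes "\<rho> > 0" "\<beta> > 0" and D: "((\<lambda>x. f (x, \<beta>)) has_real_derivative D) (at \<rho>)"
  shows "D = opt \<rho> \<beta> / (\<rho> * sqrt \<beta>)"
proof -
  define C where "C = opt \<rho> \<beta> / sqrt \<beta>"
  define u where "u x = f (x, \<beta>) - (ln x - ln \<rho>) * C" for x
  have "(u has_real_derivative D - 1 / \<rho> * C) (at \<rho>)"
    unfolding u_def using assms by (auto intro!: derivative_eq_intros D)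
  moreover have "\<forall>y. \<bar>\<rho> - y\<bar> < \<rho> \<longrightarrow> u \<rho> \<le> u y"
    using subgradient[OF assms(1,2) _ assms(2)] by (auto simp: u_def C_def[symmetric] algebra_simps abs_less_iff)
  ultimately have "D - 1 / \<rho> * C = 0"
    using assms(1) by (intro DERIV_local_min)
  then show ?thesis by (simp add: C_def)
qed

lemma partial_beta_eq:
  assumes "\<rho> > 0" "\<beta> > 0" and D: "((\<lambda>y. f (\<rho>, y)) has_real_derivative D) (at \<beta>)"
  shows "D = slope \<rho> \<beta>"
proof -
  define u where "u y = f (\<rho>, y) - (y - \<beta>) * slope \<rho> \<beta>" for y
  have "(u has_real_derivative D - 1 * slope \<rho> \<beta>) (at \<beta>)"
    unfolding u_def using assms by (auto intro!: derivative_eq_intros D)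
  moreover have "\<forall>y. \<bar>\<beta> - y\<bar> < \<beta> \<longrightarrow> u \<beta> \<le> u y"
    using subgradient[OF assms(1,2) assms(1)] by (auto simp: u_def algebra_simps abs_less_iff)
  ultimately have "D - 1 * slope \<rho> \<beta> = 0"
    using assms(2) by (intro DERIV_local_min)
  then show ?thesis by simp
qed

text \<open>Adding the subgradient inequalities at the two points. This is the form in which
  convexity fixes the sign of the second derivative.\<close>

lemma slope_mono:
  assumes "\<rho> > 0" "\<beta> > 0" "\<beta> < \<beta>'"
  shows "slope \<rho> \<beta> \<le> slope \<rho> \<beta>'"
proof -
  have "f (\<rho>, \<beta>) + (\<beta>' - \<beta>) * slope \<rho> \<beta> \<le> f (\<rho>, \<beta>')"
    "f (\<rho>, \<beta>') + (\<beta> - \<beta>') * slope \<rho> \<beta>' \<le> f (\<rho>, \<beta>)"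
    using subgradient[of \<rho> \<beta> \<rho> \<beta>'] subgradient[of \<rho> \<beta>' \<rho> \<beta>] assms by auto
  then have "(\<beta>' - \<beta>) * slope \<rho> \<beta> \<le> (\<beta>' - \<beta>) * slope \<rho> \<beta>'" by (simp add: algebra_simps)
  then show ?thesis using assms by simp
qed

lemma analytic_double_series:
  assumes "(\<rho>, \<beta>) \<in> analytic_points f"
  obtains c r where "double_series c r (\<lambda>h k. f (\<rho> + h, \<beta> + k))" "r \<le> \<rho>" "r \<le> \<beta>" "\<rho> > 0" "\<beta> > 0"
proof -
  have pos: "\<rho> > 0" "\<beta> > 0" and "real_analytic_at f (\<rho>, \<beta>)"
    using assms by (auto simp: analytic_points_def parameter_space_def)
  then obtain c r where "r > 0" and cr: "\<And>h k. \<bar>h\<bar> < r \<and> \<bar>k\<bar> < r \<Longrightarrow>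
      ((\<lambda>(i, j). c i j * h ^ i * k ^ j) has_sum f ((\<rho>, \<beta>) + (h, k))) UNIV"
    unfolding real_analytic_at_def by blast
  then have "double_series c (Min {r, \<rho>, \<beta>}) (\<lambda>h k. f (\<rho> + h, \<beta> + k))"
    using pos by (auto simp: double_series_def)
  then show ?thesis by (rule that) (use pos in auto)
qed

text \<open>Near an analytic point the first partials exist and equal their expressions in
  \<open>opt\<close> and \<open>slope\<close>. Hence \<open>opt\<close> is itself a product of
  differentiable functions, and differentiating these identities yields every second derivative with
  no prior knowledge that \<open>curvature\<close> is nonzero.\<close>

lemma analytic_second_derivs:
  assumes an: "(\<rho>, \<beta>) \<in> analytic_points f"
  shows "curvature \<rho> \<beta> > 0"
    and "\<exists>r>0. \<forall>h k. \<bar>h\<bar> < r \<and> \<bar>k\<bar> < r \<longrightarrow>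
      (\<lambda>x. f (x, \<beta> + k)) field_differentiable (at (\<rho> + h)) \<and> (\<lambda>y. f (\<rho> + h, y)) field_differentiable (at (\<beta> + k))"
    and "((\<lambda>k. deriv (\<lambda>x. f (x, \<beta> + k)) \<rho>) has_real_derivative mixed \<rho> \<beta>) (at 0)"
    and "((\<lambda>h. deriv (\<lambda>y. f (\<rho> + h, y)) \<beta>) has_real_derivative mixed \<rho> \<beta>) (at 0)"
    and "((\<lambda>h. deriv (\<lambda>x. f (x, \<beta>)) (\<rho> + h)) has_real_derivative
      1 / (\<rho> * sqrt \<beta>) * opt_rho \<rho> \<beta> - opt \<rho> \<beta> / (\<rho>\<^sup>2 * sqrt \<beta>)) (at 0)"
    and "((\<lambda>k. deriv (\<lambda>y. f (\<rho>, y)) (\<beta> + k)) has_real_derivative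
      opt \<rho> \<beta> / \<beta> * opt_beta \<rho> \<beta> - 3 * slope \<rho> \<beta> / (2 * \<beta>)) (at 0)"
proof -
  obtain c r where ds: "double_series c r (\<lambda>h k. f (\<rho> + h, \<beta> + k))" and r: "r \<le> \<rho>" "r \<le> \<beta>" and pos: "\<rho> > 0" "\<beta> > 0"
    using analytic_double_series[OF an] .
  have r0: "r > 0" using ds by (simp add: double_series_def)
  note ds' = double_series_swap[OF ds]
  define m where "m = opt \<rho> \<beta>"
  define R where "R = ln (1 + \<rho>)"
  define c11 where "c11 = c 1 1"
  have m: "m > 0" and R: "R > 0" using opt_props[OF pos] pos by (auto simp: m_def R_def)
  have sq: "sqrt \<beta> > 0" "sqrt \<beta> * sqrt \<beta> = \<beta>" using pos by auto
  have shift_diff: "(\<lambda>t. g (x + t)) field_differentiable (at h) \<Longrightarrow> g field_differentiable (at (x + h))"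
    for g :: "real \<Rightarrow> real" and x h
    unfolding field_differentiable_def using DERIV_shift[of g _ h x] by (simp add: add.commute)
  have d1: "(\<lambda>x. f (x, \<beta> + k)) field_differentiable (at (\<rho> + h))" if "\<bar>h\<bar> < r" "\<bar>k\<bar> < r" for h k
    by (rule shift_diff[of "\<lambda>x. f (x, \<beta> + k)"]) (use double_series_derivs(1)[OF ds that] in simp)
  have d2: "(\<lambda>y. f (\<rho> + h, y)) field_differentiable (at (\<beta> + k))" if "\<bar>h\<bar> < r" "\<bar>k\<bar> < r" for h k
    by (rule shift_diff[of "\<lambda>y. f (\<rho> + h, y)"]) (use double_series_derivs(1)[OF ds' that(2,1)] in simp)
  show "\<exists>r>0. \<forall>h k. \<bar>h\<bar> < r \<and> \<bar>k\<bar> < r \<longrightarrow>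
      (\<lambda>x. f (x, \<beta> + k)) field_differentiable (at (\<rho> + h)) \<and> (\<lambda>y. f (\<rho> + h, y)) field_differentiable (at (\<beta> + k))"
    using r0 d1 d2 by blast
  have e1: "deriv (\<lambda>x. f (x, \<beta> + k)) (\<rho> + h) = opt (\<rho> + h) (\<beta> + k) / ((\<rho> + h) * sqrt (\<beta> + k))"
    if "\<bar>h\<bar> < r" "\<bar>k\<bar> < r" for h k
    by (rule partial_rho_eq) (use that r d1[OF that] in \<open>auto simp: DERIV_deriv_iff_field_differentiable\<close>)
  have e2: "deriv (\<lambda>y. f (\<rho> + h, y)) (\<beta> + k) = slope (\<rho> + h) (\<beta> + k)"
    if "\<bar>h\<bar> < r" "\<bar>k\<bar> < r" for h k
    by (rule partial_beta_eq) (use that r d2[OF that] in \<open>auto simp: DERIV_deriv_iff_field_differentiable\<close>)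
  have A: "((\<lambda>k. deriv (\<lambda>x. f (x, \<beta> + k)) \<rho>) has_real_derivative c11) (at 0)"
    using double_series_derivs(2)[OF ds] unfolding deriv_shift_eq[of "\<lambda>x. f (x, _)"] c11_def .
  have B: "((\<lambda>h. deriv (\<lambda>y. f (\<rho> + h, y)) \<beta>) has_real_derivative c11) (at 0)"
    using double_series_derivs(2)[OF ds'] unfolding deriv_shift_eq[of "\<lambda>y. f (_, y)"] c11_def .
  obtain X where X: "((\<lambda>h. deriv (\<lambda>x. f (x, \<beta>)) (\<rho> + h)) has_real_derivative X) (at 0)"
  proof -
    have "deriv (\<lambda>x. f (\<rho> + x, \<beta> + 0)) h = deriv (\<lambda>x. f (x, \<beta>)) (\<rho> + h)" for h
      unfolding deriv_def using DERIV_shift[of "\<lambda>x. f (x, \<beta>)" _ h \<rho>] by (simp add: add.commute)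
    then show ?thesis using double_series_derivs(3)[OF ds] that by (auto simp: field_differentiable_def)
  qed
  obtain Y where Y: "((\<lambda>k. deriv (\<lambda>y. f (\<rho>, y)) (\<beta> + k)) has_real_derivative Y) (at 0)"
  proof -
    have "deriv (\<lambda>y. f (\<rho> + 0, \<beta> + y)) k = deriv (\<lambda>y. f (\<rho>, y)) (\<beta> + k)" for k
      unfolding deriv_def using DERIV_shift[of "\<lambda>y. f (\<rho>, y)" _ k \<beta>] by (simp add: add.commute)
    then show ?thesis using double_series_derivs(3)[OF ds'] that by (auto simp: field_differentiable_def)
  qed
  have A0: "deriv (\<lambda>x. f (x, \<beta>)) \<rho> = m / (\<rho> * sqrt \<beta>)" using e1[of 0 0] r0 by (simp add: m_def)
  have B0: "deriv (\<lambda>y. f (\<rho>, y)) \<beta> = slope \<rho> \<beta>" using e2[of 0 0] r0 by simp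
  note transform = has_field_derivative_transform_within_open[where S = "ball 0 r"]
  \<comment> \<open>The product rule applied to
    \<open>opt = f_rho * sqrt \<beta> * \<rho>\<close>.\<close>
  define mb where "mb = (c11 * sqrt \<beta> + m / (\<rho> * sqrt \<beta>) * (inverse (sqrt \<beta>) / 2)) * \<rho>"
  have sqrt_d: "((\<lambda>k. sqrt (\<beta> + k)) has_real_derivative inverse (sqrt \<beta>) / 2) (at 0)"
    using pos by (auto intro!: derivative_eq_intros)
  have mb: "((\<lambda>k. opt \<rho> (\<beta> + k)) has_real_derivative mb) (at 0)"
  proof -
    have "((\<lambda>k. deriv (\<lambda>x. f (x, \<beta> + k)) \<rho> * sqrt (\<beta> + k) * \<rho>) has_real_derivative mb) (at 0)"
      using DERIV_cmult_right[OF DERIV_mult[OF A sqrt_d], of \<rho>] by (simp add: mb_def A0 algebra_simps)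
    then show ?thesis
    proof (rule transform)
      fix k :: real assume "k \<in> ball 0 r"
      then have "\<bar>k\<bar> < r" "\<beta> + k > 0" using r by auto
      then show "deriv (\<lambda>x. f (x, \<beta> + k)) \<rho> * sqrt (\<beta> + k) * \<rho> = opt \<rho> (\<beta> + k)"
        using e1[of 0 k] r0 pos by simp
    qed (use r0 in auto)
  qed
  have tr: "transit_deriv m R * mb = 1 / (2 * sqrt \<beta>)"
  proof -
    have "((\<lambda>k. transit (opt \<rho> (\<beta> + k)) R) has_real_derivative transit_deriv m R * mb) (at 0)"
      using DERIV_chain2[OF transit_has_real_derivative[OF R, of "opt \<rho> (\<beta> + 0)"] mb] by (simp add: m_def)
    moreover have "((\<lambda>k. transit (opt \<rho> (\<beta> + k)) R) has_real_derivative inverse (sqrt \<beta>) / 2) (at 0)"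
      using sqrt_d
    proof (rule transform)
      fix k :: real assume "k \<in> ball 0 r"
      then show "sqrt (\<beta> + k) = transit (opt \<rho> (\<beta> + k)) R"
        using opt_props(2)[of \<rho> "\<beta> + k"] pos r by (simp add: R_def abs_less_iff)
    qed (use r0 in auto)
    ultimately have "transit_deriv m R * mb = inverse (sqrt \<beta>) / 2" by (rule DERIV_unique)
    then show ?thesis by (simp add: field_simps)
  qed
  define q where "q = slope \<rho> \<beta>"
  have q_eq: "ln (1 + \<rho>) + m\<^sup>2 - f (\<rho>, \<beta>) = 2 * \<beta> * q"
    using pos by (simp add: q_def slope_def m_def f)
  have q0: "q \<ge> 0" using opt_props[OF pos] by (simp add: q_def)
  have Yq: "Y = m / \<beta> * mb - 3 * q / (2 * \<beta>)"
  proof -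
    have fb: "((\<lambda>k. f (\<rho>, \<beta> + k)) has_real_derivative q) (at 0)"
      using d2[of 0 0] r0 B0 by (simp add: deriv_shift[of "\<lambda>y. f (\<rho>, y)"] DERIV_deriv_iff_field_differentiable[symmetric] q_def)
    have "((\<lambda>k. (ln (1 + \<rho>) + (opt \<rho> (\<beta> + k))\<^sup>2 - f (\<rho>, \<beta> + k)) / (2 * (\<beta> + k))) has_real_derivative
      ((2 * m * mb - q) * (2 * \<beta>) - (ln (1 + \<rho>) + m\<^sup>2 - f (\<rho>, \<beta>)) * 2) / ((2 * \<beta>) * (2 * \<beta>))) (at 0)"
      using pos by (auto intro!: derivative_eq_intros mb fb simp: m_def)
    then have "((\<lambda>k. deriv (\<lambda>y. f (\<rho>, y)) (\<beta> + k)) has_real_derivative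
      ((2 * m * mb - q) * (2 * \<beta>) - (ln (1 + \<rho>) + m\<^sup>2 - f (\<rho>, \<beta>)) * 2) / ((2 * \<beta>) * (2 * \<beta>))) (at 0)"
    proof (rule transform)
      fix k :: real assume "k \<in> ball 0 r"
      then have "\<bar>k\<bar> < r" "\<beta> + k > 0" using r by auto
      then show "(ln (1 + \<rho>) + (opt \<rho> (\<beta> + k))\<^sup>2 - f (\<rho>, \<beta> + k)) / (2 * (\<beta> + k)) = deriv (\<lambda>y. f (\<rho>, y)) (\<beta> + k)"
        using e2[of 0 k] r0 pos by (simp add: slope_def f)
    qed (use r0 in auto)
    from DERIV_unique[OF Y this]
    have "Y = ((2 * m * mb - q) * (2 * \<beta>) - 2 * \<beta> * q * 2) / ((2 * \<beta>) * (2 * \<beta>))" unfolding q_eq .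
    also have "(2 * m * mb - q) * (2 * \<beta>) - 2 * \<beta> * q * 2 = (2 * \<beta>) * (2 * m * mb - 3 * q)"
      by (simp add: algebra_simps)
    also have "\<dots> / ((2 * \<beta>) * (2 * \<beta>)) = (2 * m * mb - 3 * q) / (2 * \<beta>)"
      using pos by (intro mult_divide_mult_cancel_left) simp
    also have "\<dots> = m / \<beta> * mb - 3 * q / (2 * \<beta>)" by (simp add: diff_divide_distrib)
    finally show ?thesis .
  qed
  \<comment> \<open>Convexity enters here. As \<open>q\<close> is nonnegative, the formula for
    \<open>Y\<close> forces \<open>mb\<close> to be nonnegative, and \<open>tr\<close> then makes
    the curvature positive.\<close>
  have "Y \<ge> 0"
  proof (rule DERIV_nonneg_if_right_mono[OF Y r0])
    fix t assume t: "0 < t" "t < r"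
    then show "deriv (\<lambda>y. f (\<rho>, y)) (\<beta> + 0) \<le> deriv (\<lambda>y. f (\<rho>, y)) (\<beta> + t)"
      using e2[of 0 t] e2[of 0 0] slope_mono[OF pos, of "\<beta> + t"] r0 by simp
  qed
  then have "m / \<beta> * mb \<ge> 0" using q0 pos by (simp add: Yq) (meson divide_nonneg_pos mult_nonneg_nonneg order_trans zero_le_numeral zero_less_numeral mult_pos_pos)
  then have mb0: "mb \<ge> 0" using m pos by (simp add: zero_le_mult_iff zero_le_divide_iff)
  have "0 < transit_deriv m R * mb" using tr pos by simp
  then have curv: "transit_deriv m R > 0" using mb0 by (simp add: zero_less_mult_iff)
  then show "curvature \<rho> \<beta> > 0" by (simp add: curvature_def m_def R_def)
  have mb_eq: "mb = opt_beta \<rho> \<beta>"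
    using tr curv sq by (simp add: opt_beta_def curvature_def m_def[symmetric] R_def[symmetric] field_simps)
  show "((\<lambda>k. deriv (\<lambda>y. f (\<rho>, y)) (\<beta> + k)) has_real_derivative
      opt \<rho> \<beta> / \<beta> * opt_beta \<rho> \<beta> - 3 * slope \<rho> \<beta> / (2 * \<beta>)) (at 0)"
    using Y by (simp add: Yq mb_eq m_def q_def)
  have c11: "c11 = mixed \<rho> \<beta>"
  proof -
    define s where "s = sqrt \<beta>"
    have s: "s > 0" "s * s = \<beta>" using sq by (auto simp: s_def)
    have "1 / (\<rho> * s) * mb = c11 + m / (2 * \<rho> * (s * s) * s)"
      unfolding mb_def s_def[symmetric] using s(1) pos(1) by (simp add: field_simps)
    then show ?thesis
      unfolding mixed_def mb_eq[symmetric] m_def[symmetric] s_def[symmetric] s(2) by simp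
  qed
  show "((\<lambda>k. deriv (\<lambda>x. f (x, \<beta> + k)) \<rho>) has_real_derivative mixed \<rho> \<beta>) (at 0)"
    and "((\<lambda>h. deriv (\<lambda>y. f (\<rho> + h, y)) \<beta>) has_real_derivative mixed \<rho> \<beta>) (at 0)"
    using A B by (simp_all add: c11)
  define mr where "mr = (X * \<rho> + m / (\<rho> * sqrt \<beta>)) * sqrt \<beta>"
  have mr: "((\<lambda>h. opt (\<rho> + h) \<beta>) has_real_derivative mr) (at 0)"
  proof -
    have "((\<lambda>h. deriv (\<lambda>x. f (x, \<beta>)) (\<rho> + h) * (\<rho> + h) * sqrt \<beta>) has_real_derivative mr) (at 0)"
      by (auto intro!: derivative_eq_intros X simp: mr_def A0)
    then show ?thesis
    proof (rule transform)
      fix h :: real assume "h \<in> ball 0 r"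
      then have "\<bar>h\<bar> < r" "\<rho> + h > 0" using r by auto
      then show "deriv (\<lambda>x. f (x, \<beta>)) (\<rho> + h) * (\<rho> + h) * sqrt \<beta> = opt (\<rho> + h) \<beta>"
        using e1[of h 0] r0 sq by simp
    qed (use r0 in auto)
  qed
  \<comment> \<open>A second computation of the mixed derivative, now from \<open>slope\<close>. It
    determines \<open>mr\<close>, and through \<open>mr\<close> the remaining derivative
    \<open>X\<close>.\<close>
  have "(1 / (1 + \<rho>) + 2 * m * mr - m / (\<rho> * sqrt \<beta>)) / (2 * \<beta>) = c11"
  proof -
    have fa: "((\<lambda>h. f (\<rho> + h, \<beta>)) has_real_derivative m / (\<rho> * sqrt \<beta>)) (at 0)"
      using d1[of 0 0] r0 A0 by (simp add: deriv_shift[of "\<lambda>x. f (x, \<beta>)"] DERIV_deriv_iff_field_differentiable[symmetric])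
    have "((\<lambda>h. (ln (1 + (\<rho> + h)) + (opt (\<rho> + h) \<beta>)\<^sup>2 - f (\<rho> + h, \<beta>)) / (2 * \<beta>)) has_real_derivative
      (1 / (1 + \<rho>) + 2 * m * mr - m / (\<rho> * sqrt \<beta>)) / (2 * \<beta>)) (at 0)"
      using pos by (auto intro!: derivative_eq_intros mr fa simp: m_def divide_simps)
    then have "((\<lambda>h. deriv (\<lambda>y. f (\<rho> + h, y)) \<beta>) has_real_derivative
      (1 / (1 + \<rho>) + 2 * m * mr - m / (\<rho> * sqrt \<beta>)) / (2 * \<beta>)) (at 0)"
    proof (rule transform)
      fix h :: real assume "h \<in> ball 0 r"
      then have "\<bar>h\<bar> < r" "\<rho> + h > 0" using r by auto
      then show "(ln (1 + (\<rho> + h)) + (opt (\<rho> + h) \<beta>)\<^sup>2 - f (\<rho> + h, \<beta>)) / (2 * \<beta>) = deriv (\<lambda>y. f (\<rho> + h, y)) \<beta>"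
        using e2[of h 0] r0 pos by (simp add: slope_def f)
    qed (use r0 in auto)
    from DERIV_unique[OF this B] show ?thesis .
  qed
  moreover have "N = 2 * \<beta> * c11" if "N / (2 * \<beta>) = c11" for N using that pos by auto
  ultimately have "1 / (1 + \<rho>) + 2 * m * mr - m / (\<rho> * sqrt \<beta>) = 2 * \<beta> * c11" by blast
  then have "2 * m * mr = 2 * \<beta> * mixed \<rho> \<beta> + (m / (\<rho> * sqrt \<beta>) - 1 / (1 + \<rho>))"
    by (simp add: c11)
  then have mr_eq: "mr = opt_rho \<rho> \<beta>"
    using m unfolding opt_rho_def m_def[symmetric] by (simp add: eq_divide_eq mult.commute)
  have "X = 1 / (\<rho> * sqrt \<beta>) * mr - m / (\<rho>\<^sup>2 * sqrt \<beta>)"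
    unfolding mr_def using pos sq by (simp add: field_simps power2_eq_square)
  then show "((\<lambda>h. deriv (\<lambda>x. f (x, \<beta>)) (\<rho> + h)) has_real_derivative
      1 / (\<rho> * sqrt \<beta>) * opt_rho \<rho> \<beta> - opt \<rho> \<beta> / (\<rho>\<^sup>2 * sqrt \<beta>)) (at 0)"
    using X by (simp add: mr_eq m_def)
qed

end

section \<open>The phase transition\<close>

lemma Basis_real_prod: "(Basis :: (real \<times> real) set) = {(1, 0), (0, 1)}"
  by (auto simp: Basis_prod_def)

lemma partial_fst: "partial [(1, 0)] f (x, y) = deriv (\<lambda>x. f (x, y)) x"
  using deriv_shift_eq[of "\<lambda>x. f (x, y)" x] by simp

lemma partial_snd: "partial [(0, 1)] f (x, y) = deriv (\<lambda>y. f (x, y)) y"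
  using deriv_shift_eq[of "\<lambda>y. f (x, y)" y] by simp

lemma partial_exists_fst: "partial_exists [(1, 0)] f (x, y) \<longleftrightarrow> (\<exists>D. ((\<lambda>x. f (x, y)) has_real_derivative D) (at x))"
  using deriv_shift[of "\<lambda>x. f (x, y)" x] by (simp add: real_differentiable_def)

lemma partial_exists_snd: "partial_exists [(0, 1)] f (x, y) \<longleftrightarrow> (\<exists>D. ((\<lambda>y. f (x, y)) has_real_derivative D) (at y))"
  using deriv_shift[of "\<lambda>y. f (x, y)" y] by (simp add: real_differentiable_def)

lemma second_partial:
  assumes D: "((\<lambda>t. partial [v] f (p + t *\<^sub>R u)) has_real_derivative D) (at 0)"
    and ex: "\<forall>\<^sub>F t in nhds 0. partial_exists [v] f (p + t *\<^sub>R u)"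
  shows "partial_exists [u, v] f p" "partial [u, v] f p = D"
proof -
  show "partial_exists [u, v] f p"
    using D ex unfolding partial_exists.simps(2)[of u] by (auto simp: real_differentiable_def simp del: partial.simps partial_exists.simps)
  show "partial [u, v] f p = D"
    using DERIV_imp_deriv[OF D] unfolding partial.simps(2)[of u] .
qed

context
  fixes f :: "real \<times> real \<Rightarrow> real"
  assumes f: "\<And>\<rho> \<beta>. \<rho> > 0 \<Longrightarrow> \<beta> > 0 \<Longrightarrow> f (\<rho>, \<beta>) = free_energy (ln \<rho>) \<beta>"
begin

lemma analytic_second_partials:
  assumes an: "(\<rho>, \<beta>) \<in> analytic_points f"
  shows "\<And>u v. u \<in> Basis \<Longrightarrow> v \<in> Basis \<Longrightarrow> partial_exists [u, v] f (\<rho>, \<beta>)"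
    and "partial [(1, 0), (1, 0)] f (\<rho>, \<beta>) = 1 / (\<rho> * sqrt \<beta>) * opt_rho \<rho> \<beta> - opt \<rho> \<beta> / (\<rho>\<^sup>2 * sqrt \<beta>)"
    and "partial [(1, 0), (0, 1)] f (\<rho>, \<beta>) = mixed \<rho> \<beta>"
    and "partial [(0, 1), (1, 0)] f (\<rho>, \<beta>) = mixed \<rho> \<beta>"
    and "partial [(0, 1), (0, 1)] f (\<rho>, \<beta>) = opt \<rho> \<beta> / \<beta> * opt_beta \<rho> \<beta> - 3 * slope \<rho> \<beta> / (2 * \<beta>)"
proof -
  note d = analytic_second_derivs[of f, OF f an]
  obtain r where r: "r > 0" "\<And>h k. \<bar>h\<bar> < r \<Longrightarrow> \<bar>k\<bar> < r \<Longrightarrow>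
      (\<lambda>x. f (x, \<beta> + k)) field_differentiable (at (\<rho> + h)) \<and> (\<lambda>y. f (\<rho> + h, y)) field_differentiable (at (\<beta> + k))"
    using d(2) by blast
  have near: "\<forall>\<^sub>F t in nhds 0. \<bar>t\<bar> < r" for t :: real
    using r(1) by (auto simp: eventually_nhds_metric dist_real_def intro!: exI[of _ r])
  have ex: "\<forall>\<^sub>F t in nhds 0. partial_exists [v] f ((\<rho>, \<beta>) + t *\<^sub>R u)" if "u \<in> Basis" "v \<in> Basis" for u v
    using near
  proof eventually_elim
    case (elim t)
    show ?case
      using that r(2)[of t 0] r(2)[of 0 t] elim r(1)
      by (auto simp: Basis_real_prod partial_exists_fst partial_exists_snd field_differentiable_def
          simp del: partial_exists.simps)
  qed
  have D: "((\<lambda>t. partial [(1, 0)] f ((\<rho>, \<beta>) + t *\<^sub>R (1, 0))) has_real_derivative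
      1 / (\<rho> * sqrt \<beta>) * opt_rho \<rho> \<beta> - opt \<rho> \<beta> / (\<rho>\<^sup>2 * sqrt \<beta>)) (at 0)"
    "((\<lambda>t. partial [(0, 1)] f ((\<rho>, \<beta>) + t *\<^sub>R (1, 0))) has_real_derivative mixed \<rho> \<beta>) (at 0)"
    "((\<lambda>t. partial [(1, 0)] f ((\<rho>, \<beta>) + t *\<^sub>R (0, 1))) has_real_derivative mixed \<rho> \<beta>) (at 0)"
    "((\<lambda>t. partial [(0, 1)] f ((\<rho>, \<beta>) + t *\<^sub>R (0, 1))) has_real_derivative
      opt \<rho> \<beta> / \<beta> * opt_beta \<rho> \<beta> - 3 * slope \<rho> \<beta> / (2 * \<beta>)) (at 0)"
    using d(3-6) by (simp_all add: partial_fst partial_snd del: partial.simps)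
  have B: "(1, 0) \<in> (Basis :: (real \<times> real) set)" "(0, 1) \<in> (Basis :: (real \<times> real) set)"
    by (simp_all add: Basis_real_prod)
  show "partial_exists [u, v] f (\<rho>, \<beta>)" if "u \<in> Basis" "v \<in> Basis" for u v
    using second_partial(1)[OF D(1) ex] second_partial(1)[OF D(2) ex] second_partial(1)[OF D(3) ex]
      second_partial(1)[OF D(4) ex] that B unfolding Basis_real_prod
    by (auto simp del: partial_exists.simps)
  show "partial [(1, 0), (1, 0)] f (\<rho>, \<beta>) = 1 / (\<rho> * sqrt \<beta>) * opt_rho \<rho> \<beta> - opt \<rho> \<beta> / (\<rho>\<^sup>2 * sqrt \<beta>)"
    by (rule second_partial(2)[OF D(1) ex]) (fact B)+
  show "partial [(1, 0), (0, 1)] f (\<rho>, \<beta>) = mixed \<rho> \<beta>"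
    by (rule second_partial(2)[OF D(2) ex]) (fact B)+
  show "partial [(0, 1), (1, 0)] f (\<rho>, \<beta>) = mixed \<rho> \<beta>"
    by (rule second_partial(2)[OF D(3) ex]) (fact B)+
  show "partial [(0, 1), (0, 1)] f (\<rho>, \<beta>) = opt \<rho> \<beta> / \<beta> * opt_beta \<rho> \<beta> - 3 * slope \<rho> \<beta> / (2 * \<beta>)"
    by (rule second_partial(2)[OF D(4) ex]) (fact B)+
qed

context
  fixes m_c \<beta>_c :: real
  assumes m_c: "m_c > 0" and \<beta>_c: "\<beta>_c > 0" and sol: "transit m_c R_c = sqrt \<beta>_c"
    and crit: "transit_deriv m_c R_c = 0"
begin

section \<open>Continuity and divergence at the critical point\<close>

lemma critical_unique: "m \<ge> 0 \<Longrightarrow> transit m (ln (1 + rho_c)) = sqrt \<beta>_c \<Longrightarrow> m = m_c"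
  using transit_critical_inj[of m m_c] m_c sol by (simp add: R_c_def)

lemma opt_critical: "opt rho_c \<beta>_c = m_c"
  using opt_props[OF rho_c_pos \<beta>_c] by (intro critical_unique) auto

lemma eventually_positive: "\<forall>\<^sub>F p in nhds (rho_c, \<beta>_c). fst p > 0 \<and> snd p > 0"
proof -
  have "open ({0<..} \<times> {0<..} :: (real \<times> real) set)" by (intro open_Times) auto
  then have "\<forall>\<^sub>F p in nhds (rho_c, \<beta>_c). p \<in> {0<..} \<times> {0<..}"
    using rho_c_pos \<beta>_c by (intro eventually_nhds_in_open) auto
  then show ?thesis by eventually_elim auto
qed

lemma opt_tendsto: "((\<lambda>p. opt (fst p) (snd p)) \<longlongrightarrow> m_c) (nhds (rho_c, \<beta>_c))"
proof (rule tendstoI)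
  fix e :: real assume "e > 0"
  from transit_solution_close[OF rho_c_pos \<beta>_c critical_unique this]
  obtain \<delta> where \<delta>: "\<delta> > 0" "\<And>\<rho> \<beta> m. \<bar>\<rho> - rho_c\<bar> < \<delta> \<Longrightarrow> \<bar>\<beta> - \<beta>_c\<bar> < \<delta> \<Longrightarrow> m \<ge> 0 \<Longrightarrow>
      transit m (ln (1 + \<rho>)) = sqrt \<beta> \<Longrightarrow> \<bar>m - m_c\<bar> < e" by blast
  have "\<forall>\<^sub>F p in nhds (rho_c, \<beta>_c). dist p (rho_c, \<beta>_c) < \<delta>"
    using \<delta>(1) by (auto simp: eventually_nhds_metric)
  with eventually_positive show "\<forall>\<^sub>F p in nhds (rho_c, \<beta>_c). dist (opt (fst p) (snd p)) m_c < e"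
  proof eventually_elim
    case (elim p)
    have "\<bar>fst p - rho_c\<bar> < \<delta>" "\<bar>snd p - \<beta>_c\<bar> < \<delta>"
      using dist_fst_le[of p "(rho_c, \<beta>_c)"] dist_snd_le[of p "(rho_c, \<beta>_c)"] elim
      by (auto simp: dist_real_def)
    then show ?case
      using \<delta>(2)[of "fst p" "snd p" "opt (fst p) (snd p)"] opt_props[of "fst p" "snd p"] elim
      by (simp add: dist_real_def)
  qed
qed

lemma tendsto_fst_snd: "(fst \<longlongrightarrow> rho_c) (nhds (rho_c, \<beta>_c))" "(snd \<longlongrightarrow> \<beta>_c) (nhds (rho_c, \<beta>_c))"
  using tendsto_fst[OF filterlim_ident, of "(rho_c, \<beta>_c)"] tendsto_snd[OF filterlim_ident, of "(rho_c, \<beta>_c)"]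
  by simp_all

text \<open>A sandwich between two subgradient inequalities: the one based at the critical point
  bounds \<open>f p\<close> from below, the one based at \<open>p\<close> bounds it from
  above.\<close>

lemma f_tendsto: "(f \<longlongrightarrow> f (rho_c, \<beta>_c)) (nhds (rho_c, \<beta>_c))"
proof -
  \<comment> \<open>The upper bound contains \<open>slope\<close> at \<open>p\<close>, which itself
    involves \<open>f p\<close>. Collecting these terms multiplies \<open>f p\<close> by this
    factor, which tends to 1.\<close>
  define q where "q p = 1 + (snd p - \<beta>_c) / (2 * snd p)" for p :: "real \<times> real"
  define up where "up p = (f (rho_c, \<beta>_c) - (ln rho_c - ln (fst p)) * (opt (fst p) (snd p) / sqrt (snd p))
     - (\<beta>_c - snd p) * ((ln (1 + fst p) + (opt (fst p) (snd p))\<^sup>2) / (2 * snd p))) / q p" for p :: "real \<times> real"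
  define lo where "lo p = f (rho_c, \<beta>_c) + (ln (fst p) - ln rho_c) * (opt rho_c \<beta>_c / sqrt \<beta>_c)
     + (snd p - \<beta>_c) * slope rho_c \<beta>_c" for p
  note lims = tendsto_fst_snd opt_tendsto
  have "(q \<longlongrightarrow> 1 + (\<beta>_c - \<beta>_c) / (2 * \<beta>_c)) (nhds (rho_c, \<beta>_c))"
    unfolding q_def using \<beta>_c by (intro tendsto_intros lims) auto
  then have q1: "(q \<longlongrightarrow> 1) (nhds (rho_c, \<beta>_c))" by simp
  have "(up \<longlongrightarrow> (f (rho_c, \<beta>_c) - (ln rho_c - ln rho_c) * (m_c / sqrt \<beta>_c)
     - (\<beta>_c - \<beta>_c) * ((ln (1 + rho_c) + m_c\<^sup>2) / (2 * \<beta>_c))) / 1) (nhds (rho_c, \<beta>_c))"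
    unfolding up_def using \<beta>_c rho_c_pos by (intro tendsto_intros lims q1) auto
  then have up_lim: "(up \<longlongrightarrow> f (rho_c, \<beta>_c)) (nhds (rho_c, \<beta>_c))" by simp
  have "(lo \<longlongrightarrow> f (rho_c, \<beta>_c) + (ln rho_c - ln rho_c) * (opt rho_c \<beta>_c / sqrt \<beta>_c)
     + (\<beta>_c - \<beta>_c) * slope rho_c \<beta>_c) (nhds (rho_c, \<beta>_c))"
    unfolding lo_def using rho_c_pos by (intro tendsto_intros lims) auto
  then have lo_lim: "(lo \<longlongrightarrow> f (rho_c, \<beta>_c)) (nhds (rho_c, \<beta>_c))" by simp
  have q_pos: "\<forall>\<^sub>F p in nhds (rho_c, \<beta>_c). q p > 0" by (rule order_tendstoD(1)[OF q1]) simp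
  show ?thesis
  proof (rule tendsto_sandwich[OF _ _ lo_lim up_lim])
    show "\<forall>\<^sub>F p in nhds (rho_c, \<beta>_c). lo p \<le> f p"
      using eventually_positive
    proof eventually_elim
      case (elim p)
      then show ?case using subgradient[of f, OF f rho_c_pos \<beta>_c, of "fst p" "snd p"] by (simp add: lo_def)
    qed
    show "\<forall>\<^sub>F p in nhds (rho_c, \<beta>_c). f p \<le> up p"
      using eventually_positive q_pos
    proof eventually_elim
      case (elim p)
      define m where "m = opt (fst p) (snd p)"
      have "f p + (ln rho_c - ln (fst p)) * (m / sqrt (snd p)) + (\<beta>_c - snd p) * slope (fst p) (snd p) \<le> f (rho_c, \<beta>_c)"
        using subgradient[of f, OF f _ _ rho_c_pos \<beta>_c, of "fst p" "snd p"] elim by (simp add: m_def)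
      moreover have "(\<beta>_c - snd p) * slope (fst p) (snd p) =
          (\<beta>_c - snd p) * ((ln (1 + fst p) + m\<^sup>2) / (2 * snd p)) + (snd p - \<beta>_c) / (2 * snd p) * f p"
        using f[of "fst p" "snd p"] elim by (simp add: slope_def m_def field_simps)
      ultimately have "f p * q p \<le> f (rho_c, \<beta>_c) - (ln rho_c - ln (fst p)) * (m / sqrt (snd p))
         - (\<beta>_c - snd p) * ((ln (1 + fst p) + m\<^sup>2) / (2 * snd p))"
        by (simp add: q_def distrib_left mult.commute)
      then show ?case using elim unfolding up_def m_def by (simp add: pos_le_divide_eq)
    qed
  qed
qed

lemma slope_tendsto: "((\<lambda>p. slope (fst p) (snd p)) \<longlongrightarrow> slope rho_c \<beta>_c) (nhds (rho_c, \<beta>_c))"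
proof -
  have "((\<lambda>p. (ln (1 + fst p) + (opt (fst p) (snd p))\<^sup>2 - f p) / (2 * snd p)) \<longlongrightarrow>
     (ln (1 + rho_c) + m_c\<^sup>2 - f (rho_c, \<beta>_c)) / (2 * \<beta>_c)) (nhds (rho_c, \<beta>_c))"
    using rho_c_pos \<beta>_c by (intro tendsto_intros tendsto_fst_snd opt_tendsto f_tendsto) auto
  moreover have "(ln (1 + rho_c) + m_c\<^sup>2 - f (rho_c, \<beta>_c)) / (2 * \<beta>_c) = slope rho_c \<beta>_c"
    using f[OF rho_c_pos \<beta>_c] by (simp add: slope_def opt_critical)
  moreover have "\<forall>\<^sub>F p in nhds (rho_c, \<beta>_c). (ln (1 + fst p) + (opt (fst p) (snd p))\<^sup>2 - f p) / (2 * snd p) = slope (fst p) (snd p)"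
    using eventually_positive
  proof eventually_elim
    case (elim p)
    then show ?case using f[of "fst p" "snd p"] by (simp add: slope_def)
  qed
  ultimately show ?thesis by (simp add: tendsto_cong)
qed

lemma first_partials_critical:
  "((\<lambda>x. f (x, \<beta>_c)) has_real_derivative m_c / (rho_c * sqrt \<beta>_c)) (at rho_c)"
  "((\<lambda>y. f (rho_c, y)) has_real_derivative slope rho_c \<beta>_c) (at \<beta>_c)"
proof -
  have fl1: "filterlim (\<lambda>t. (t, \<beta>_c)) (nhds (rho_c, \<beta>_c)) (at rho_c)"
    by (intro tendsto_Pair tendsto_ident_at tendsto_const)
  have fl2: "filterlim (\<lambda>t. (rho_c, t)) (nhds (rho_c, \<beta>_c)) (at \<beta>_c)"
    by (intro tendsto_Pair tendsto_ident_at tendsto_const)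
  have "((\<lambda>x. f (x, \<beta>_c)) has_real_derivative 1 / rho_c * (m_c / sqrt \<beta>_c)) (at rho_c)"
  proof (rule DERIV_of_subgradients)
    \<comment> \<open>The subgradient inequality is linear in \<open>ln \<rho>\<close>, so the
      logarithm is the inner function here.\<close>
    show "(ln has_real_derivative 1 / rho_c) (at rho_c)"
      using rho_c_pos by (auto intro!: derivative_eq_intros)
    show "((\<lambda>t. opt t \<beta>_c / sqrt \<beta>_c) \<longlongrightarrow> m_c / sqrt \<beta>_c) (at rho_c)"
      using filterlim_compose[OF opt_tendsto fl1] \<beta>_c by (intro tendsto_intros) auto
    show "\<forall>\<^sub>F t in at rho_c. (ln t - ln rho_c) * (m_c / sqrt \<beta>_c) \<le> f (t, \<beta>_c) - f (rho_c, \<beta>_c) \<and>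
       (ln rho_c - ln t) * (opt t \<beta>_c / sqrt \<beta>_c) \<le> f (rho_c, \<beta>_c) - f (t, \<beta>_c)"
      using eventually_compose_filterlim[OF eventually_positive fl1]
    proof eventually_elim
      case (elim t)
      then show ?case
        using subgradient[of f, OF f rho_c_pos \<beta>_c, of t \<beta>_c] subgradient[of f, OF f _ \<beta>_c rho_c_pos \<beta>_c, of t]
        by (simp add: opt_critical)
    qed
  qed
  then show "((\<lambda>x. f (x, \<beta>_c)) has_real_derivative m_c / (rho_c * sqrt \<beta>_c)) (at rho_c)" by simp
  have "((\<lambda>y. f (rho_c, y)) has_real_derivative 1 * slope rho_c \<beta>_c) (at \<beta>_c)"
  proof (rule DERIV_of_subgradients)
    show "((\<lambda>y. y) has_real_derivative 1) (at \<beta>_c)" by (rule DERIV_ident)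
    show "((\<lambda>t. slope rho_c t) \<longlongrightarrow> slope rho_c \<beta>_c) (at \<beta>_c)"
      using filterlim_compose[OF slope_tendsto fl2] by simp
    show "\<forall>\<^sub>F t in at \<beta>_c. (t - \<beta>_c) * slope rho_c \<beta>_c \<le> f (rho_c, t) - f (rho_c, \<beta>_c) \<and>
       (\<beta>_c - t) * slope rho_c t \<le> f (rho_c, \<beta>_c) - f (rho_c, t)"
      using eventually_compose_filterlim[OF eventually_positive fl2]
    proof eventually_elim
      case (elim t)
      then show ?case
        using subgradient[of f, OF f rho_c_pos \<beta>_c rho_c_pos, of t] subgradient[of f, OF f rho_c_pos _ rho_c_pos \<beta>_c, of t]
        by simp
    qed
  qed
  then show "((\<lambda>y. f (rho_c, y)) has_real_derivative slope rho_c \<beta>_c) (at \<beta>_c)" by simp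
qed

text \<open>Wherever a first partial exists it equals an expression in \<open>opt\<close> and
  \<open>slope\<close>, and these converge along the full neighbourhood filter; so the limit can be
  restricted to the domain of the partial.\<close>

lemma partial_continuous_critical:
  assumes vs: "set vs \<subseteq> Basis" "length vs < 2"
  shows "partial_continuous_at vs f (rho_c, \<beta>_c)"
proof (cases vs)
  case Nil
  have "partial [] f = f" by (rule ext) simp
  then show ?thesis
    using f_tendsto Nil by (simp add: partial_continuous_at_def continuous_within tendsto_at_iff_tendsto_nhds[of f, symmetric])
next
  case (Cons v vs')
  then have v: "vs = [v]" "v = (1, 0) \<or> v = (0, 1)" using vs by (auto simp: Basis_real_prod)
  from v(2) show ?thesis
  proof
    assume v1: "v = (1, 0)"
    have "((\<lambda>p. opt (fst p) (snd p) / (fst p * sqrt (snd p))) \<longlongrightarrow> m_c / (rho_c * sqrt \<beta>_c))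
       (at (rho_c, \<beta>_c) within {q. partial_exists vs f q})"
      using rho_c_pos \<beta>_c
      by (intro tendsto_intros tendsto_mono[OF at_within_le_nhds] tendsto_fst_snd opt_tendsto) auto
    moreover have "\<forall>\<^sub>F p in at (rho_c, \<beta>_c) within {q. partial_exists vs f q}.
       opt (fst p) (snd p) / (fst p * sqrt (snd p)) = partial vs f p"
    proof -
      have "\<forall>\<^sub>F p in at (rho_c, \<beta>_c) within {q. partial_exists vs f q}. fst p > 0 \<and> snd p > 0"
        using eventually_positive at_within_le_nhds by (rule filter_leD[rotated])
      moreover have "\<forall>\<^sub>F p in at (rho_c, \<beta>_c) within {q. partial_exists vs f q}. partial_exists vs f p"
        by (simp add: eventually_at_filter del: partial_exists.simps)
      ultimately show ?thesis
      proof eventually_elim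
        case (elim p)
        obtain \<rho> \<beta> where p: "p = (\<rho>, \<beta>)" by (cases p)
        then obtain D where D: "((\<lambda>x. f (x, \<beta>)) has_real_derivative D) (at \<rho>)"
          using elim by (auto simp: v v1 partial_exists_fst simp del: partial_exists.simps)
        show ?case
          using partial_rho_eq[of f, OF f _ _ D] DERIV_imp_deriv[OF D] elim
          by (simp add: p v v1 partial_fst del: partial.simps)
      qed
    qed
    ultimately have "(partial vs f \<longlongrightarrow> m_c / (rho_c * sqrt \<beta>_c)) (at (rho_c, \<beta>_c) within {q. partial_exists vs f q})"
      using tendsto_cong by fastforce
    moreover have "partial vs f (rho_c, \<beta>_c) = m_c / (rho_c * sqrt \<beta>_c)"
      using DERIV_imp_deriv[OF first_partials_critical(1)] by (simp add: v v1 partial_fst del: partial.simps)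
    moreover have "partial_exists vs f (rho_c, \<beta>_c)"
      using first_partials_critical(1) by (auto simp: v v1 partial_exists_fst simp del: partial_exists.simps)
    ultimately show ?thesis
      by (simp add: partial_continuous_at_def continuous_within del: partial.simps partial_exists.simps)
  next
    assume v2: "v = (0, 1)"
    have "((\<lambda>p. slope (fst p) (snd p)) \<longlongrightarrow> slope rho_c \<beta>_c)
       (at (rho_c, \<beta>_c) within {q. partial_exists vs f q})"
      by (rule tendsto_mono[OF at_within_le_nhds slope_tendsto])
    moreover have "\<forall>\<^sub>F p in at (rho_c, \<beta>_c) within {q. partial_exists vs f q}.
       slope (fst p) (snd p) = partial vs f p"
    proof -
      have "\<forall>\<^sub>F p in at (rho_c, \<beta>_c) within {q. partial_exists vs f q}. fst p > 0 \<and> snd p > 0"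
        using eventually_positive at_within_le_nhds by (rule filter_leD[rotated])
      moreover have "\<forall>\<^sub>F p in at (rho_c, \<beta>_c) within {q. partial_exists vs f q}. partial_exists vs f p"
        by (simp add: eventually_at_filter del: partial_exists.simps)
      ultimately show ?thesis
      proof eventually_elim
        case (elim p)
        obtain \<rho> \<beta> where p: "p = (\<rho>, \<beta>)" by (cases p)
        then obtain D where D: "((\<lambda>y. f (\<rho>, y)) has_real_derivative D) (at \<beta>)"
          using elim by (auto simp: v v2 partial_exists_snd simp del: partial_exists.simps)
        show ?case
          using partial_beta_eq[of f, OF f _ _ D] DERIV_imp_deriv[OF D] elim
          by (simp add: p v v2 partial_snd del: partial.simps)
      qed
    qed
    ultimately have "(partial vs f \<longlongrightarrow> slope rho_c \<beta>_c) (at (rho_c, \<beta>_c) within {q. partial_exists vs f q})"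
      using tendsto_cong by fastforce
    moreover have "partial vs f (rho_c, \<beta>_c) = slope rho_c \<beta>_c"
      using DERIV_imp_deriv[OF first_partials_critical(2)] by (simp add: v v2 partial_snd del: partial.simps)
    moreover have "partial_exists vs f (rho_c, \<beta>_c)"
      using first_partials_critical(2) by (auto simp: v v2 partial_exists_snd simp del: partial_exists.simps)
    ultimately show ?thesis
      by (simp add: partial_continuous_at_def continuous_within del: partial.simps partial_exists.simps)
  qed
qed

text \<open>The divergence passes from \<open>1 / curvature\<close> to \<open>opt_beta\<close>, then
  to \<open>mixed\<close>, then to \<open>opt_rho\<close>: at each stage a factor with positive
  limit is multiplied by the diverging one and a convergent term is added.\<close>

lemma critical_second_partials_infinite:
  assumes uv: "u \<in> Basis" "v \<in> Basis"
  shows "partial_infinite_at [u, v] f (rho_c, \<beta>_c)"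
proof -
  define A where "A = analytic_points f"
  define \<F> where "\<F> = at (rho_c, \<beta>_c) within A"
  have le: "\<F> \<le> nhds (rho_c, \<beta>_c)" by (simp add: \<F>_def at_within_le_nhds)
  note lims = tendsto_mono[OF le tendsto_fst_snd(1)] tendsto_mono[OF le tendsto_fst_snd(2)]
    tendsto_mono[OF le opt_tendsto] tendsto_mono[OF le slope_tendsto]
  have inA: "\<forall>\<^sub>F p in \<F>. p \<in> A" by (simp add: \<F>_def eventually_at_filter)
  have "((\<lambda>p. case (opt (fst p) (snd p), ln (1 + fst p)) of (m, R) \<Rightarrow> transit_deriv m R) \<longlongrightarrow>
      (case (m_c, ln (1 + rho_c)) of (m, R) \<Rightarrow> transit_deriv m R)) \<F>"
  proof (rule continuous_on_tendsto_compose[OF continuous_on_transit_deriv])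
    show "((\<lambda>p. (opt (fst p) (snd p), ln (1 + fst p))) \<longlongrightarrow> (m_c, ln (1 + rho_c))) \<F>"
      using rho_c_pos by (intro tendsto_intros lims) auto
    show "\<forall>\<^sub>F p in \<F>. (opt (fst p) (snd p), ln (1 + fst p)) \<in> regular"
      using filter_leD[OF le eventually_positive] by eventually_elim (auto intro!: regular_real ln_gt_zero)
  qed (use rho_c_pos in \<open>auto intro!: regular_real\<close>)
  then have curv0: "((\<lambda>p. curvature (fst p) (snd p)) \<longlongrightarrow> 0) \<F>"
    using crit by (simp add: curvature_def R_c_def)
  have curv_pos: "\<forall>\<^sub>F p in \<F>. 0 < curvature (fst p) (snd p)"
    using inA by eventually_elim (use analytic_second_derivs(1)[of f, OF f] in \<open>auto simp: A_def\<close>)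
  have curv: "filterlim (\<lambda>p. 1 / curvature (fst p) (snd p)) at_top \<F>"
    using filterlim_inverse_at_top[OF curv0 curv_pos] by (simp add: inverse_eq_divide)
  have l1: "((\<lambda>p. 1 / (2 * sqrt (snd p))) \<longlongrightarrow> 1 / (2 * sqrt \<beta>_c)) \<F>"
    and l2: "((\<lambda>p. 1 / (fst p * sqrt (snd p))) \<longlongrightarrow> 1 / (rho_c * sqrt \<beta>_c)) \<F>"
    and l3: "((\<lambda>p. opt (fst p) (snd p) / (2 * fst p * snd p * sqrt (snd p))) \<longlongrightarrow>
      m_c / (2 * rho_c * \<beta>_c * sqrt \<beta>_c)) \<F>"
    and l4: "((\<lambda>p. opt (fst p) (snd p) / ((fst p)\<^sup>2 * sqrt (snd p))) \<longlongrightarrow> m_c / (rho_c\<^sup>2 * sqrt \<beta>_c)) \<F>"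
    and l5: "((\<lambda>p. opt (fst p) (snd p) / snd p) \<longlongrightarrow> m_c / \<beta>_c) \<F>"
    and l6: "((\<lambda>p. 3 * slope (fst p) (snd p) / (2 * snd p)) \<longlongrightarrow> 3 * slope rho_c \<beta>_c / (2 * \<beta>_c)) \<F>"
    and l7: "((\<lambda>p. 2 * snd p) \<longlongrightarrow> 2 * \<beta>_c) \<F>"
    by (intro tendsto_intros lims; use \<beta>_c rho_c_pos in simp)+
  have ob: "filterlim (\<lambda>p. opt_beta (fst p) (snd p)) at_top \<F>"
    unfolding opt_beta_def
    by (rule filterlim_tendsto_pos_mult_at_top[OF l1 _ curv]) (use \<beta>_c in simp)
  have add: "filterlim (\<lambda>p. g p - h p) at_top \<F>" if "filterlim g at_top \<F>" "(h \<longlongrightarrow> l) \<F>" for g h :: "real \<times> real \<Rightarrow> real" and l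
    using filterlim_tendsto_add_at_top[OF tendsto_minus[OF that(2)] that(1)] by simp
  have mx: "filterlim (\<lambda>p. mixed (fst p) (snd p)) at_top \<F>"
    unfolding mixed_def
    by (rule add[OF filterlim_tendsto_pos_mult_at_top[OF l2 _ ob] l3]) (use \<beta>_c rho_c_pos in simp)
  have orho: "filterlim (\<lambda>p. opt_rho (fst p) (snd p)) at_top \<F>"
  proof -
    have 1: "((\<lambda>p. 1 / (2 * opt (fst p) (snd p))) \<longlongrightarrow> 1 / (2 * m_c)) \<F>"
      using m_c by (intro tendsto_intros lims) auto
    have 2: "((\<lambda>p. opt (fst p) (snd p) / (fst p * sqrt (snd p)) - 1 / (1 + fst p)) \<longlongrightarrow>
        m_c / (rho_c * sqrt \<beta>_c) - 1 / (1 + rho_c)) \<F>"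
      using \<beta>_c rho_c_pos by (intro tendsto_intros lims) auto
    have 3: "filterlim (\<lambda>p. 2 * snd p * mixed (fst p) (snd p)) at_top \<F>"
      by (rule filterlim_tendsto_pos_mult_at_top[OF l7 _ mx]) (use \<beta>_c in simp)
    have "filterlim (\<lambda>p. 1 / (2 * opt (fst p) (snd p)) * (opt (fst p) (snd p) / (fst p * sqrt (snd p)) - 1 / (1 + fst p)
        + 2 * snd p * mixed (fst p) (snd p))) at_top \<F>"
      by (rule filterlim_tendsto_pos_mult_at_top[OF 1 _ filterlim_tendsto_add_at_top[OF 2 3]]) (use m_c in simp)
    then show ?thesis by (simp add: opt_rho_def add.commute)
  qed
  have rr: "filterlim (\<lambda>p. 1 / (fst p * sqrt (snd p)) * opt_rho (fst p) (snd p) - opt (fst p) (snd p) / ((fst p)\<^sup>2 * sqrt (snd p))) at_top \<F>"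
    by (rule add[OF filterlim_tendsto_pos_mult_at_top[OF l2 _ orho] l4]) (use \<beta>_c rho_c_pos in simp)
  have bb: "filterlim (\<lambda>p. opt (fst p) (snd p) / snd p * opt_beta (fst p) (snd p) - 3 * slope (fst p) (snd p) / (2 * snd p)) at_top \<F>"
    by (rule add[OF filterlim_tendsto_pos_mult_at_top[OF l5 _ ob] l6]) (use \<beta>_c m_c in simp)
  have cong: "filterlim (partial [u, v] f) at_top \<F>"
    if "filterlim g at_top \<F>" "\<And>\<rho> \<beta>. (\<rho>, \<beta>) \<in> A \<Longrightarrow> partial [u, v] f (\<rho>, \<beta>) = g (\<rho>, \<beta>)" for g u v
  proof -
    have ev: "\<forall>\<^sub>F p in \<F>. g p = partial [u, v] f p"
      using inA by eventually_elim (use that(2) in \<open>metis surj_pair\<close>)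
    show ?thesis using that(1) filterlim_cong[OF refl refl ev, of at_top] by blast
  qed
  have "filterlim (partial [u, v] f) at_top \<F>"
    using cong[OF rr, of "(1, 0)" "(1, 0)"] cong[OF mx, of "(1, 0)" "(0, 1)"] cong[OF mx, of "(0, 1)" "(1, 0)"]
      cong[OF bb, of "(0, 1)" "(0, 1)"] uv analytic_second_partials(2-5)
    by (auto simp: Basis_real_prod A_def simp del: partial.simps)
  then show ?thesis by (simp add: partial_infinite_at_def \<F>_def A_def)
qed

text \<open>The curvature is positive at analytic points and vanishes here.\<close>

lemma critical_not_analytic: "(rho_c, \<beta>_c) \<notin> analytic_points f"
proof
  assume "(rho_c, \<beta>_c) \<in> analytic_points f"
  from analytic_second_derivs(1)[of f, OF f this] show False
    using crit by (simp add: curvature_def opt_critical R_c_def)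
qed

text \<open>On the vertical line through the critical point the solution stays unique and becomes nondegenerate
  just above it. So a vertical segment ending at the critical point lies in the interior of the analytic points.\<close>

lemma critical_phase: "\<exists>P. is_phase f P \<and> (rho_c, \<beta>_c) \<in> frontier P"
proof -
  obtain \<epsilon> where \<epsilon>: "\<epsilon> > 0" "\<And>x. m_c < x \<Longrightarrow> x < m_c + \<epsilon> \<Longrightarrow> transit_deriv x R_c > 0"
    using transit_deriv_critical_pos_right[OF m_c] by blast
  \<comment> \<open>The vertical line is parametrised by the solution itself: \<open>x\<close> is
    the unique solution at the point \<open>\<gamma> x\<close>.\<close>
  define \<gamma> where "\<gamma> x = (rho_c, (transit x R_c)\<^sup>2)" for x
  define L where "L = \<gamma> ` {m_c<..<m_c + \<epsilon>}"
  have cont: "continuous_on UNIV \<gamma>"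
    unfolding \<gamma>_def
    by (intro continuous_intros DERIV_continuous_on[OF has_field_derivative_at_within[OF transit_has_real_derivative[OF R_c_pos]]])
  have L_int: "L \<subseteq> interior (analytic_points f)"
  proof
    fix p assume "p \<in> L"
    then obtain x where x: "m_c < x" "x < m_c + \<epsilon>" "p = \<gamma> x" by (auto simp: L_def)
    have xpos: "x > 0" using x m_c by simp
    define b where "b = (transit x R_c)\<^sup>2"
    have tpos: "transit x R_c > 0" using transit_ge[OF R_c_pos, of x] xpos by simp
    have b: "b > 0" "sqrt b = transit x R_c" using tpos by (auto simp: b_def)
    have "\<exists>\<delta>>0. \<forall>p\<in>ball (rho_c, b) \<delta>. p \<in> analytic_points f"
    proof (rule free_energy_analytic[OF rho_c_pos b(1) xpos _ refl _ _ f])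
      show "transit x (ln (1 + rho_c)) = sqrt b" "transit_deriv x (ln (1 + rho_c)) \<noteq> 0"
        using b \<epsilon>(2)[OF x(1,2)] by (simp_all add: R_c_def)
      show "m = x" if "m \<ge> 0" "transit m (ln (1 + rho_c)) = sqrt b" for m
        using transit_critical_inj[of m x] that xpos b by (simp add: R_c_def)
    qed
    then show "p \<in> interior (analytic_points f)"
      by (auto simp: mem_interior x(3) \<gamma>_def b_def)
  qed
  have conn: "connected L"
    unfolding L_def by (rule connected_continuous_image[OF continuous_on_subset[OF cont]]) auto
  define x0 where "x0 = \<gamma> (m_c + \<epsilon> / 2)"
  have x0: "x0 \<in> L" using \<epsilon>(1) by (simp add: x0_def L_def)
  \<comment> \<open>Regions are open by definition, so a maximal one is a component of the interior
    of the analytic points.\<close>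
  define P where "P = connected_component_set (interior (analytic_points f)) x0"
  have LP: "L \<subseteq> P" unfolding P_def by (rule connected_component_maximal[OF x0 conn L_int])
  have P_sub: "P \<subseteq> interior (analytic_points f)" unfolding P_def by (rule connected_component_subset)
  have oP: "open P" unfolding P_def by (intro open_connected_component) simp
  have phase: "is_phase f P"
    unfolding is_phase_def
  proof (intro conjI allI impI)
    show "analytic_region f P"
      unfolding analytic_region_def
    proof (intro conjI)
      show "P \<noteq> {}" using LP x0 by blast
      show "connected P" unfolding P_def by (rule connected_connected_component)
      show "P \<subseteq> analytic_points f" using P_sub interior_subset by (rule subset_trans)
    qed (rule oP)
    fix Q assume Q: "analytic_region f Q \<and> P \<subseteq> Q"
    then have "Q \<subseteq> interior (analytic_points f)" "connected Q" "x0 \<in> Q"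
      using LP x0 by (auto simp: analytic_region_def intro: interior_maximal[THEN subsetD])
    then have "Q \<subseteq> P" unfolding P_def by (intro connected_component_maximal)
    then show "Q = P" using Q by blast
  qed
  have "(rho_c, \<beta>_c) \<notin> P" using critical_not_analytic P_sub interior_subset by blast
  moreover have "(rho_c, \<beta>_c) \<in> closure P"
  proof -
    have \<gamma>c: "\<gamma> m_c = (rho_c, \<beta>_c)" using \<beta>_c by (simp add: \<gamma>_def sol)
    have "(\<lambda>n. m_c + \<epsilon> / 2 / real (Suc n)) \<longlonglongrightarrow> m_c + 0"
      by (intro tendsto_intros LIMSEQ_Suc[OF lim_const_over_n])
    then have "(\<lambda>n. \<gamma> (m_c + \<epsilon> / 2 / real (Suc n))) \<longlonglongrightarrow> \<gamma> (m_c + 0)"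
      by (rule continuous_on_tendsto_compose[OF cont]) auto
    moreover have "\<gamma> (m_c + \<epsilon> / 2 / real (Suc n)) \<in> P" for n
    proof -
      define t where "t = \<epsilon> / 2 / real (Suc n)"
      have "t \<le> \<epsilon> / 2 / 1" unfolding t_def using \<epsilon>(1) by (intro divide_left_mono) auto
      moreover have "t > 0" using \<epsilon>(1) by (simp add: t_def)
      ultimately have "\<gamma> (m_c + t) \<in> L" using \<epsilon>(1) unfolding L_def by (intro imageI) auto
      then show ?thesis using LP unfolding t_def by blast
    qed
    ultimately show ?thesis unfolding closure_sequential using \<gamma>c by (intro exI[of _ "\<lambda>n. \<gamma> (m_c + \<epsilon> / 2 / real (Suc n))"]) simp
  qed
  ultimately have "(rho_c, \<beta>_c) \<in> frontier P" using oP by (simp add: frontier_def interior_open)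
  then show ?thesis using phase by blast
qed

text \<open>The critical point is a limit of analytic points, at which the second partials exist and
  along which they diverge. A finite limit relative to the larger domain of the partial is then
  impossible.\<close>

lemma critical_second_order: "phase_transition 2 f (rho_c, \<beta>_c)"
proof -
  obtain P where P: "is_phase f P" "(rho_c, \<beta>_c) \<in> frontier P" using critical_phase by blast
  have limpt: "(rho_c, \<beta>_c) islimpt analytic_points f"
  proof -
    have "P \<subseteq> analytic_points f" using P(1) by (simp add: is_phase_def analytic_region_def)
    then have "(rho_c, \<beta>_c) \<in> closure (analytic_points f)"
      using P(2) closure_mono by (auto simp: frontier_def)
    then show ?thesis using critical_not_analytic by (simp add: closure_def)
  qed
  have B: "(1, 0) \<in> (Basis :: (real \<times> real) set)" by (simp add: Basis_real_prod)
  have "\<not> partial_continuous_at [(1, 0), (1, 0)] f (rho_c, \<beta>_c)"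
  proof
    assume "partial_continuous_at [(1, 0), (1, 0)] f (rho_c, \<beta>_c)"
    then have "(partial [(1, 0), (1, 0)] f \<longlongrightarrow> partial [(1, 0), (1, 0)] f (rho_c, \<beta>_c))
       (at (rho_c, \<beta>_c) within {q. partial_exists [(1, 0), (1, 0)] f q})"
      by (simp add: partial_continuous_at_def continuous_within del: partial.simps partial_exists.simps)
    moreover have "analytic_points f \<subseteq> {q. partial_exists [(1, 0), (1, 0)] f q}"
      using analytic_second_partials(1)[OF _ B B] by (auto simp del: partial_exists.simps)
    ultimately have "(partial [(1, 0), (1, 0)] f \<longlongrightarrow> partial [(1, 0), (1, 0)] f (rho_c, \<beta>_c))
       (at (rho_c, \<beta>_c) within analytic_points f)"
      by (rule tendsto_within_subset)
    moreover have "filterlim (partial [(1, 0), (1, 0)] f) at_infinity (at (rho_c, \<beta>_c) within analytic_points f)"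
      using critical_second_partials_infinite[OF B B] unfolding partial_infinite_at_def
      by (rule filterlim_at_top_imp_at_infinity)
    ultimately show False
      using limpt not_tendsto_and_filterlim_at_infinity by (metis trivial_limit_within)
  qed
  moreover have "set [(1, 0), (1, 0)] \<subseteq> (Basis :: (real \<times> real) set)" using B by simp
  ultimately show ?thesis
    unfolding phase_transition_def
    using P partial_continuous_critical rho_c_pos \<beta>_c
    by (intro conjI exI[of _ P] exI[of _ "[(1, 0), (1, 0)]"]) (auto simp: parameter_space_def simp del: partial.simps partial_exists.simps)
qed

end

end

theorem proposition19:
  fixes M :: "'a measure" and W :: "real \<Rightarrow> 'a \<Rightarrow> real" and x0 a_c \<beta>_c :: real
  assumes "standard_brownian_motion M W"
    and "x0 > 0"
    and "a_c > ln rho_c"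
    and "((\<lambda>a. F a rho_c) has_real_derivative 0) (at a_c)"
    and "2 * sqrt \<beta>_c = F a_c rho_c"
  shows "phase_transition 2 (lyapunov_exponent M W x0) (rho_c, \<beta>_c) \<and>
    (\<forall>u\<in>Basis. \<forall>v\<in>Basis. partial_infinite_at [u, v] (lyapunov_exponent M W x0) (rho_c, \<beta>_c))"
proof -
  \<comment> \<open>The value of \<open>m\<close> that belongs to \<open>a_c\<close>. Since
    \<open>sig a_c / m_c\<close> is positive, the vanishing derivative of \<open>F\<close> becomes a
    zero of \<open>transit_deriv\<close>.\<close>
  define m_c where "m_c = sqrt (softplus a_c - ln (1 + rho_c))"
  have m_c: "m_c > 0" using softplus_diff_pos[OF rho_c_pos assms(3)] by (simp add: m_c_def)
  have sol: "transit m_c R_c = sqrt \<beta>_c"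
    using assms(5) F_eq_transit[OF rho_c_pos assms(3)] by (simp add: m_c_def R_c_def)
  have "m_c \<le> transit m_c R_c" using R_c_pos m_c by (intro transit_ge) auto
  then have "0 < sqrt \<beta>_c" using m_c unfolding sol by linarith
  then have \<beta>_c: "\<beta>_c > 0" by simp
  have "transit_deriv m_c R_c * (sig a_c / m_c) = 0"
    using DERIV_unique[OF F_has_derivative[OF rho_c_pos assms(3)] assms(4)] by (simp add: m_c_def R_c_def)
  then have crit: "transit_deriv m_c R_c = 0" using m_c sig_bounds(1)[of a_c] by simp
  have f: "lyapunov_exponent M W x0 (\<rho>, \<beta>) = free_energy (ln \<rho>) \<beta>" if "\<rho> > 0" "\<beta> > 0" for \<rho> \<beta>
    by (rule lyapunov_exponent_eq[OF assms(1,2) that])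
  show ?thesis
    using critical_second_order[OF f m_c \<beta>_c sol crit] critical_second_partials_infinite[OF f m_c \<beta>_c sol crit]
    by blast
qed

end
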